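(* Let $0<n<N$, $k=N-n$. For all $\lambda,\mu\in\Pi_{n,k}$ the normalised partition functions of the vicious and osculating walker models satisfy $$\tilde Z_{\lambda,\mu}(x_1,\dots,x_n|t)=\sum_{d\ge0}q^d\,s_{\lambda^\vee/d/\mu^\vee}(x|T),\qquad \tilde Z'_{\lambda,\mu}(x_1,\dots,x_k|t)=\sum_{d\ge0}q^d\,s_{\lambda^*/d/\mu^*}(x|-t),$$ where the right-hand sides are the generalised factorial skew Schur functions; equivalently, $$\tilde Z_{\lambda,\mu}(x|t)=\sum_{\nu\in\Pi_{n,k},\,d\ge0}q^dC_{\mu\nu}^{\lambda,d}(T)\,s_{\nu^\vee}(x|T),\qquad \tilde Z'_{\lambda,\mu}(x|t)=\sum_{\nu\in\Pi_{n,k},\,d\ge0}q^dC_{\mu\nu}^{\lambda,d}(T)\,s_{\nu^*}(x|-t).$$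
   Context: Set $\Lambda=\mathbb Z[T_1,\dots,T_N]$, $t_i:=T_{N+1-i}$; $T=(T_1,\dots,T_N)$, $t=(t_1,\dots,t_N)$. $\mathcal V=\Lambda[q]\otimes V^{\otimes N}$ is free over $\Lambda[q]$ with basis $v_{\varepsilon_1}\otimes\cdots\otimes v_{\varepsilon_N}$, $\varepsilon_j\in\{0,1\}$; $\mathcal V_n$ is the span of those with $\sum\varepsilon_j=n$. $\Pi_{n,k}=\{\lambda:k\ge\lambda_1\ge\dots\ge\lambda_n\ge0\}$; $|\lambda\rangle$ is the basis vector of $\mathcal V_n$ with $\varepsilon_j=1$ iff $j=\lambda_{n+1-i}+i$ for some $i$, and $\langle\lambda|$ is the dual basis. $\lambda'$ is the conjugate of $\lambda$, $\lambda^\vee=(k-\lambda_n,\dots,k-\lambda_1)$, $\lambda^*=(\lambda^\vee)'\in\Pi_{k,n}$ (for partitions in $\Pi_{k,n}$, $\vee$ is the complement in the $k\times n$ box). $\sigma^+v_0=v_1$, $\sigma^+v_1=0$, $\sigma^-v_1=v_0$, $\sigma^-v_0=0$; $$L_j(x)=\begin{pmatrix}1-xt_j\sigma_j^-\sigma_j^+ & x\sigma_j^+\\ \sigma_j^- & x\sigma_j^-\sigma_j^+\end{pmatrix},\qquad L'_j(x)=\begin{pmatrix}1+xt_j\sigma_j^+\sigma_j^- & x\sigma_j^+\\ \sigma_j^- & x\sigma_j^+\sigma_j^-\end{pmatrix},$$ $L_N\cdots L_1=\begin{pmatrix}A&B\\C&D\end{pmatrix}$, $L'_N\cdots L'_1=\begin{pmatrix}A'&B'\\C'&D'\end{pmatrix}$,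 $H(x)=A+qD$, $E(x)=A'+qD'=\sum_rE_rx^r$. The partition functions are weighted sums over vicious (osculating) lattice path configurations on an $n\times N$ ($k\times N$) square lattice wrapped on a cylinder, with vertex weights the matrix elements of $L$ ($L'$), a factor $q$ per path crossing the gluing line, and start/end positions given by $\mu$/$\lambda$; they equal the matrix elements $Z_{\lambda,\mu}(x|t)=\langle\lambda|H(x_n)\cdots H(x_1)|\mu\rangle$ and $Z'_{\lambda,\mu}(x|t)=\langle\lambda|E(x_k)\cdots E(x_1)|\mu\rangle$. Put $\tilde Z_{\lambda,\mu}(x|t)=(x_1\cdots x_n)^kZ_{\lambda,\mu}(x_1^{-1},\dots,x_n^{-1}|t)$ and $\tilde Z'_{\lambda,\mu}(x|t)=(x_1\cdots x_k)^nZ'_{\lambda,\mu}(x_1^{-1},\dots,x_k^{-1}|t)$. Structure constants: $S_\lambda=\det(E_{\lambda'_i-i+j})_{1\le i,j\le k}$ ($E_r=0$ for $r<0$), $\tilde S_\lambda=\sum_{\mu\subseteq\lambda}(-1)^{|\lambda/\mu|}\det(e_{\lambda_i-\mu_j-i+j}(t_1,\dots,t_{n+\lambda_i-i}))_{1\le i,j\le n}S_\mu$ on $\mathcal V_n$, and $\langle\nu|\tilde S_\lambda|\mu\rangle=\sum_{d\ge0}q^dC_{\lambda\mu}^{\nu,d}(T)$ with $C_{\lambda\mu}^{\nu,d}(T)\in\Lambda$. These are the equivariant 3-point genus zero Gromov–Witten invariants of $\mathrm{Gr}_{n,N}$. Given parameters $a=(a_1,\dots,a_N)$, $C_{\lambda\mu}^{\nu,d}(a)$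 denotes the polynomial with $T_i$ replaced by $a_i$. The same definitions with $n,k$ exchanged are used for partitions in $\Pi_{k,n}$. Factorial Schur functions in $m$ variables: $s_\lambda(x|a)=\det[(x_j|a)^{\lambda_i+m-i}]/\det[(x_j|a)^{m-i}]$, $(x|a)^r=\prod_{i=1}^r(x-a_i)$. Generalised factorial skew Schur functions: for $\lambda,\mu\in\Pi_{m,N-m}$ and parameters $a$, $s_{\lambda/d/\mu}(x|a)=\sum_{\nu\in\Pi_{m,N-m}}C_{\mu^\vee\nu^\vee}^{\lambda^\vee,d}(a)\,s_\nu(x|a)$. *)

theory Defs
  imports
    "HOL-Library.Poly_Mapping"
    "HOL-Library.FuncSet"
    "HOL-Combinatorics.Permutations"
    "HOL-Computational_Algebra.Polynomial_Factorial"
    "Jordan_Normal_Form.Determinant"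
begin

section \<open>Coefficient rings\<close>

text \<open>Polynomials over the integers in the indeterminates \<open>T\<^sub>0, T\<^sub>1, \<dots>\<close>; only
  \<open>T\<^sub>1, \<dots>, T\<^sub>N\<close> ever occur below, so that everything lives in the subring
  \<open>\<Lambda> = \<int>[T\<^sub>1, \<dots>, T\<^sub>N]\<close>.\<close>

type_synonym Lam = "(nat \<Rightarrow>\<^sub>0 nat) \<Rightarrow>\<^sub>0 int"

definition T_var :: "nat \<Rightarrow> Lam" where
  "T_var i = Poly_Mapping.single (Poly_Mapping.single i 1) 1"

text \<open>The polynomial \<open>p\<close> with each \<open>T\<^sub>i\<close> replaced by \<open>a i\<close>.\<close>

definition subst_T :: "(nat \<Rightarrow> 'a::comm_ring_1) \<Rightarrow> Lam \<Rightarrow> 'a" where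
  "subst_T a p = (\<Sum>e\<in>Poly_Mapping.keys p.
     of_int (Poly_Mapping.lookup p e) *
     (\<Prod>i\<in>Poly_Mapping.keys e. a i ^ Poly_Mapping.lookup e i))"

text \<open>The identities to be stated are identities of rational functions in independent
  indeterminates \<open>T\<^sub>i\<close>, \<open>q\<close> and \<open>x\<^sub>j\<close>: they live in the field of fractions of \<open>\<Lambda>[q][x\<^sub>1, x\<^sub>2, \<dots>]\<close>.\<close>

type_synonym rat_fun = "((nat \<Rightarrow>\<^sub>0 nat) \<Rightarrow>\<^sub>0 Lam poly) fract"

definition T_ind :: "nat \<Rightarrow> rat_fun" where
  "T_ind i = to_fract (Poly_Mapping.single 0 [:T_var i:])"

definition q_ind :: rat_fun where
  "q_ind = to_fract (Poly_Mapping.single 0 [:0, 1:])"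

definition x_ind :: "nat \<Rightarrow> rat_fun" where
  "x_ind j = to_fract (Poly_Mapping.single (Poly_Mapping.single j 1) 1)"

text \<open>\<open>t\<^sub>i = T\<^bsub>N+1-i\<^esub>\<close>\<close>

definition rev_params :: "nat \<Rightarrow> (nat \<Rightarrow> 'a) \<Rightarrow> nat \<Rightarrow> 'a" where
  "rev_params N T i = T (N + 1 - i)"


section \<open>Partitions in a box\<close>

text \<open>\<open>\<lambda> \<in> \<Pi>\<^sub>n\<^sub>,\<^sub>k\<close> is the list \<open>[\<lambda>\<^sub>1, \<dots>, \<lambda>\<^sub>n]\<close> of length exactly \<open>n\<close>, zero parts included;
  hence \<open>\<lambda>\<^sub>i\<close> is \<open>lam ! (i - 1)\<close>.\<close>

definition box :: "nat \<Rightarrow> nat \<Rightarrow> nat list set" where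
  "box n k = {lam. length lam = n \<and> sorted_wrt (\<ge>) lam \<and> (\<forall>p\<in>set lam. p \<le> k)}"

definition part :: "nat list \<Rightarrow> nat \<Rightarrow> nat" where
  "part lam i = lam ! (i - 1)"

text \<open>\<open>\<lambda>'\<close> for \<open>\<lambda> \<in> \<Pi>\<^sub>n\<^sub>,\<^sub>k\<close>, as an element of \<open>\<Pi>\<^sub>k\<^sub>,\<^sub>n\<close>.\<close>

definition conj_part :: "nat \<Rightarrow> nat list \<Rightarrow> nat list" where
  "conj_part k lam = map (\<lambda>j. card {i \<in> {1..length lam}. j \<le> part lam i}) [1..<k + 1]"

text \<open>\<open>\<lambda>\<^sup>\<or> = (k - \<lambda>\<^sub>n, \<dots>, k - \<lambda>\<^sub>1)\<close>\<close>

definition compl_part :: "nat \<Rightarrow> nat list \<Rightarrow> nat list" where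
  "compl_part k lam = rev (map (\<lambda>p. k - p) lam)"

definition star_part :: "nat \<Rightarrow> nat list \<Rightarrow> nat list" where
  "star_part k lam = conj_part k (compl_part k lam)"

definition part_sub :: "nat list \<Rightarrow> nat list \<Rightarrow> bool" where
  "part_sub mu lam \<longleftrightarrow> list_all2 (\<le>) mu lam"


section \<open>The tensor product space and its operators\<close>

text \<open>The basis vector \<open>v\<^bsub>\<epsilon>\<^sub>1\<^esub> \<otimes> \<dots> \<otimes> v\<^bsub>\<epsilon>\<^sub>N\<^esub>\<close> is indexed by the set \<open>{j. \<epsilon>\<^sub>j = 1} \<subseteq> {1..N}\<close>, and a
  vector is represented by its coordinate function.  Thus the matrix element
  \<open>\<langle>I|O|J\<rangle>\<close> of an operator \<open>O\<close> is \<open>O (basis_vec J) I\<close>.\<close>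

type_synonym 'a tensor = "nat set \<Rightarrow> 'a"
type_synonym 'a oper = "'a tensor \<Rightarrow> 'a tensor"

definition basis_vec :: "nat set \<Rightarrow> 'a::comm_ring_1 tensor" where
  "basis_vec J = (\<lambda>I. if I = J then 1 else 0)"

definition positions :: "nat \<Rightarrow> nat list \<Rightarrow> nat set" where
  "positions n lam = (\<lambda>i. part lam (n + 1 - i) + i) ` {1..n}"

definition sigma_plus :: "nat \<Rightarrow> 'a::comm_ring_1 oper" where
  "sigma_plus j f = (\<lambda>I. if j \<in> I then f (I - {j}) else 0)"

definition sigma_minus :: "nat \<Rightarrow> 'a::comm_ring_1 oper" where
  "sigma_minus j f = (\<lambda>I. if j \<in> I then 0 else f (insert j I))"

text \<open>Operator-valued \<open>2 \<times> 2\<close> matrices are indexed by row and column in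
  \<open>{False, True}\<close>, read as \<open>{0, 1}\<close>.\<close>

type_synonym 'a oper2 = "bool \<Rightarrow> bool \<Rightarrow> 'a oper"

fun L_vic :: "(nat \<Rightarrow> 'a::comm_ring_1) \<Rightarrow> 'a \<Rightarrow> nat \<Rightarrow> 'a oper2" where
  "L_vic t x j False False f = (\<lambda>I. f I - x * t j * sigma_minus j (sigma_plus j f) I)"
| "L_vic t x j False True f = (\<lambda>I. x * sigma_plus j f I)"
| "L_vic t x j True False f = sigma_minus j f"
| "L_vic t x j True True f = (\<lambda>I. x * sigma_minus j (sigma_plus j f) I)"

fun L_osc :: "(nat \<Rightarrow> 'a::comm_ring_1) \<Rightarrow> 'a \<Rightarrow> nat \<Rightarrow> 'a oper2" where
  "L_osc t x j False False f = (\<lambda>I. f I + x * t j * sigma_plus j (sigma_minus j f) I)"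
| "L_osc t x j False True f = (\<lambda>I. x * sigma_plus j f I)"
| "L_osc t x j True False f = sigma_minus j f"
| "L_osc t x j True True f = (\<lambda>I. x * sigma_plus j (sigma_minus j f) I)"

text \<open>\<open>monodromy L N = L\<^sub>N \<cdots> L\<^sub>1\<close>\<close>

primrec monodromy :: "(nat \<Rightarrow> 'a::comm_ring_1 oper2) \<Rightarrow> nat \<Rightarrow> 'a oper2" where
  "monodromy L 0 = (\<lambda>a b f I. if a = b then f I else 0)"
| "monodromy L (Suc j) = (\<lambda>a b f I. \<Sum>c\<in>UNIV. L (Suc j) a c (monodromy L j c b f) I)"

definition twisted_trace :: "'a::comm_ring_1 \<Rightarrow> 'a oper2 \<Rightarrow> 'a oper" where
  "twisted_trace q M f = (\<lambda>I. M False False f I + q * M True True f I)"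

definition H_op :: "nat \<Rightarrow> (nat \<Rightarrow> 'a::comm_ring_1) \<Rightarrow> 'a \<Rightarrow> 'a \<Rightarrow> 'a oper" where
  "H_op N t q x = twisted_trace q (monodromy (L_vic t x) N)"

definition E_op :: "nat \<Rightarrow> (nat \<Rightarrow> 'a::comm_ring_1) \<Rightarrow> 'a \<Rightarrow> 'a \<Rightarrow> 'a oper" where
  "E_op N t q x = twisted_trace q (monodromy (L_osc t x) N)"

text \<open>\<open>E\<^sub>r\<close> is the coefficient of \<open>x\<^sup>r\<close> in \<open>E(x)\<close>, computed with the indeterminate
  \<open>x = [:0, 1:]\<close> of the polynomial ring \<open>'a poly\<close>.\<close>

definition E_coeff :: "nat \<Rightarrow> (nat \<Rightarrow> 'a::comm_ring_1) \<Rightarrow> 'a \<Rightarrow> int \<Rightarrow> 'a oper" where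
  "E_coeff N t q r f = (\<lambda>I. if r < 0 then 0
     else coeff (E_op N (\<lambda>j. [:t j:]) [:q:] [:0, 1:] (\<lambda>J. [:f J:]) I) (nat r))"


section \<open>Partition functions\<close>

text \<open>In one row of the lattice, horizontal edge \<open>j\<close> joins the columns \<open>j\<close> and \<open>j + 1\<close>, and
  the edges \<open>0\<close> and \<open>N\<close> are glued.  The weight of the vertex in column \<open>j\<close> with horizontal
  edges \<open>b\<close> (number \<open>j - 1\<close>), \<open>a\<close> (number \<open>j\<close>) and vertical edges \<open>e\<close> (incoming),
  \<open>e'\<close> (outgoing) is the matrix element \<open>\<langle>a, e'|L\<^sub>j|b, e\<rangle>\<close>.\<close>

definition vertex_weight ::
  "(nat \<Rightarrow> 'a::comm_ring_1 oper2) \<Rightarrow> nat \<Rightarrow> bool \<Rightarrow> bool \<Rightarrow> bool \<Rightarrow> bool \<Rightarrow> 'a" where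
  "vertex_weight L j a b e' e =
     L j a b (basis_vec (if e then {j} else {})) (if e' then {j} else {})"

text \<open>Path configurations on an \<open>m \<times> N\<close> lattice on the cylinder: \<open>v i\<close> is the set of columns
  whose vertical edge between the rows \<open>i\<close> and \<open>i + 1\<close> lies on a path, and \<open>h i\<close> the set of
  horizontal edges of row \<open>i\<close> which lie on a path.  Configurations with a vertex that is not
  allowed have weight zero.\<close>

definition vertical_configs :: "nat \<Rightarrow> nat \<Rightarrow> nat set \<Rightarrow> nat set \<Rightarrow> (nat \<Rightarrow> nat set) set" where
  "vertical_configs N m A B =
     {v \<in> {0..m} \<rightarrow>\<^sub>E Pow {1..N}. v 0 = A \<and> v m = B}"

definition row_configs :: "nat \<Rightarrow> nat set set" where
  "row_configs N = {h \<in> Pow {0..N}. 0 \<in> h \<longleftrightarrow> N \<in> h}"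

definition row_weight ::
  "(nat \<Rightarrow> 'a::comm_ring_1 oper2) \<Rightarrow> nat \<Rightarrow> 'a \<Rightarrow> nat set \<Rightarrow> nat set \<Rightarrow> nat set \<Rightarrow> 'a" where
  "row_weight L N q A B h = (if 0 \<in> h then q else 1) *
     (\<Prod>j\<in>{1..N}. vertex_weight L j (j \<in> h) (j - 1 \<in> h) (j \<in> B) (j \<in> A))"

definition cylinder_sum ::
  "(nat \<Rightarrow> nat \<Rightarrow> 'a::comm_ring_1 oper2) \<Rightarrow> nat \<Rightarrow> nat \<Rightarrow> 'a \<Rightarrow> nat set \<Rightarrow> nat set \<Rightarrow> 'a" where
  "cylinder_sum L N m q A B =
     (\<Sum>v\<in>vertical_configs N m A B. \<Sum>h\<in>({1..m} \<rightarrow>\<^sub>E row_configs N).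
        \<Prod>i\<in>{1..m}. row_weight (L i) N q (v (i - 1)) (v i) (h i))"

text \<open>\<open>Z\<^sub>\<lambda>\<^sub>,\<^sub>\<mu>(x|t)\<close> and \<open>Z'\<^sub>\<lambda>\<^sub>,\<^sub>\<mu>(x|t)\<close> for \<open>\<lambda>, \<mu> \<in> \<Pi>\<^sub>n\<^sub>,\<^sub>k\<close>\<close>

definition Z_vic ::
  "nat \<Rightarrow> nat \<Rightarrow> (nat \<Rightarrow> 'a::comm_ring_1) \<Rightarrow> 'a \<Rightarrow> (nat \<Rightarrow> 'a) \<Rightarrow> nat list \<Rightarrow> nat list \<Rightarrow> 'a" where
  "Z_vic n k t q x lam mu =
     cylinder_sum (\<lambda>i. L_vic t (x i)) (n + k) n q (positions n mu) (positions n lam)"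

definition Z_osc ::
  "nat \<Rightarrow> nat \<Rightarrow> (nat \<Rightarrow> 'a::comm_ring_1) \<Rightarrow> 'a \<Rightarrow> (nat \<Rightarrow> 'a) \<Rightarrow> nat list \<Rightarrow> nat list \<Rightarrow> 'a" where
  "Z_osc n k t q x lam mu =
     cylinder_sum (\<lambda>i. L_osc t (x i)) (n + k) k q (positions n mu) (positions n lam)"

text \<open>The matrix elements of \<open>L\<^sub>j\<close> only see site \<open>j\<close>, so the partition functions
  are matrix elements of products of the row operators.\<close>

definition site_local :: "(nat \<Rightarrow> 'a::comm_ring_1 oper2) \<Rightarrow> bool" where
  "site_local L \<longleftrightarrow> (\<forall>j a b f I. L j a b f I =
     (\<Sum>e\<in>UNIV. vertex_weight L j a b (j \<in> I) e * f (if e then insert j I else I - {j})))"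

lemma site_local_L_vic: "site_local (L_vic t x)"
  unfolding site_local_def
proof (intro allI)
  fix j a b and f :: "'a tensor" and I
  show "L_vic t x j a b f I = (\<Sum>e\<in>UNIV. vertex_weight (L_vic t x) j a b (j \<in> I) e *
      f (if e then insert j I else I - {j}))"
    by (cases a; cases b) (auto simp: UNIV_bool vertex_weight_def sigma_plus_def sigma_minus_def
        basis_vec_def insert_absorb algebra_simps)
qed

lemma site_local_L_osc: "site_local (L_osc t x)"
  unfolding site_local_def
proof (intro allI)
  fix j a b and f :: "'a tensor" and I
  show "L_osc t x j a b f I = (\<Sum>e\<in>UNIV. vertex_weight (L_osc t x) j a b (j \<in> I) e *
      f (if e then insert j I else I - {j}))"
    by (cases a; cases b) (auto simp: UNIV_bool vertex_weight_def sigma_plus_def sigma_minus_def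
        basis_vec_def insert_absorb algebra_simps)
qed

lemma sum_Pow_Suc:
  fixes g :: "nat set \<Rightarrow> 'a::comm_ring_1"
  shows "(\<Sum>K\<in>Pow {1..Suc n}. g K) =
    (\<Sum>e\<in>UNIV. \<Sum>K\<in>Pow {1..n}. g (if e then insert (Suc n) K else K))"
proof -
  have 1: "{1..Suc n} = insert (Suc n) {1..n}" by auto
  have inj: "inj_on (insert (Suc n)) (Pow {1..n})"
    by (auto simp: inj_on_def) (metis Suc_n_not_le_n atLeastAtMost_iff insert_iff subsetD)+
  have "(\<Sum>K\<in>Pow {1..Suc n}. g K) =
      (\<Sum>K\<in>Pow {1..n}. g K) + (\<Sum>K\<in>insert (Suc n) ` Pow {1..n}. g K)"
    unfolding 1 Pow_insert by (rule sum.union_disjoint) auto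
  also have "(\<Sum>K\<in>insert (Suc n) ` Pow {1..n}. g K) = (\<Sum>K\<in>Pow {1..n}. g (insert (Suc n) K))"
    by (subst sum.reindex[OF inj]) simp
  finally show ?thesis by (simp add: UNIV_bool)
qed

definition open_rows :: "nat \<Rightarrow> bool \<Rightarrow> bool \<Rightarrow> nat set set" where
  "open_rows n a b = {h \<in> Pow {0..n}. (0 \<in> h \<longleftrightarrow> b) \<and> (n \<in> h \<longleftrightarrow> a)}"

lemma finite_open_rows: "finite (open_rows n a b)"
  unfolding open_rows_def by (rule finite_subset[of _ "Pow {0..n}"]) auto

lemma sum_open_rows_Suc:
  fixes g :: "nat set \<Rightarrow> 'a::comm_ring_1"
  shows "(\<Sum>h\<in>open_rows (Suc n) a b. g h) =
    (\<Sum>c\<in>UNIV. \<Sum>h\<in>open_rows n c b. g (if a then insert (Suc n) h else h))"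
proof -
  have "(\<Sum>c\<in>UNIV. \<Sum>h\<in>open_rows n c b. g (if a then insert (Suc n) h else h)) =
     (\<Sum>(c,h)\<in>Sigma UNIV (\<lambda>c. open_rows n c b). g (if a then insert (Suc n) h else h))"
    by (rule sum.Sigma) (auto simp: finite_open_rows)
  also have "\<dots> = (\<Sum>h\<in>open_rows (Suc n) a b. g h)"
  proof (rule sum.reindex_bij_witness[where
        i = "\<lambda>h. (n \<in> h, h - {Suc n})" and
        j = "\<lambda>(c,h). if a then insert (Suc n) h else h"])
    fix p assume p: "p \<in> Sigma UNIV (\<lambda>c. open_rows n c b)"
    obtain c h where ch: "p = (c, h)" by (cases p)
    with p have h: "h \<subseteq> {0..n}" "0 \<in> h \<longleftrightarrow> b" "n \<in> h \<longleftrightarrow> c" by (auto simp: open_rows_def)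
    have "Suc n \<notin> h" using h(1) by auto
    then show "(n \<in> (case p of (c, h) \<Rightarrow> if a then insert (Suc n) h else h),
        (case p of (c, h) \<Rightarrow> if a then insert (Suc n) h else h) - {Suc n}) = p"
      using h by (auto simp: ch)
    show "(case p of (c, h) \<Rightarrow> if a then insert (Suc n) h else h) \<in> open_rows (Suc n) a b"
      using h \<open>Suc n \<notin> h\<close> by (auto simp: ch open_rows_def)
  next
    fix h assume h: "h \<in> open_rows (Suc n) a b"
    then show "(case (n \<in> h, h - {Suc n}) of (c, h) \<Rightarrow> if a then insert (Suc n) h else h) = h"
      by (auto simp: open_rows_def)
    have "h \<subseteq> {0..Suc n}" using h by (auto simp: open_rows_def)
    then have "h - {Suc n} \<subseteq> {0..n}" by (metis Diff_subset_conv atLeast0_atMost_Suc insert_is_Un)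
    then show "(n \<in> h, h - {Suc n}) \<in> Sigma UNIV (\<lambda>c. open_rows n c b)"
      using h by (auto simp: open_rows_def)
  qed auto
  finally show ?thesis by simp
qed

lemma monodromy_expand:
  assumes L: "site_local L"
  shows "monodromy L n a b f I = (\<Sum>K\<in>Pow {1..n}. (\<Sum>h\<in>open_rows n a b.
    \<Prod>j\<in>{1..n}. vertex_weight L j (j \<in> h) (j - 1 \<in> h) (j \<in> I) (j \<in> K)) * f (I - {1..n} \<union> K))"
proof (induction n arbitrary: a b f I)
  case 0
  have "open_rows 0 a b = (if a = b then {if a then {0} else {}} else {})"
    by (auto simp: open_rows_def)
  then show ?case by simp
next
  case (Suc n)
  let ?w = "vertex_weight L"
  let ?P = "\<lambda>I K h. \<Prod>j\<in>{1..n}. ?w j (j \<in> h) (j - 1 \<in> h) (j \<in> I) (j \<in> K)"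
  let ?Ie = "\<lambda>e. if e then insert (Suc n) I else I - {Suc n}"
  let ?Ke = "\<lambda>e K. if e then insert (Suc n) K else K"
  have P: "(\<Prod>j\<in>{1..Suc n}. ?w j (j \<in> ?Ke a h) (j - 1 \<in> ?Ke a h) (j \<in> I) (j \<in> ?Ke e K)) =
      ?w (Suc n) a c (Suc n \<in> I) e * ?P (?Ie e) K h"
    if "h \<in> open_rows n c b" "K \<in> Pow {1..n}" for h K c e
  proof -
    have S: "Suc n \<notin> h" "Suc n \<notin> K" "n \<in> h \<longleftrightarrow> c" using that by (auto simp: open_rows_def)
    have "(\<Prod>j\<in>{1..Suc n}. ?w j (j \<in> ?Ke a h) (j - 1 \<in> ?Ke a h) (j \<in> I) (j \<in> ?Ke e K)) =
       ?w (Suc n) (Suc n \<in> ?Ke a h) (n \<in> ?Ke a h) (Suc n \<in> I) (Suc n \<in> ?Ke e K) *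
       (\<Prod>j\<in>{1..n}. ?w j (j \<in> ?Ke a h) (j - 1 \<in> ?Ke a h) (j \<in> I) (j \<in> ?Ke e K))"
      by (simp add: mult.commute)
    also have "(\<Prod>j\<in>{1..n}. ?w j (j \<in> ?Ke a h) (j - 1 \<in> ?Ke a h) (j \<in> I) (j \<in> ?Ke e K)) =
       ?P (?Ie e) K h"
    proof (rule prod.cong[OF refl])
      fix j assume "j \<in> {1..n}"
      then have "j \<noteq> Suc n" "j - 1 \<noteq> Suc n" by auto
      then show "?w j (j \<in> ?Ke a h) (j - 1 \<in> ?Ke a h) (j \<in> I) (j \<in> ?Ke e K) =
          ?w j (j \<in> h) (j - 1 \<in> h) (j \<in> ?Ie e) (j \<in> K)"
        by simp
    qed
    also have "?w (Suc n) (Suc n \<in> ?Ke a h) (n \<in> ?Ke a h) (Suc n \<in> I) (Suc n \<in> ?Ke e K) =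
       ?w (Suc n) a c (Suc n \<in> I) e"
      using S by (cases a; cases e) auto
    finally show ?thesis .
  qed
  have F: "I - {1..Suc n} \<union> ?Ke e K = ?Ie e - {1..n} \<union> K" if "K \<in> Pow {1..n}" for e K
    using that by (cases e) (auto simp: le_Suc_eq)
  have "monodromy L (Suc n) a b f I =
    (\<Sum>c\<in>UNIV. \<Sum>e\<in>UNIV. ?w (Suc n) a c (Suc n \<in> I) e * monodromy L n c b f (?Ie e))"
    using L by (simp add: site_local_def)
  also have "\<dots> = (\<Sum>c\<in>UNIV. \<Sum>e\<in>UNIV. \<Sum>K\<in>Pow {1..n}. \<Sum>h\<in>open_rows n c b.
      ?w (Suc n) a c (Suc n \<in> I) e * ?P (?Ie e) K h * f (?Ie e - {1..n} \<union> K))"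
    by (simp only: Suc.IH sum_distrib_left sum_distrib_right mult.assoc)
  also have "\<dots> = (\<Sum>c\<in>UNIV. \<Sum>e\<in>UNIV. \<Sum>K\<in>Pow {1..n}. \<Sum>h\<in>open_rows n c b.
      (\<Prod>j\<in>{1..Suc n}. ?w j (j \<in> ?Ke a h) (j - 1 \<in> ?Ke a h) (j \<in> I) (j \<in> ?Ke e K)) *
      f (I - {1..Suc n} \<union> ?Ke e K))"
    by (intro sum.cong refl) (simp only: P F)
  also have "\<dots> = (\<Sum>e\<in>UNIV. \<Sum>c\<in>UNIV. \<Sum>K\<in>Pow {1..n}. \<Sum>h\<in>open_rows n c b.
      (\<Prod>j\<in>{1..Suc n}. ?w j (j \<in> ?Ke a h) (j - 1 \<in> ?Ke a h) (j \<in> I) (j \<in> ?Ke e K)) *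
      f (I - {1..Suc n} \<union> ?Ke e K))"
    by (rule sum.swap)
  also have "\<dots> = (\<Sum>e\<in>UNIV. \<Sum>K\<in>Pow {1..n}. \<Sum>c\<in>UNIV. \<Sum>h\<in>open_rows n c b.
      (\<Prod>j\<in>{1..Suc n}. ?w j (j \<in> ?Ke a h) (j - 1 \<in> ?Ke a h) (j \<in> I) (j \<in> ?Ke e K)) *
      f (I - {1..Suc n} \<union> ?Ke e K))"
    by (rule sum.cong[OF refl], rule sum.swap)
  also have "\<dots> = (\<Sum>K\<in>Pow {1..Suc n}. (\<Sum>h\<in>open_rows (Suc n) a b.
    \<Prod>j\<in>{1..Suc n}. ?w j (j \<in> h) (j - 1 \<in> h) (j \<in> I) (j \<in> K)) * f (I - {1..Suc n} \<union> K))"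
    by (simp only: sum_Pow_Suc sum_open_rows_Suc sum_distrib_right)
  finally show ?case .
qed

lemma twisted_trace_expand:
  assumes L: "site_local L" and I: "I \<in> Pow {1..N}"
  shows "twisted_trace q (monodromy L N) f I =
    (\<Sum>K\<in>Pow {1..N}. (\<Sum>h\<in>row_configs N. row_weight L N q K I h) * f K)"
proof -
  let ?P = "\<lambda>K h. \<Prod>j\<in>{1..N}. vertex_weight L j (j \<in> h) (j - 1 \<in> h) (j \<in> I) (j \<in> K)"
  have R: "row_configs N = open_rows N False False \<union> open_rows N True True"
    by (auto simp: row_configs_def open_rows_def)
  have D: "open_rows N False False \<inter> open_rows N True True = {}"
    by (auto simp: open_rows_def)
  have "(\<Sum>h\<in>row_configs N. row_weight L N q K I h) =
    (\<Sum>h\<in>open_rows N False False. ?P K h) + (\<Sum>h\<in>open_rows N True True. q * ?P K h)" for K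
    unfolding R sum.union_disjoint[OF finite_open_rows finite_open_rows D]
    by (intro arg_cong2[of _ _ _ _ "(+)"] sum.cong refl)
       (auto simp: row_weight_def open_rows_def)
  moreover have "I - {1..N} \<union> K = K" for K using I by auto
  ultimately show ?thesis
    by (simp only: twisted_trace_def monodromy_expand[OF L] sum.distrib distrib_right
        sum_distrib_left sum_distrib_right mult.assoc)
qed

lemma vertical_configs_0: "vertical_configs N 0 A B =
    (if A = B \<and> A \<subseteq> {1..N} then {\<lambda>i. if i = 0 then A else undefined} else {})"
  by (auto simp: vertical_configs_def PiE_iff fun_eq_iff extensional_def)

lemma sum_vertical_configs_Suc:
  fixes g :: "(nat \<Rightarrow> nat set) \<Rightarrow> 'a::comm_ring_1"
  assumes "B \<in> Pow {1..N}"
  shows "(\<Sum>v\<in>vertical_configs N (Suc m) A B. g v) =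
    (\<Sum>K\<in>Pow {1..N}. \<Sum>v\<in>vertical_configs N m A K. g (v(Suc m := B)))"
proof -
  have fin: "finite (vertical_configs N m A K)" for K
    unfolding vertical_configs_def
    by (rule finite_subset[of _ "{0..m} \<rightarrow>\<^sub>E Pow {1..N}"]) (auto intro!: finite_PiE)
  have "(\<Sum>K\<in>Pow {1..N}. \<Sum>v\<in>vertical_configs N m A K. g (v(Suc m := B))) =
    (\<Sum>(K,v)\<in>Sigma (Pow {1..N}) (vertical_configs N m A). g (v(Suc m := B)))"
    by (rule sum.Sigma) (auto simp: fin)
  also have "\<dots> = (\<Sum>v\<in>vertical_configs N (Suc m) A B. g v)"
    by (rule sum.reindex_bij_witness[where
          i = "\<lambda>v. (v m, v(Suc m := undefined))" and j = "\<lambda>(K,v). v(Suc m := B)"])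
       (use assms in \<open>auto simp: vertical_configs_def PiE_iff extensional_def fun_eq_iff le_Suc_eq subset_iff\<close>)
  finally show ?thesis by simp
qed

lemma cylinder_sum_operator:
  assumes L: "\<And>i. site_local (L i)" and A: "A \<subseteq> {1..N}" and B: "B \<subseteq> {1..N}"
  shows "cylinder_sum L N m q A B =
    fold (\<lambda>i. twisted_trace q (monodromy (L i) N)) [1..<m + 1] (basis_vec A) B"
proof -
  let ?W = "\<lambda>i A B. \<Sum>h\<in>row_configs N. row_weight (L i) N q A B h"
  have fr: "finite (row_configs N)"
    unfolding row_configs_def by (rule finite_subset[of _ "Pow {0..N}"]) auto
  have *: "cylinder_sum L N m q A B =
      (\<Sum>v\<in>vertical_configs N m A B. \<Prod>i\<in>{1..m}. ?W i (v (i - 1)) (v i))" for m B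
    unfolding cylinder_sum_def by (simp add: prod_sum_PiE fr)
  show ?thesis using B
  proof (induction m arbitrary: B)
    case 0
    then show ?case using A by (auto simp: * vertical_configs_0 basis_vec_def)
  next
    case (Suc m)
    have v: "v m = K" if "v \<in> vertical_configs N m A K" for v K
      using that by (simp add: vertical_configs_def)
    have "cylinder_sum L N (Suc m) q A B = (\<Sum>K\<in>Pow {1..N}. \<Sum>v\<in>vertical_configs N m A K.
        \<Prod>i\<in>{1..Suc m}. ?W i ((v(Suc m := B)) (i - 1)) ((v(Suc m := B)) i))"
      using Suc.prems unfolding * by (subst sum_vertical_configs_Suc) auto
    also have "\<dots> = (\<Sum>K\<in>Pow {1..N}. \<Sum>v\<in>vertical_configs N m A K.
        ?W (Suc m) K B * (\<Prod>i\<in>{1..m}. ?W i (v (i - 1)) (v i)))"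
    proof (intro sum.cong refl)
      fix K v assume v': "v \<in> vertical_configs N m A K"
      have "(\<Prod>i\<in>{1..m}. ?W i ((v(Suc m := B)) (i - 1)) ((v(Suc m := B)) i)) =
          (\<Prod>i\<in>{1..m}. ?W i (v (i - 1)) (v i))"
        by (rule prod.cong) auto
      then show "(\<Prod>i\<in>{1..Suc m}. ?W i ((v(Suc m := B)) (i - 1)) ((v(Suc m := B)) i)) =
          ?W (Suc m) K B * (\<Prod>i\<in>{1..m}. ?W i (v (i - 1)) (v i))"
        using v[OF v'] by (simp add: mult.commute)
    qed
    also have "\<dots> = (\<Sum>K\<in>Pow {1..N}. ?W (Suc m) K B * cylinder_sum L N m q A K)"
      by (simp only: * sum_distrib_left)
    also have "\<dots> = (\<Sum>K\<in>Pow {1..N}. ?W (Suc m) K B *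
        fold (\<lambda>i. twisted_trace q (monodromy (L i) N)) [1..<m + 1] (basis_vec A) K)"
      by (intro sum.cong refl) (simp only: Suc.IH Pow_iff)
    also have "\<dots> = twisted_trace q (monodromy (L (Suc m)) N)
        (fold (\<lambda>i. twisted_trace q (monodromy (L i) N)) [1..<m + 1] (basis_vec A)) B"
      using Suc.prems by (simp add: twisted_trace_expand[OF L])
    finally show ?case by simp
  qed
qed

lemma positions_subset:
  assumes "lam \<in> box n k"
  shows "positions n lam \<subseteq> {1..n + k}"
proof -
  have "part lam (n + 1 - i) \<le> k" if "i \<in> {1..n}" for i
  proof -
    have "n - i < length lam" using assms that by (auto simp: box_def)
    then have "lam ! (n - i) \<in> set lam" by (rule nth_mem)
    then show ?thesis using assms by (auto simp: box_def part_def)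
  qed
  then show ?thesis by (fastforce simp: positions_def)
qed

text \<open>\<open>Z\<^sub>\<lambda>\<^sub>,\<^sub>\<mu>(x|t) = \<langle>\<lambda>|H(x\<^sub>n) \<cdots> H(x\<^sub>1)|\<mu>\<rangle>\<close> and \<open>Z'\<^sub>\<lambda>\<^sub>,\<^sub>\<mu>(x|t) = \<langle>\<lambda>|E(x\<^sub>k) \<cdots> E(x\<^sub>1)|\<mu>\<rangle>\<close>\<close>

lemma Z_vic_operator:
  assumes "lam \<in> box n k" "mu \<in> box n k"
  shows "Z_vic n k t q x lam mu =
    fold (\<lambda>i. H_op (n + k) t q (x i)) [1..<n + 1] (basis_vec (positions n mu)) (positions n lam)"
  unfolding Z_vic_def H_op_def
  by (intro cylinder_sum_operator site_local_L_vic positions_subset assms)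

lemma Z_osc_operator:
  assumes "lam \<in> box n k" "mu \<in> box n k"
  shows "Z_osc n k t q x lam mu =
    fold (\<lambda>i. E_op (n + k) t q (x i)) [1..<k + 1] (basis_vec (positions n mu)) (positions n lam)"
  unfolding Z_osc_def E_op_def
  by (intro cylinder_sum_operator site_local_L_osc positions_subset assms)

definition Z_vic_tilde ::
  "nat \<Rightarrow> nat \<Rightarrow> (nat \<Rightarrow> 'a::field) \<Rightarrow> 'a \<Rightarrow> (nat \<Rightarrow> 'a) \<Rightarrow> nat list \<Rightarrow> nat list \<Rightarrow> 'a" where
  "Z_vic_tilde n k t q x lam mu =
     (\<Prod>i\<in>{1..n}. x i) ^ k * Z_vic n k t q (\<lambda>i. inverse (x i)) lam mu"

definition Z_osc_tilde ::
  "nat \<Rightarrow> nat \<Rightarrow> (nat \<Rightarrow> 'a::field) \<Rightarrow> 'a \<Rightarrow> (nat \<Rightarrow> 'a) \<Rightarrow> nat list \<Rightarrow> nat list \<Rightarrow> 'a" where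
  "Z_osc_tilde n k t q x lam mu =
     (\<Prod>i\<in>{1..k}. x i) ^ n * Z_osc n k t q (\<lambda>i. inverse (x i)) lam mu"


section \<open>Structure constants\<close>

text \<open>\<open>S\<^sub>\<lambda> = det(E\<^bsub>\<lambda>'\<^sub>i - i + j\<^esub>)\<close>: the entries are operators, so the Leibniz formula is
  written out, with the factors composed in the order of the rows.\<close>

definition S_op :: "nat \<Rightarrow> nat \<Rightarrow> (nat \<Rightarrow> 'a::comm_ring_1) \<Rightarrow> 'a \<Rightarrow> nat list \<Rightarrow> 'a oper" where
  "S_op n k t q lam f = (\<lambda>I. \<Sum>p | p permutes {1..k}. of_int (sign p) *
     foldr (\<lambda>i. E_coeff (n + k) t q (int (part (conj_part k lam) i) - int i + int (p i)))
       [1..<k + 1] f I)"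

text \<open>\<open>elem_sym r m t = e\<^sub>r(t\<^sub>1, \<dots>, t\<^sub>m)\<close>\<close>

definition elem_sym :: "int \<Rightarrow> nat \<Rightarrow> (nat \<Rightarrow> 'a::comm_ring_1) \<Rightarrow> 'a" where
  "elem_sym r m t = (\<Sum>A | A \<subseteq> {1..m} \<and> int (card A) = r. \<Prod>i\<in>A. t i)"

text \<open>Library matrices are indexed from \<open>0\<close>; this is the determinant of
  \<open>(a i j)\<close> with \<open>1 \<le> i, j \<le> m\<close>.\<close>

definition det1 :: "nat \<Rightarrow> (nat \<Rightarrow> nat \<Rightarrow> 'a::comm_ring_1) \<Rightarrow> 'a" where
  "det1 m a = det (mat m m (\<lambda>(i, j). a (i + 1) (j + 1)))"

definition S_tilde :: "nat \<Rightarrow> nat \<Rightarrow> (nat \<Rightarrow> 'a::comm_ring_1) \<Rightarrow> 'a \<Rightarrow> nat list \<Rightarrow> 'a oper" where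
  "S_tilde n k t q lam f = (\<lambda>I. \<Sum>mu | mu \<in> box n k \<and> part_sub mu lam.
     (-1) ^ (sum_list lam - sum_list mu) *
     det1 n (\<lambda>i j. elem_sym (int (part lam i) - int (part mu j) - int i + int j)
                     (n + part lam i - i) t) *
     S_op n k t q mu f I)"

text \<open>\<open>gw n k lam mu nu d\<close> is \<open>C\<^bsub>\<lambda>\<mu>\<^esub>\<^bsup>\<nu>,d\<^esup>(T) \<in> \<Lambda>\<close>; the operators are taken over \<open>\<Lambda>[q]\<close>.\<close>

definition gw :: "nat \<Rightarrow> nat \<Rightarrow> nat list \<Rightarrow> nat list \<Rightarrow> nat list \<Rightarrow> nat \<Rightarrow> Lam" where
  "gw n k lam mu nu d =
     coeff (S_tilde n k (rev_params (n + k) (\<lambda>i. [:T_var i:])) [:0, 1:] lam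
              (basis_vec (positions n mu)) (positions n nu)) d"


section \<open>Factorial Schur functions\<close>

definition fact_power :: "(nat \<Rightarrow> 'a::comm_ring_1) \<Rightarrow> 'a \<Rightarrow> nat \<Rightarrow> 'a" where
  "fact_power a x r = (\<Prod>i\<in>{1..r}. x - a i)"

definition fact_schur :: "nat \<Rightarrow> nat list \<Rightarrow> (nat \<Rightarrow> 'a::field) \<Rightarrow> (nat \<Rightarrow> 'a) \<Rightarrow> 'a" where
  "fact_schur m lam x a =
     det1 m (\<lambda>i j. fact_power a (x j) (part lam i + m - i)) /
     det1 m (\<lambda>i j. fact_power a (x j) (m - i))"

text \<open>\<open>s\<^bsub>\<lambda>/d/\<mu>\<^esub>(x|a)\<close> for \<open>\<lambda>, \<mu> \<in> \<Pi>\<^sub>m\<^sub>,\<^sub>l\<close>, where \<open>l = N - m\<close>\<close>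

definition fact_skew_schur ::
  "nat \<Rightarrow> nat \<Rightarrow> nat list \<Rightarrow> nat \<Rightarrow> nat list \<Rightarrow> (nat \<Rightarrow> 'a::field) \<Rightarrow> (nat \<Rightarrow> 'a) \<Rightarrow> 'a" where
  "fact_skew_schur m l lam d mu x a =
     (\<Sum>nu\<in>box m l.
        subst_T a (gw m l (compl_part l mu) (compl_part l nu) (compl_part l lam) d) *
        fact_schur m nu x a)"

text \<open>Only finitely many \<open>d\<close> contribute, so the sums over \<open>d\<close> may be written with
  \<^const>\<open>Sum_any\<close>.\<close>

lemma finite_gw: "finite {d. gw n k lam mu nu d \<noteq> 0}"
  unfolding gw_def by (rule finite_subset[OF _ finite_atMost]) (auto intro: le_degree)

lemma finite_fact_skew_schur: "finite {d. fact_skew_schur m l lam d mu x a \<noteq> 0}"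
proof (cases "finite (box m l)")
  case True
  have "{d. fact_skew_schur m l lam d mu x a \<noteq> 0} \<subseteq>
      (\<Union>nu\<in>box m l. {d. gw m l (compl_part l mu) (compl_part l nu) (compl_part l lam) d \<noteq> 0})"
  proof
    fix d assume "d \<in> {d. fact_skew_schur m l lam d mu x a \<noteq> 0}"
    then have "fact_skew_schur m l lam d mu x a \<noteq> 0" by simp
    then obtain nu where "nu \<in> box m l"
      "subst_T a (gw m l (compl_part l mu) (compl_part l nu) (compl_part l lam) d) *
        fact_schur m nu x a \<noteq> 0"
      unfolding fact_skew_schur_def by (meson sum.not_neutral_contains_not_neutral)
    moreover have "subst_T a 0 = 0" by (simp add: subst_T_def)
    ultimately show "d \<in> (\<Union>nu\<in>box m l.
        {d. gw m l (compl_part l mu) (compl_part l nu) (compl_part l lam) d \<noteq> 0})"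
      by force
  qed
  then show ?thesis by (rule finite_subset) (auto simp: True finite_gw)
next
  case False
  then show ?thesis by (simp add: fact_skew_schur_def)
qed

lemma finite_box: "finite (box n k)"
  by (rule finite_subset[OF _ finite_lists_length_eq[of "{..k}" n]]) (auto simp: box_def)

lemma subst_T_var: "subst_T a (T_var i) = a i"
  by (simp add: subst_T_def T_var_def lookup_single)

end

theory Submission
  imports Defs "Jordan_Normal_Form.Char_Poly" "HOL-Computational_Algebra.Polynomial_FPS"
begin

text \<open>
  Let \<open>W\<close> be the module with basis \<open>w\<^sub>1, \<dots>, w\<^sub>N\<close> and \<open>Y\<close> its endomorphism
  \<open>Y w\<^sub>j = t\<^sub>j w\<^sub>j + w\<^bsub>j+1\<^esub>\<close>, where \<open>w\<^bsub>N+1\<^esub> = (-1)\<^bsup>n-1\<^esup> q w\<^sub>1\<close>.  Read the basis vector of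
  \<open>V\<^sub>n\<close> with particles at the sites \<open>i\<^sub>1 > \<dots> > i\<^sub>n\<close> as \<open>w\<^bsub>i\<^sub>1\<^esub> \<and> \<dots> \<and> w\<^bsub>i\<^sub>n\<^esub>\<close>.  Both models
  consist of free fermions: \<open>E(x)\<close> is the exterior power \<open>\<Lambda>\<^sup>n(1 + x Y)\<close>, and \<open>H(x)\<close> is \<open>det(1 - x Y)\<close>
  times the inverse of \<open>\<Lambda>\<^sup>n(1 - x Y)\<close>.  The sign in \<open>w\<^bsub>N+1\<^esub>\<close> is the one produced when a particle
  that has crossed the gluing line is moved past the \<open>n - 1\<close> others.

  Since \<open>w\<^bsub>j+1\<^esub> = (Y|t)\<^sup>j w\<^sub>1\<close>, the left eigenvectors of \<open>Y\<close> belong to the solutions of the Bethe equation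
  \<open>(y|t)\<^sup>N = (-1)\<^bsup>n-1\<^esup> q\<close>, and every \<open>n\<close>-tuple \<open>y\<close> of solutions gives a functional
  \<open>f \<mapsto> \<Sum>\<^sub>\<lambda> f(\<lambda>) det((y\<^sub>j|t)\<^bsup>\<lambda>\<^sub>i+n-i\<^esup>)\<close> on \<open>V\<^sub>n\<close>, called \<open>pairing\<close> below.  It is a common left eigenvector
  of all operators of the theorem.  The eigenvalue of \<open>E(x)\<close> is \<open>\<Prod>\<^sub>j (1 + x y\<^sub>j)\<close>, hence that of \<open>E\<^sub>r\<close> is
  \<open>e\<^sub>r(y)\<close>; the dual Jacobi-Trudi identity turns the determinant defining \<open>S\<^sub>\<lambda>\<close> into a Schur polynomial,
  and the expansion of factorial powers into powers makes \<open>s\<^sub>\<lambda>(y|t)\<close> the eigenvalue of \<open>S\<close>-tilde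
  (\<open>pairing_S_tilde\<close>).  If there are \<open>N\<close> distinct solutions, these functionals separate the
  vectors of \<open>V\<^sub>n\<close> (\<open>pairing_separates\<close>), so an identity between operators may be verified on eigenvalues.

  For the vicious walkers this leaves the identity
  \<open>\<Prod>\<^sub>i (P(x\<^sub>i) / \<Prod>\<^sub>j (x\<^sub>i - y\<^sub>j)) = \<Sum>\<^sub>\<nu> s\<^sub>\<nu>(y|t) s\<^bsub>\<nu>\<or>\<^esub>(x|T)\<close> with \<open>P(x) = (x|t)\<^sup>N - (-1)\<^bsup>n-1\<^esup> q\<close>.
  As \<open>P(y\<^sub>j) = 0\<close>, the quotient \<open>P(x) / (x - y\<^sub>j)\<close> is a divided difference of \<open>(x|t)\<^sup>N\<close>, which telescopes to
  \<open>\<Sum>\<^sub>m (y\<^sub>j|t)\<^sup>m (x|T)\<^bsup>N-1-m\<^esup>\<close>.  The determinant of these quotients is evaluated in two ways, by the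
  Cauchy-Binet formula and by the Cauchy determinant (\<open>cauchy_identity\<close>).

  Exchanging particles with holes and reflecting the cylinder carries the osculating walkers for
  \<open>(n, k, t)\<close> to the vicious walkers for \<open>(k, n, -T)\<close> (\<open>Z_osc_dual\<close>).  This is the formula with the
  skew functions of the partitions \<open>\<lambda>\<^sup>*\<close>, \<open>\<mu>\<^sup>*\<close>.  For \<open>\<mu> = \<emptyset>\<close> it evaluates the partition function as a single
  factorial Schur function; this special case is the dual Cauchy identity in disguise, and by
  diagonalisation it determines the partition function for every \<open>\<mu>\<close> (\<open>Z_osc_expansion\<close>).

  The Bethe equation has no solutions among the rational functions in \<open>t\<close> and \<open>q\<close>.  Both sides of the
  theorem are however polynomial in \<open>q\<close>, and over the power series in \<open>q\<close> there are \<open>N\<close>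
  solutions: one with constant term \<open>t\<^sub>j\<close> for each \<open>j\<close>, by inversion of power series
  (\<open>bethe_solution_exists\<close>).  So the identities are proved in power series, read as identities of
  polynomials in \<open>q\<close>, and then specialised.\<close>

section \<open>Determinants indexed from one\<close>

lemma det1_leibniz:
  "det1 n A = (\<Sum>p | p permutes {1..n}. of_int (sign p) * (\<Prod>i\<in>{1..n}. A i (p i)))"
proof -
  let ?S = "{0..<n}" and ?T = "{1..n}" and ?pred = "\<lambda>i. i - Suc 0"
  have f: "bij_betw Suc ?S ?T"
    by (auto simp: bij_betw_def image_Suc_atLeastLessThan atLeastLessThanSuc_atLeastAtMost)
  have g: "bij_betw ?pred ?T ?S"
    by (rule bij_betw_byWitness[where f' = Suc]) auto
  have "det1 n A = (\<Sum>p | p permutes ?S. of_int (sign p) * (\<Prod>i\<in>?S. A (Suc i) (Suc (p i))))"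
    unfolding det1_def
    by (subst det_def'[of _ n]) (auto intro!: sum.cong prod.cong simp: permutes_in_image)
  also have "\<dots> = (\<Sum>p | p permutes ?T. of_int (sign p) * (\<Prod>i\<in>?T. A i (p i)))"
  proof (rule sum.reindex_bij_witness[where
        j = "map_permutation ?S Suc" and i = "map_permutation ?T ?pred"])
    fix p assume p: "p \<in> {p. p permutes ?S}"
    show "map_permutation ?T ?pred (map_permutation ?S Suc p) = p"
      by (rule map_permutation_compose_inv[OF f]) (use p in auto)
    show "map_permutation ?S Suc p \<in> {p. p permutes ?T}"
      using map_permutation_permutes[OF f, of p] p by auto
    have s: "sign (map_permutation ?S Suc p) = sign p"
      by (rule sign_map_permutation) (use p f in auto)
    have "(\<Prod>i\<in>?T. A i (map_permutation ?S Suc p i)) =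
        (\<Prod>i\<in>?S. A (Suc i) (map_permutation ?S Suc p (Suc i)))"
      by (rule prod.reindex_bij_betw[OF f, symmetric])
    also have "\<dots> = (\<Prod>i\<in>?S. A (Suc i) (Suc (p i)))"
      by (rule prod.cong[OF refl], subst map_permutation_apply) auto
    finally show "of_int (sign (map_permutation ?S Suc p)) *
        (\<Prod>i\<in>?T. A i (map_permutation ?S Suc p i)) =
        of_int (sign p) * (\<Prod>i\<in>?S. A (Suc i) (Suc (p i)))"
      by (simp add: s)
  next
    fix p assume p: "p \<in> {p. p permutes ?T}"
    show "map_permutation ?S Suc (map_permutation ?T ?pred p) = p"
      by (rule map_permutation_compose_inv[OF g]) (use p in auto)
    show "map_permutation ?T ?pred p \<in> {p. p permutes ?S}"
      using map_permutation_permutes[OF g, of p] p by auto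
  qed
  finally show ?thesis .
qed

lemma det1_cong:
  assumes "\<And>i j. i \<in> {1..n} \<Longrightarrow> j \<in> {1..n} \<Longrightarrow> A i j = B i j"
  shows "det1 n A = det1 n B"
  unfolding det1_leibniz
  by (intro sum.cong refl arg_cong2[of _ _ _ _ "(*)"] prod.cong)
    (use assms permutes_in_image in fastforce)

lemma det1_transpose: "det1 n (\<lambda>i j. A j i) = det1 n A"
proof -
  have "mat n n (\<lambda>(i, j). A (j + 1) (i + 1)) = transpose_mat (mat n n (\<lambda>(i, j). A (i + 1) (j + 1)))"
    by (auto simp: mat_eq_iff)
  then show ?thesis by (simp add: det1_def det_transpose[of _ n])
qed

lemma det1_mult:
  "det1 n (\<lambda>i j. \<Sum>m\<in>{1..n}. A i m * B m j) = det1 n A * det1 n B"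
proof -
  have "mat n n (\<lambda>(i, j). \<Sum>m\<in>{1..n}. A (i + 1) m * B m (j + 1)) =
     mat n n (\<lambda>(i, j). A (i + 1) (j + 1)) * mat n n (\<lambda>(i, j). B (i + 1) (j + 1))"
    by (auto simp: mat_eq_iff scalar_prod_def sum.atLeast1_atMost_eq atLeast0LessThan)
  then show ?thesis by (simp add: det1_def det_mult[of _ n])
qed

lemma det1_scale_cols: "det1 n (\<lambda>i j. c j * A i j) = (\<Prod>j\<in>{1..n}. c j) * det1 n A"
proof -
  have "(\<Prod>i\<in>{1..n}. c (p i)) = (\<Prod>j\<in>{1..n}. c j)" if "p permutes {1..n}" for p
    using prod.permute[OF that, of c] by (simp add: o_def)
  then have "of_int (sign p) * (\<Prod>i\<in>{1..n}. c (p i) * A i (p i)) =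
      (\<Prod>j\<in>{1..n}. c j) * (of_int (sign p) * (\<Prod>i\<in>{1..n}. A i (p i)))"
    if "p permutes {1..n}" for p
    using that by (simp only: prod.distrib mult.left_commute)
  then show ?thesis
    unfolding det1_leibniz sum_distrib_left by (intro sum.cong) auto
qed

lemma det1_scale_rows: "det1 n (\<lambda>i j. c i * A i j) = (\<Prod>i\<in>{1..n}. c i) * det1 n A"
  using det1_scale_cols[of n c "\<lambda>i j. A j i"]
  by (simp only: det1_transpose[of n A] det1_transpose[of n "\<lambda>i j. c i * A i j"])

lemma det1_permute_cols:
  assumes "p permutes {1..n}"
  shows "det1 n (\<lambda>i j. A i (p j)) = of_int (sign p) * det1 n A"
proof -
  have pp: "permutation p" using assms permutation_permutes by blast
  have "det1 n A = (\<Sum>r | r permutes {1..n}. of_int (sign (p \<circ> r)) * (\<Prod>i\<in>{1..n}. A i ((p \<circ> r) i)))"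
    unfolding det1_leibniz by (rule setum_permutations_compose_left[OF assms])
  also have "\<dots> = of_int (sign p) * det1 n (\<lambda>i j. A i (p j))"
    unfolding det1_leibniz sum_distrib_left
    proof (intro sum.cong refl)
    fix r assume "r \<in> {r. r permutes {1..n}}"
    then have "permutation r" using permutation_permutes by blast
    then show "of_int (sign (p \<circ> r)) * (\<Prod>i\<in>{1..n}. A i ((p \<circ> r) i)) =
        of_int (sign p) * (of_int (sign r) * (\<Prod>i\<in>{1..n}. A i (p (r i))))"
      by (simp add: sign_compose[OF pp] mult.assoc)
  qed
  finally show ?thesis by (simp add: mult.assoc[symmetric] flip: of_int_mult)
qed

lemma det1_permute_rows:
  assumes "p permutes {1..n}"
  shows "det1 n (\<lambda>i j. A (p i) j) = of_int (sign p) * det1 n A"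
  using det1_permute_cols[OF assms, of "\<lambda>i j. A j i"]
  by (simp only: det1_transpose[of n A] det1_transpose[of n "\<lambda>i j. A (p i) j"])

lemma det1_identical_rows:
  assumes "i \<in> {1..n}" "j \<in> {1..n}" "i \<noteq> j" "\<And>m. m \<in> {1..n} \<Longrightarrow> A i m = A j m"
  shows "det1 n A = 0"
  unfolding det1_def
  by (rule det_identical_rows[of _ n "i - 1" "j - 1"]) (use assms in \<open>auto simp: row_def vec_eq_iff\<close>)

lemma det1_row_zero:
  assumes "i \<in> {1..n}" "\<And>m. m \<in> {1..n} \<Longrightarrow> A i m = 0"
  shows "det1 n A = 0"
  unfolding det1_leibniz
proof (rule sum.neutral, intro ballI)
  fix p assume "p \<in> {p. p permutes {1..n}}"
  then have "p i \<in> {1..n}" using assms(1) permutes_in_image by fastforce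
  then have "A i (p i) = 0" using assms(2) by blast
  then show "of_int (sign p) * (\<Prod>i\<in>{1..n}. A i (p i)) = 0"
    using assms(1) by (metis (mono_tags, lifting) finite_atLeastAtMost mult_zero_right prod_zero)
qed

lemma det1_row_linear:
  assumes r: "r \<in> {1..n}"
    and "\<And>i j. i \<in> {1..n} \<Longrightarrow> i \<noteq> r \<Longrightarrow> A i j = (C i j :: 'a::comm_ring_1)" "\<And>i j. i \<in> {1..n} \<Longrightarrow> i \<noteq> r \<Longrightarrow> B i j = C i j"
    and "\<And>j. j \<in> {1..n} \<Longrightarrow> C r j = u * A r j + v * B r j"
  shows "det1 n C = u * det1 n A + v * det1 n B"
proof -
  have "(\<Prod>i\<in>{1..n}. C i (p i)) = u * (\<Prod>i\<in>{1..n}. A i (p i)) + v * (\<Prod>i\<in>{1..n}. B i (p i))"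
    if "p permutes {1..n}" for p
  proof -
    have "p r \<in> {1..n}" using that r permutes_in_image by fastforce
    moreover have "(\<Prod>i\<in>{1..n} - {r}. A i (p i)) = (\<Prod>i\<in>{1..n} - {r}. C i (p i))"
      "(\<Prod>i\<in>{1..n} - {r}. B i (p i)) = (\<Prod>i\<in>{1..n} - {r}. C i (p i))"
      using assms by (auto intro!: prod.cong)
    moreover have "prod f {1..n} = f r * prod f ({1..n} - {r})" for f :: "nat \<Rightarrow> 'a"
      by (rule prod.remove) (use r in auto)
    ultimately show ?thesis
      by (simp only: assms(4)) (simp only: algebra_simps)
  qed
  then have "of_int (sign p) * (\<Prod>i\<in>{1..n}. C i (p i)) =
      u * (of_int (sign p) * (\<Prod>i\<in>{1..n}. A i (p i))) +
      v * (of_int (sign p) * (\<Prod>i\<in>{1..n}. B i (p i)))" if "p permutes {1..n}" for p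
    using that by (simp only:) (simp only: algebra_simps)
  then show ?thesis
    unfolding det1_leibniz sum_distrib_left sum.distrib[symmetric] by (intro sum.cong) auto
qed

text \<open>Multilinearity in the rows, without any cancellation: this single expansion serves both the
  Cauchy-Binet formula, where only injective \<open>g\<close> survive, and the inversion of the map from
  tensors to their alternant sums.\<close>

lemma det1_expand_rows:
  assumes "finite S"
  shows "det1 n (\<lambda>i j. \<Sum>m\<in>S. A i m * B m j) =
    (\<Sum>g\<in>{1..n} \<rightarrow>\<^sub>E S. (\<Prod>i\<in>{1..n}. A i (g i)) * det1 n (\<lambda>i j. B (g i) j))"
proof -
  have "det1 n (\<lambda>i j. \<Sum>m\<in>S. A i m * B m j) = (\<Sum>p | p permutes {1..n}. of_int (sign p) *
     (\<Sum>g\<in>{1..n} \<rightarrow>\<^sub>E S. \<Prod>i\<in>{1..n}. A i (g i) * B (g i) (p i)))"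
    by (simp add: det1_leibniz prod_sum_PiE assms)
  also have "\<dots> = (\<Sum>g\<in>{1..n} \<rightarrow>\<^sub>E S. \<Sum>p | p permutes {1..n}. of_int (sign p) *
     (\<Prod>i\<in>{1..n}. A i (g i) * B (g i) (p i)))"
    by (subst sum.swap) (simp add: sum_distrib_left)
  finally show ?thesis
    by (simp add: det1_leibniz sum_distrib_left prod.distrib mult_ac)
qed

lemma det1_hom:
  assumes "comm_ring_hom f"
  shows "f (det1 n A) = det1 n (\<lambda>i j. f (A i j))"
proof -
  interpret comm_ring_hom f by fact
  show ?thesis by (simp add: det1_def hom_det[symmetric] map_mat_def) 
     (auto intro!: arg_cong[of _ _ det] simp: mat_eq_iff)
qed

text \<open>The sign \<open>(-1)\<^bsup>n(n-1)/2\<^esup>\<close> of the order-reversing permutation.  It enters the Cauchy determinant and the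
  Cauchy-Binet sum alike and cancels between them, so only its square is ever computed.\<close>

definition rev_sign :: "nat \<Rightarrow> 'a::comm_ring_1" where
  "rev_sign n = of_int (sign (\<lambda>i. if i \<in> {1..n} then n + 1 - i else i))"

lemma rev_permutes: "(\<lambda>i::nat. if i \<in> {1..n} then n + 1 - i else i) permutes {1..n}"
  by (rule bij_imp_permutes, rule bij_betw_byWitness[where f' = "\<lambda>i. if i \<in> {1..n} then n + 1 - i else i"]) auto

lemma rev_sign_square: "rev_sign n * rev_sign n = (1::'a::comm_ring_1)"
  unfolding rev_sign_def by (simp flip: of_int_mult)

lemma det1_reverse_cols: "det1 n (\<lambda>i j. A i (n + 1 - j)) = rev_sign n * det1 n A"
  unfolding rev_sign_def det1_permute_cols[OF rev_permutes, symmetric] by (rule det1_cong) simp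

section \<open>Partitions in a box, particles and holes\<close>

lemma boxD:
  assumes "lam \<in> box n k"
  shows "length lam = n" and "i \<in> {1..n} \<Longrightarrow> part lam i \<le> k"
    and "i \<in> {1..n} \<Longrightarrow> j \<in> {1..n} \<Longrightarrow> i \<le> j \<Longrightarrow> part lam j \<le> part lam i"
proof -
  show l: "length lam = n" using assms by (simp add: box_def)
  show "part lam i \<le> k" if "i \<in> {1..n}"
    using assms that l by (auto simp: box_def part_def)
  show "part lam j \<le> part lam i" if "i \<in> {1..n}" "j \<in> {1..n}" "i \<le> j"
  proof (cases "i = j")
    case False
    then have "i - 1 < j - 1" "j - 1 < length lam" using that l by auto
    then show ?thesis using assms by (auto simp: box_def part_def sorted_wrt_iff_nth_less)
  qed simp
qed

lemma part_map: "i \<in> {1..n} \<Longrightarrow> part (map f [1..<n + 1]) i = f i"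
  by (auto simp: part_def simp del: upt_Suc)

lemma box_mapI:
  assumes "\<And>i. i \<in> {1..n} \<Longrightarrow> f i \<le> k"
    and "\<And>i. i \<in> {1..n} \<Longrightarrow> i + 1 \<in> {1..n} \<Longrightarrow> f (i + 1) \<le> f i"
  shows "map f [1..<n + 1] \<in> box n k"
proof -
  have "f j \<le> f i" if "i \<le> j" "1 \<le> i" "j \<le> n" for i j
    using that
  proof (induction rule: dec_induct)
    case (step m)
    then show ?case using assms(2)[of m] by force
  qed simp
  then have "sorted_wrt (\<ge>) (map f [1..<n + 1])"
    by (auto simp: sorted_wrt_iff_nth_less simp del: upt_Suc)
  then show ?thesis using assms(1) by (auto simp: box_def)
qed

lemma box_eqI:
  assumes "lam \<in> box n k" "mu \<in> box n l" "\<And>i. i \<in> {1..n} \<Longrightarrow> part lam i = part mu i"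
  shows "lam = mu"
proof (rule nth_equalityI)
  show "length lam = length mu" using assms by (simp add: box_def)
  show "lam ! i = mu ! i" if "i < length lam" for i
    using assms(3)[of "Suc i"] that boxD(1)[OF assms(1)] by (simp add: part_def)
qed

text \<open>The exponents \<open>\<lambda>\<^sub>i + n - i\<close> of an alternant; the sites of the particles of \<open>|\<lambda>\<rangle>\<close> are
  these numbers plus one.\<close>

definition expo :: "nat \<Rightarrow> nat list \<Rightarrow> nat \<Rightarrow> nat" where
  "expo n lam i = part lam i + n - i"

lemma expo_less:
  assumes "lam \<in> box n k" "i \<in> {1..n}"
  shows "expo n lam i < n + k"
  using boxD(2)[OF assms] assms(2) by (auto simp: expo_def)

lemma expo_strict:
  assumes "lam \<in> box n k" "i \<in> {1..n}" "j \<in> {1..n}" "i < j"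
  shows "expo n lam j < expo n lam i"
  using boxD(3)[OF assms(1-3)] assms(2-) by (auto simp: expo_def)

lemma inj_on_expo:
  assumes "lam \<in> box n k"
  shows "inj_on (expo n lam) {1..n}"
  by (rule linorder_inj_onI') (metis assms expo_strict less_irrefl)

lemma positions_eq_expo: "positions n lam = Suc ` expo n lam ` {1..n}"
proof -
  have "(\<lambda>i. n + 1 - i) ` {1..n} = {1..n}"
    by (rule bij_betw_imp_surj_on, rule bij_betw_byWitness[where f' = "\<lambda>i. n + 1 - i"]) auto
  then have "Suc ` expo n lam ` {1..n} = (\<lambda>i. Suc (expo n lam (n + 1 - i))) ` {1..n}"
    by (metis (no_types) image_image)
  also have "\<dots> = positions n lam"
    unfolding positions_def by (rule image_cong) (auto simp: expo_def)
  finally show ?thesis by simp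
qed

lemma strict_sorted_nth_gap:
  fixes s :: "nat list"
  assumes "sorted_wrt (<) s" "i \<le> j" "j < length s"
  shows "s ! i + (j - i) \<le> s ! j"
  using assms(2,3)
proof (induction rule: dec_induct)
  case (step m)
  then have "s ! m < s ! Suc m" using assms(1) by (simp add: sorted_wrt_iff_nth_less)
  then show ?case using step by auto
qed simp

lemma rev_sorted_list_of_image:
  fixes f :: "nat \<Rightarrow> nat"
  assumes "\<And>i j. i \<in> {1..n} \<Longrightarrow> j \<in> {1..n} \<Longrightarrow> i < j \<Longrightarrow> f j < f i"
  shows "rev (sorted_list_of_set (f ` {1..n})) = map f [1..<n + 1]"
proof -
  have inj: "inj_on f {1..n}"
    by (rule linorder_inj_onI') (metis assms less_irrefl)
  have "sorted_list_of_set (f ` {1..n}) = rev (map f [1..<n + 1])"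
  proof (rule sorted_list_of_set_unique[THEN iffD1])
    have "sorted_wrt (\<lambda>x y. y < x) (map f [1..<n + 1])"
      using assms by (auto simp: sorted_wrt_iff_nth_less simp del: upt_Suc)
    moreover have "set [1..<n + 1] = {1..n}" by auto
    ultimately show "sorted_wrt (<) (rev (map f [1..<n + 1])) \<and>
        set (rev (map f [1..<n + 1])) = f ` {1..n} \<and>
        length (rev (map f [1..<n + 1])) = card (f ` {1..n})"
      using card_image[OF inj] by (simp add: sorted_wrt_rev del: upt_Suc set_upt)
  qed simp
  then show ?thesis by simp
qed

text \<open>Subtracting the staircase from a strictly decreasing sequence in \<open>{0..<n + k}\<close> leaves a
  partition in the box, because consecutive entries differ by at least one.\<close>

lemma bij_betw_box_subsets:
  "bij_betw (\<lambda>lam. expo n lam ` {1..n}) (box n k) {M. M \<subseteq> {0..<n + k} \<and> card M = n}"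
proof (rule bij_betw_imageI)
  show "inj_on (\<lambda>lam. expo n lam ` {1..n}) (box n k)"
  proof (rule inj_onI)
    fix lam mu assume lam: "lam \<in> box n k" and mu: "mu \<in> box n k"
      and eq: "expo n lam ` {1..n} = expo n mu ` {1..n}"
    have s: "rev (sorted_list_of_set (expo n nu ` {1..n})) = map (expo n nu) [1..<n + 1]"
      if "nu \<in> box n k" for nu
      by (rule rev_sorted_list_of_image) (rule expo_strict[OF that])
    have "map (expo n lam) [1..<n + 1] = map (expo n mu) [1..<n + 1]"
      using s[OF lam] s[OF mu] eq by simp
    then have "expo n lam i = expo n mu i" if "i \<in> {1..n}" for i
      using that by (simp add: map_eq_conv del: upt_Suc)
    then show "lam = mu"
      by (intro box_eqI[OF lam mu]) (fastforce simp: expo_def)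
  qed
  show "(\<lambda>lam. expo n lam ` {1..n}) ` box n k = {M. M \<subseteq> {0..<n + k} \<and> card M = n}"
  proof (intro equalityI subsetI)
    fix M assume "M \<in> (\<lambda>lam. expo n lam ` {1..n}) ` box n k"
    then obtain lam where lam: "lam \<in> box n k" "M = expo n lam ` {1..n}" by blast
    then show "M \<in> {M. M \<subseteq> {0..<n + k} \<and> card M = n}"
      using card_image[OF inj_on_expo[OF lam(1)]] by (auto simp: expo_less)
  next
    fix M assume "M \<in> {M. M \<subseteq> {0..<n + k} \<and> card M = n}"
    then have M: "M \<subseteq> {0..<n + k}" "card M = n" "finite M" by (auto intro: finite_subset)
    let ?s = "sorted_list_of_set M"
    have s: "sorted_wrt (<) ?s" "length ?s = n" "set ?s = M" using M by auto
    let ?f = "\<lambda>i. ?s ! (n - i) - (n - i)"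
    have ge: "n - i \<le> ?s ! (n - i)" if "i \<in> {1..n}" for i
      using strict_sorted_nth_gap[OF s(1), of 0 "n - i"] that s(2) by auto
    have box: "map ?f [1..<n + 1] \<in> box n k"
    proof (rule box_mapI)
      fix i assume i: "i \<in> {1..n}"
      have "n - 1 < length ?s" using s(2) i by auto
      then have "?s ! (n - 1) \<in> M" using nth_mem[of "n - 1" ?s] s(3) by simp
      then have "?s ! (n - 1) < n + k" using M(1) by auto
      moreover have "?s ! (n - i) + (n - 1 - (n - i)) \<le> ?s ! (n - 1)"
        by (rule strict_sorted_nth_gap[OF s(1)]) (use i s(2) in auto)
      ultimately show "?f i \<le> k" using i by simp
      assume i1: "i + 1 \<in> {1..n}"
      have "?s ! (n - (i + 1)) + (n - i - (n - (i + 1))) \<le> ?s ! (n - i)"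
        by (rule strict_sorted_nth_gap[OF s(1)]) (use i i1 s(2) in auto)
      then show "?f (i + 1) \<le> ?f i" using i1 by simp
    qed
    have "expo n (map ?f [1..<n + 1]) i = ?s ! (n - i)" if "i \<in> {1..n}" for i
      using ge[OF that] that unfolding expo_def part_map[OF that] by simp
    then have "expo n (map ?f [1..<n + 1]) ` {1..n} = (\<lambda>i. ?s ! (n - i)) ` {1..n}"
      by (rule image_cong[OF refl])
    also have "\<dots> = (!) ?s ` {0..<n}"
    proof -
      have "{0..<n} = (\<lambda>i. n - i) ` {1..n}"
        by (rule bij_betw_imp_surj_on[symmetric], rule bij_betw_byWitness[where f' = "\<lambda>i. n - i"]) auto
      then show ?thesis by (simp add: image_image)
    qed
    also have "\<dots> = M" using s by (metis list.set_map map_nth set_upt)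
    finally show "M \<in> (\<lambda>lam. expo n lam ` {1..n}) ` box n k"
      using box by (intro image_eqI[where x = "map ?f [1..<n + 1]"]) auto
  qed
qed

lemma conj_part_box:
  assumes "lam \<in> box n k"
  shows "conj_part k lam \<in> box k n"
    and part_conj_part_iff: "\<And>i j. i \<in> {1..n} \<Longrightarrow> j \<in> {1..k} \<Longrightarrow>
      i \<le> part (conj_part k lam) j \<longleftrightarrow> j \<le> part lam i"
proof -
  note l = boxD(1)[OF assms]
  let ?c = "\<lambda>j. card {i \<in> {1..n}. j \<le> part lam i}"
  have c: "conj_part k lam = map ?c [1..<k + 1]"
    by (simp add: conj_part_def l)
  show "conj_part k lam \<in> box k n"
    unfolding c
  proof (rule box_mapI)
    show "?c j \<le> n" for j
      by (rule order_trans[OF card_mono[of "{1..n}"]]) auto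
    show "?c (j + 1) \<le> ?c j" for j by (rule card_mono) auto
  qed
  fix i j assume i: "i \<in> {1..n}" and j: "j \<in> {1..k}"
  have "j \<le> part lam i \<longleftrightarrow> i \<le> ?c j"
  proof
    assume "j \<le> part lam i"
    then have "{1..i} \<subseteq> {i \<in> {1..n}. j \<le> part lam i}"
      using boxD(3)[OF assms] i by (force intro: order_trans)
    from card_mono[OF _ this] show "i \<le> ?c j" by simp
  next
    assume *: "i \<le> ?c j"
    show "j \<le> part lam i"
    proof (rule ccontr)
      assume "\<not> j \<le> part lam i"
      then have "{i \<in> {1..n}. j \<le> part lam i} \<subseteq> {1..<i}"
        using boxD(3)[OF assms i] by (force simp: not_le)
      from card_mono[OF _ this] have "?c j < i" using i by auto
      with * show False by simp
    qed
  qed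
  then show "i \<le> part (conj_part k lam) j \<longleftrightarrow> j \<le> part lam i"
    by (simp only: c part_map[OF j])
qed

lemma conj_part_involution:
  assumes "lam \<in> box n k"
  shows "conj_part n (conj_part k lam) = lam"
proof (rule box_eqI)
  note b = conj_part_box(1)[OF assms]
  show bb: "conj_part n (conj_part k lam) \<in> box n k" by (rule conj_part_box[OF b])
  show "lam \<in> box n k" by fact
  fix i assume i: "i \<in> {1..n}"
  have "j \<le> part (conj_part n (conj_part k lam)) i \<longleftrightarrow> j \<le> part lam i" if "j \<in> {1..k}" for j
    using part_conj_part_iff[OF b that i] part_conj_part_iff[OF assms i that] by simp
  moreover have "part (conj_part n (conj_part k lam)) i \<le> k" "part lam i \<le> k"
    using boxD(2)[OF bb i] boxD(2)[OF assms i] by auto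
  ultimately show "part (conj_part n (conj_part k lam)) i = part lam i"
    by (metis atLeastAtMost_iff le_antisym le_zero_eq nat_le_linear not_less_eq_eq order_refl One_nat_def)
qed

text \<open>The holes of \<open>|\<lambda>\<rangle>\<close>, counted from \<open>0\<close>: the numbers \<open>n - 1 + j - \<lambda>'\<^sub>j\<close>.\<close>

definition coexpo :: "nat \<Rightarrow> nat \<Rightarrow> nat list \<Rightarrow> nat \<Rightarrow> nat" where
  "coexpo n k lam j = n + j - 1 - part (conj_part k lam) j"

lemma coexpo_eq:
  assumes "lam \<in> box n k" "j \<in> {1..k}"
  shows "coexpo n k lam j = n + k - 1 - expo k (conj_part k lam) j" 
    and "coexpo n k lam j < n + k"
    and "coexpo n k lam j + part (conj_part k lam) j + 1 = n + j"
  using boxD(2)[OF conj_part_box(1)[OF assms(1)] assms(2)] assms(2)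
  by (auto simp: coexpo_def expo_def)

lemma expo_coexpo_disjoint:
  assumes "lam \<in> box n k" "i \<in> {1..n}" "j \<in> {1..k}"
  shows "expo n lam i \<noteq> coexpo n k lam j"
  using part_conj_part_iff[OF assms] coexpo_eq(3)[OF assms(1,3)] assms(2,3)
  by (cases "j \<le> part lam i") (auto simp: expo_def)

lemma inj_on_coexpo:
  assumes "lam \<in> box n k"
  shows "inj_on (coexpo n k lam) {1..k}"
proof (rule inj_onI)
  note b = conj_part_box(1)[OF assms]
  fix i j assume i: "i \<in> {1..k}" and j: "j \<in> {1..k}" and "coexpo n k lam i = coexpo n k lam j"
  then have "expo k (conj_part k lam) i = expo k (conj_part k lam) j"
    using coexpo_eq(1)[OF assms i] coexpo_eq(1)[OF assms j] expo_less[OF b i] expo_less[OF b j] by auto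
  then show "i = j" using inj_on_expo[OF b] i j by (auto dest: inj_onD)
qed

text \<open>Reading the boundary of the diagram of \<open>\<lambda>\<close>: if the box \<open>(i, j)\<close> belongs to \<open>\<lambda>\<close>, then the hole \<open>j\<close> lies to the left of
  the particle \<open>i\<close>, and otherwise to its right.  So holes and particles never coincide, and a count shows that they
  fill all sites.\<close>

lemma coexpo_image:
  assumes "lam \<in> box n k"
  shows "coexpo n k lam ` {1..k} = {0..<n + k} - expo n lam ` {1..n}"
proof (rule card_subset_eq)
  show "coexpo n k lam ` {1..k} \<subseteq> {0..<n + k} - expo n lam ` {1..n}"
    using expo_coexpo_disjoint[OF assms] coexpo_eq(2)[OF assms] by fastforce
  have "card ({0..<n + k} - expo n lam ` {1..n}) = k"
    using card_image[OF inj_on_expo[OF assms]]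
    by (subst card_Diff_subset) (auto simp: expo_less[OF assms])
  then show "card (coexpo n k lam ` {1..k}) = card ({0..<n + k} - expo n lam ` {1..n})"
    using card_image[OF inj_on_coexpo[OF assms]] by simp
qed simp

text \<open>Conjugation of partitions is the particle-hole exchange followed by the reflection of the sites.\<close>

lemma positions_conj_part:
  assumes "lam \<in> box n k"
  shows "positions k (conj_part k lam) = (\<lambda>p. n + k + 1 - p) ` ({1..n + k} - positions n lam)"
proof -
  note b = conj_part_box(1)[OF assms]
  have "{1..n + k} = Suc ` {0..<n + k}"
    by (simp add: image_Suc_atLeastLessThan atLeastLessThanSuc_atLeastAtMost)
  then have "{1..n + k} - positions n lam = Suc ` coexpo n k lam ` {1..k}"
    unfolding positions_eq_expo coexpo_image[OF assms] by (simp add: image_set_diff)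
  then have "(\<lambda>p. n + k + 1 - p) ` ({1..n + k} - positions n lam) =
      (\<lambda>j. n + k - coexpo n k lam j) ` {1..k}"
    by (simp add: image_image)
  also have "\<dots> = (\<lambda>j. Suc (expo k (conj_part k lam) j)) ` {1..k}"
    by (rule image_cong[OF refl]) (use coexpo_eq(1)[OF assms] expo_less[OF b] in force)
  finally show ?thesis by (simp add: positions_eq_expo image_image)
qed

lemma compl_part_map:
  assumes "lam \<in> box n k"
  shows "compl_part k lam = map (\<lambda>i. k - part lam (n + 1 - i)) [1..<n + 1]"
  using boxD(1)[OF assms]
  by (intro nth_equalityI) (auto simp: compl_part_def part_def rev_nth simp del: upt_Suc)

lemma compl_part_box:
  assumes "lam \<in> box n k"
  shows "compl_part k lam \<in> box n k"
    and "i \<in> {1..n} \<Longrightarrow> part (compl_part k lam) i = k - part lam (n + 1 - i)"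
proof -
  show "compl_part k lam \<in> box n k"
    unfolding compl_part_map[OF assms]
  proof (rule box_mapI)
    fix i assume "i \<in> {1..n}" "i + 1 \<in> {1..n}"
    then show "k - part lam (n + 1 - (i + 1)) \<le> k - part lam (n + 1 - i)"
      using boxD(3)[OF assms, of "n + 1 - (i + 1)" "n + 1 - i"] by (auto simp: diff_le_mono2)
  qed simp
  show "i \<in> {1..n} \<Longrightarrow> part (compl_part k lam) i = k - part lam (n + 1 - i)"
    unfolding compl_part_map[OF assms] by (rule part_map)
qed

lemma compl_part_involution:
  assumes "lam \<in> box n k"
  shows "compl_part k (compl_part k lam) = lam"
  using assms by (auto simp: compl_part_def box_def rev_map intro!: map_idI)

lemma expo_compl_part:
  assumes "lam \<in> box n k" "i \<in> {1..n}"
  shows "expo n (compl_part k lam) i = n + k - 1 - expo n lam (n + 1 - i)"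
  using boxD(2)[OF assms(1), of "n + 1 - i"] assms(2)
  by (simp add: expo_def compl_part_box(2)[OF assms]) arith

lemma star_part_box: "lam \<in> box n k \<Longrightarrow> star_part k lam \<in> box k n"
  unfolding star_part_def by (intro conj_part_box compl_part_box)

lemma compl_star_part:
  assumes "lam \<in> box n k"
  shows "compl_part n (star_part k lam) = conj_part k lam"
proof (rule box_eqI)
  note s = star_part_box[OF assms] and c = compl_part_box(1)[OF assms]
  show "compl_part n (star_part k lam) \<in> box k n" by (rule compl_part_box[OF s])
  show cb: "conj_part k lam \<in> box k n" by (rule conj_part_box[OF assms])
  fix j assume j: "j \<in> {1..k}"
  let ?j = "k + 1 - j"
  have j': "?j \<in> {1..k}" using j by auto
  have le: "part (conj_part k lam) j \<le> n" "part (star_part k lam) ?j \<le> n"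
    using boxD(2)[OF cb j] boxD(2)[OF s j'] by auto
  have *: "n - i + 1 \<le> part (star_part k lam) ?j \<longleftrightarrow> \<not> i \<le> part (conj_part k lam) j" if i: "i \<in> {1..n}" for i
  proof -
    have i': "n + 1 - i \<in> {1..n}" "n + 1 - (n + 1 - i) = i" using i by auto
    have "n - i + 1 \<le> part (star_part k lam) ?j \<longleftrightarrow> ?j \<le> part (compl_part k lam) (n + 1 - i)"
      using part_conj_part_iff[OF c i'(1) j'] i by (simp add: star_part_def Suc_diff_le)
    also have "\<dots> \<longleftrightarrow> ?j \<le> k - part lam i"
      unfolding compl_part_box(2)[OF assms i'(1)] i'(2) ..
    also have "\<dots> \<longleftrightarrow> \<not> j \<le> part lam i" using j boxD(2)[OF assms i] by auto
    finally show ?thesis using part_conj_part_iff[OF assms i j] by simp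
  qed
  have "part (star_part k lam) ?j = n - part (conj_part k lam) j"
  proof (rule ccontr)
    assume ne: "part (star_part k lam) ?j \<noteq> n - part (conj_part k lam) j"
    show False
    proof (cases "part (star_part k lam) ?j < n - part (conj_part k lam) j")
      case True
      then have "part (conj_part k lam) j + 1 \<in> {1..n}" by auto
      with *[OF this] True show False by (simp add: Suc_diff_Suc)
    next
      case False
      then show False using *[of "part (conj_part k lam) j"] ne le
        by (cases "part (conj_part k lam) j = 0") auto
    qed
  qed
  then show "part (compl_part n (star_part k lam)) j = part (conj_part k lam) j"
    using compl_part_box(2)[OF s j] le by simp
qed

lemma bij_betw_compl_part: "bij_betw (compl_part k) (box n k) (box n k)"
  by (rule bij_betw_byWitness[where f' = "compl_part k"])
    (auto simp: compl_part_involution compl_part_box)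

text \<open>The Cauchy-Binet formula.  Indexing its \<open>n\<close>-subsets of \<open>{0..<n + k}\<close> by partitions fixes the order of the
  rows and columns of the minors, which then are alternants without further signs.\<close>

lemma cauchy_binet_box:
  fixes A B :: "nat \<Rightarrow> nat \<Rightarrow> 'a::comm_ring_1"
  shows "det1 n (\<lambda>i j. \<Sum>m<n + k. A i m * B m j) =
    (\<Sum>mu\<in>box n k. det1 n (\<lambda>i j. A i (expo n mu j)) * det1 n (\<lambda>i j. B (expo n mu i) j))"
proof -
  let ?S = "{..<n + k}" and ?P = "{p. p permutes {1..n}}"
  let ?F = "\<lambda>g. (\<Prod>i\<in>{1..n}. A i (g i)) * det1 n (\<lambda>i j. B (g i) j)"
  let ?I = "{g \<in> {1..n} \<rightarrow>\<^sub>E ?S. inj_on g {1..n}}"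
  have fin: "finite ({1..n} \<rightarrow>\<^sub>E ?S)" by (intro finite_PiE) auto
  have "det1 n (\<lambda>i j. \<Sum>m<n + k. A i m * B m j) = sum ?F ({1..n} \<rightarrow>\<^sub>E ?S)"
    by (rule det1_expand_rows) simp
  also have "\<dots> = sum ?F ?I"
  proof (rule sum.mono_neutral_right[OF fin])
    show "\<forall>g\<in>({1..n} \<rightarrow>\<^sub>E ?S) - ?I. ?F g = 0"
    proof
      fix g assume "g \<in> ({1..n} \<rightarrow>\<^sub>E ?S) - ?I"
      then obtain i j where "i \<in> {1..n}" "j \<in> {1..n}" "i \<noteq> j" "g i = g j"
        by (auto simp: inj_on_def)
      then have "det1 n (\<lambda>i j. B (g i) j) = 0" by (intro det1_identical_rows[of i n j]) auto
      then show "?F g = 0" by simp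
    qed
  qed auto
  \<comment> \<open>an injective map is an enumeration of its image in decreasing order, after a permutation\<close>
  also have "\<dots> = (\<Sum>(mu, p)\<in>box n k \<times> ?P. ?F (restrict (expo n mu \<circ> p) {1..n}))"
  proof -
    have bij: "bij_betw (\<lambda>(mu, p). restrict (expo n mu \<circ> p) {1..n}) (box n k \<times> ?P) ?I"
    proof (rule bij_betw_imageI)
      have im: "restrict (expo n mu \<circ> p) {1..n} ` {1..n} = expo n mu ` {1..n}"
        if "p permutes {1..n}" for mu p
      proof -
        have "restrict (expo n mu \<circ> p) {1..n} ` {1..n} = expo n mu ` p ` {1..n}"
          by (simp only: image_restrict_eq image_comp)
        then show ?thesis by (simp only: permutes_image[OF that])
      qed
      show "inj_on (\<lambda>(mu, p). restrict (expo n mu \<circ> p) {1..n}) (box n k \<times> ?P)"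
      proof (rule inj_onI, clarify)
        fix mu p mu' p'
        assume mu: "mu \<in> box n k" "mu' \<in> box n k" and p: "p permutes {1..n}" "p' permutes {1..n}"
          and eq: "restrict (expo n mu \<circ> p) {1..n} = restrict (expo n mu' \<circ> p') {1..n}"
        have "expo n mu ` {1..n} = expo n mu' ` {1..n}"
          using im[OF p(1), of mu] im[OF p(2), of mu'] eq by (simp only:)
        then have mm: "mu = mu'"
          using inj_onD[OF bij_betw_imp_inj_on[OF bij_betw_box_subsets] _ mu] by simp
        have "p i = p' i" for i
        proof (cases "i \<in> {1..n}")
          case True
          then have "expo n mu (p i) = expo n mu (p' i)"
            using fun_cong[OF eq, of i] mm by auto
          then show ?thesis
            using inj_on_expo[OF mu(1)] True p permutes_in_image by (metis inj_onD)
        next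
          case False
          then show ?thesis using permutes_not_in[OF p(1) False] permutes_not_in[OF p(2) False] by simp
        qed
        then show "mu = mu' \<and> p = p'" using mm by auto
      qed
      show "(\<lambda>(mu, p). restrict (expo n mu \<circ> p) {1..n}) ` (box n k \<times> ?P) = ?I"
      proof (intro equalityI subsetI)
        fix g assume "g \<in> (\<lambda>(mu, p). restrict (expo n mu \<circ> p) {1..n}) ` (box n k \<times> ?P)"
        then obtain mu p where mu: "mu \<in> box n k" and p: "p permutes {1..n}"
          and g: "g = restrict (expo n mu \<circ> p) {1..n}" by auto
        have "inj_on (expo n mu \<circ> p) {1..n}"
          using inj_on_expo[OF mu] permutes_inj_on[OF p, of "{1..n}"] permutes_image[OF p]
          by (simp add: comp_inj_on)
        moreover have lt: "expo n mu (p i) < n + k" if i: "i \<in> {1..n}" for i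
        proof -
          have "p i \<in> {1..n}" using permutes_in_image[OF p, of i] i by (rule iffD2)
          then show ?thesis by (rule expo_less[OF mu])
        qed
        moreover have "restrict (expo n mu \<circ> p) {1..n} \<in> {1..n} \<rightarrow>\<^sub>E ?S"
        proof (rule restrict_PiE_iff[THEN iffD2], rule ballI)
          fix i assume "i \<in> {1..n}"
          from lt[OF this] show "(expo n mu \<circ> p) i \<in> ?S" by simp
        qed
        ultimately show "g \<in> ?I" unfolding g by (simp only: mem_Collect_eq inj_on_restrict_eq)
      next
        fix g assume g: "g \<in> ?I"
        then have "g ` {1..n} \<in> {M. M \<subseteq> {0..<n + k} \<and> card M = n}"
          by (auto simp: card_image)
        then obtain mu where mu: "mu \<in> box n k" and M: "expo n mu ` {1..n} = g ` {1..n}"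
          using bij_betw_imp_surj_on[OF bij_betw_box_subsets] by (metis (no_types, lifting) imageE)
        have be: "bij_betw (expo n mu) {1..n} (g ` {1..n})"
          using inj_on_expo[OF mu] M by (auto simp: bij_betw_def)
        have bg: "bij_betw g {1..n} (g ` {1..n})" using g by (auto simp: bij_betw_def)
        let ?e = "inv_into {1..n} (expo n mu)"
        let ?p = "\<lambda>i. if i \<in> {1..n} then ?e (g i) else i"
        have "bij_betw (?e \<circ> g) {1..n} {1..n}"
          using bij_betw_trans[OF bg bij_betw_inv_into[OF be]] .
        then have "bij_betw ?p {1..n} {1..n}"
          by (rule bij_betw_cong[THEN iffD1, rotated]) simp
        then have p: "?p permutes {1..n}" by (rule bij_imp_permutes) (rule if_not_P)
        have "expo n mu (?e (g i)) = g i" if "i \<in> {1..n}" for i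
          using that M by (intro f_inv_into_f) auto
        then have "g = restrict (expo n mu \<circ> ?p) {1..n}"
          using g by (auto simp: fun_eq_iff PiE_def extensional_def)
        then show "g \<in> (\<lambda>(mu, p). restrict (expo n mu \<circ> p) {1..n}) ` (box n k \<times> ?P)"
          using mu p by (intro image_eqI[where x = "(mu, ?p)"]) auto
      qed
    qed
    show ?thesis
      unfolding sum.reindex_bij_betw[OF bij, of ?F, symmetric] by (simp add: case_prod_unfold)
  qed
  also have "\<dots> = (\<Sum>mu\<in>box n k. \<Sum>p\<in>?P. ?F (restrict (expo n mu \<circ> p) {1..n}))"
    by (rule sum.cartesian_product[symmetric])
  also have "\<dots> = (\<Sum>mu\<in>box n k. \<Sum>p\<in>?P. (of_int (sign p) * (\<Prod>i\<in>{1..n}. A i (expo n mu (p i)))) *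
      det1 n (\<lambda>i j. B (expo n mu i) j))"
  proof (intro sum.cong refl)
    fix mu p assume "mu \<in> box n k" and "p \<in> ?P"
    then have p: "p permutes {1..n}" by simp
    have "det1 n (\<lambda>i j. B (restrict (expo n mu \<circ> p) {1..n} i) j) = det1 n (\<lambda>i j. B (expo n mu (p i)) j)"
      by (rule det1_cong) simp
    also have "\<dots> = of_int (sign p) * det1 n (\<lambda>i j. B (expo n mu i) j)"
      by (rule det1_permute_rows[OF p, of "\<lambda>i j. B (expo n mu i) j"])
    finally show "?F (restrict (expo n mu \<circ> p) {1..n}) = (of_int (sign p) * (\<Prod>i\<in>{1..n}. A i (expo n mu (p i)))) *
      det1 n (\<lambda>i j. B (expo n mu i) j)" by (simp add: mult_ac)
  qed
  finally show ?thesis by (simp add: det1_leibniz sum_distrib_right)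
qed

section \<open>Elementary symmetric polynomials and alternants\<close>

lemma elem_sym_0: "elem_sym r 0 t = (if r = 0 then 1 else 0)"
proof -
  have "{A. A \<subseteq> {1..0::nat} \<and> int (card A) = r} = (if r = 0 then {{}} else {})" by auto
  then show ?thesis by (simp add: elem_sym_def)
qed

lemma elem_sym_Suc:
  "elem_sym r (Suc m) t = elem_sym r m t + t (Suc m) * elem_sym (r - 1) m t"
proof -
  have *: "elem_sym r m t = (\<Sum>A\<in>Pow {1..m}. if int (card A) = r then \<Prod>i\<in>A. t i else 0)" for r m
    unfolding elem_sym_def by (rule sum.mono_neutral_cong_left) auto
  have c: "card (insert (Suc m) A) = Suc (card A)" "(\<Prod>i\<in>insert (Suc m) A. t i) = t (Suc m) * (\<Prod>i\<in>A. t i)"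
    if "A \<in> Pow {1..m}" for A
  proof -
    have "finite A" "Suc m \<notin> A" using that by (auto intro: finite_subset)
    then show "card (insert (Suc m) A) = Suc (card A)" "(\<Prod>i\<in>insert (Suc m) A. t i) = t (Suc m) * (\<Prod>i\<in>A. t i)"
      by auto
  qed
  have "(\<Sum>A\<in>Pow {1..m}. if int (card (insert (Suc m) A)) = r then \<Prod>i\<in>insert (Suc m) A. t i else 0) =
      (\<Sum>A\<in>Pow {1..m}. t (Suc m) * (if int (card A) = r - 1 then \<Prod>i\<in>A. t i else 0))"
    by (rule sum.cong[OF refl]) (auto simp: c)
  then show ?thesis
    unfolding * sum_Pow_Suc by (simp add: UNIV_bool sum_distrib_left cong: if_cong)
qed

lemma elem_sym_eq_0:
  assumes "r < 0 \<or> int m < r"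
  shows "elem_sym r m t = 0"
proof -
  have "int (card A) \<noteq> r" if "A \<subseteq> {1..m}" for A
    using card_mono[OF _ that] assms by auto
  then have "{A. A \<subseteq> {1..m} \<and> int (card A) = r} = {}" by blast
  then show ?thesis unfolding elem_sym_def by (simp only: sum.empty)
qed

lemma elem_sym_uminus:
  "elem_sym (int r - int s) m (\<lambda>i. - t i) = (-1) ^ r * ((-1) ^ s * elem_sym (int r - int s) m (t :: nat \<Rightarrow> 'a::comm_ring_1))"
  unfolding elem_sym_def sum_distrib_left
proof (rule sum.cong[OF refl])
  fix A assume "A \<in> {A. A \<subseteq> {1..m} \<and> int (card A) = int r - int s}"
  then have "r = card A + s" by auto
  then show "(\<Prod>i\<in>A. - t i) = (-1) ^ r * ((-1) ^ s * (\<Prod>i\<in>A. t i))"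
    by (simp add: prod_uminus power_add mult.assoc[symmetric])
      (simp add: power_mult_distrib[symmetric] mult.assoc)
qed

lemma prod_add_elem_sym:
  assumes "m < M"
  shows "(\<Prod>i\<in>{1..m}. x + t i) = (\<Sum>c<M. elem_sym (int m - int c) m t * x ^ c)"
  using assms
proof (induction m arbitrary: M)
  case 0
  then have "(\<Sum>c<M. elem_sym (int 0 - int c) 0 t * x ^ c) = (\<Sum>c<M. if c = 0 then 1 else 0)"
    by (intro sum.cong) (auto simp: elem_sym_0)
  then show ?case using 0 by simp
next
  case (Suc m)
  then obtain M' where M': "M = Suc M'" "m < M'" by (cases M) auto
  let ?P = "\<Prod>i\<in>{1..m}. x + t i"
  have "(\<Prod>i\<in>{1..Suc m}. x + t i) = t (Suc m) * ?P + x * ?P" by (simp add: algebra_simps)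
  also have "t (Suc m) * ?P = (\<Sum>c<M. t (Suc m) * elem_sym (int m - int c) m t * x ^ c)"
    using Suc.IH[of M] Suc.prems by (simp add: sum_distrib_left mult.assoc)
  also have "x * ?P = (\<Sum>c<M'. elem_sym (int m - int c) m t * x ^ Suc c)"
    using Suc.IH[OF M'(2)] by (simp add: sum_distrib_left mult_ac)
  also have "\<dots> = (\<Sum>c<M. elem_sym (int (Suc m) - int c) m t * x ^ c)"
    unfolding M'(1) sum.lessThan_Suc_shift by (simp add: elem_sym_eq_0)
  also have "(\<Sum>c<M. t (Suc m) * elem_sym (int m - int c) m t * x ^ c) + \<dots> =
      (\<Sum>c<M. elem_sym (int (Suc m) - int c) (Suc m) t * x ^ c)"
    by (simp add: sum.distrib[symmetric] elem_sym_Suc algebra_simps)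
  finally show ?case .
qed

lemma coeff_prod_elem_sym:
  "coeff (\<Prod>i\<in>{1..m}. 1 + [:0, 1:] * [:y i:]) r = elem_sym (int r) m (y :: nat \<Rightarrow> 'a::comm_ring_1)"
proof (induction m arbitrary: r)
  case 0
  then show ?case by (simp add: elem_sym_0)
next
  case (Suc m)
  define Q where "Q = (\<Prod>i\<in>{1..m}. 1 + [:0, 1:] * [:y i:])"
  have Q: "coeff Q r = elem_sym (int r) m y" for r
    unfolding Q_def by (rule Suc.IH)
  have "(\<Prod>i\<in>{1..Suc m}. 1 + [:0, 1:] * [:y i:]) = Q + pCons 0 (smult (y (Suc m)) Q)"
    by (simp add: Q_def algebra_simps)
  then show ?case
    by (cases r) (simp_all add: Q elem_sym_Suc elem_sym_eq_0 del: prod.cl_ivl_Suc)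
qed

text \<open>The numerator of the factorial Schur function.  Working with alternants instead of quotients
  keeps all identities valid in rings, where the variables need not be distinct.\<close>

definition alternant :: "nat \<Rightarrow> (nat \<Rightarrow> 'a::comm_ring_1) \<Rightarrow> nat list \<Rightarrow> (nat \<Rightarrow> 'a) \<Rightarrow> 'a" where
  "alternant n a lam x = det1 n (\<lambda>i j. fact_power a (x j) (expo n lam i))"

abbreviation vandermonde :: "nat \<Rightarrow> (nat \<Rightarrow> 'a::comm_ring_1) \<Rightarrow> 'a" where
  "vandermonde n x \<equiv> det1 n (\<lambda>i j. x j ^ (n - i))"

lemma fact_power_zero: "fact_power (\<lambda>_. 0) x r = x ^ r"
  by (simp add: fact_power_def)

lemma fact_power_expand:
  assumes "l < M"
  shows "fact_power t y l = (\<Sum>c<M. elem_sym (int l - int c) l (\<lambda>i. - t i) * y ^ c)"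
  using prod_add_elem_sym[OF assms, of y "\<lambda>i. - t i"] by (simp add: fact_power_def)

lemma sum_expo:
  assumes "lam \<in> box n k"
  shows "(\<Sum>i\<in>{1..n}. expo n lam i) = sum_list lam + (\<Sum>i\<in>{1..n}. n - i)"
proof -
  have "sum_list lam = (\<Sum>i\<in>{0..<n}. lam ! i)"
    using boxD(1)[OF assms] by (simp add: sum_list_sum_nth)
  also have "\<dots> = (\<Sum>i\<in>{1..n}. part lam i)"
    by (simp add: sum.atLeast1_atMost_eq atLeast0LessThan part_def)
  finally have "sum_list lam + (\<Sum>i\<in>{1..n}. n - i) = (\<Sum>i\<in>{1..n}. part lam i + (n - i))"
    by (simp only: sum.distrib)
  also have "\<dots> = (\<Sum>i\<in>{1..n}. expo n lam i)"
    by (rule sum.cong) (auto simp: expo_def)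
  finally show ?thesis by simp
qed

lemma part_sub_iff:
  assumes "mu \<in> box n k" "lam \<in> box n l"
  shows "part_sub mu lam \<longleftrightarrow> (\<forall>i\<in>{1..n}. part mu i \<le> part lam i)"
proof
  assume "part_sub mu lam"
  then show "\<forall>i\<in>{1..n}. part mu i \<le> part lam i"
    using boxD(1)[OF assms(1)] by (auto simp: part_sub_def list_all2_conv_all_nth part_def)
next
  assume *: "\<forall>i\<in>{1..n}. part mu i \<le> part lam i"
  have "mu ! i \<le> lam ! i" if "i < n" for i
    using bspec[OF *, of "Suc i"] that by (simp add: part_def)
  then show "part_sub mu lam"
    using boxD(1)[OF assms(1)] boxD(1)[OF assms(2)] by (simp add: part_sub_def list_all2_conv_all_nth)
qed

text \<open>A zero block of \<open>n - r + 1\<close> rows and \<open>r\<close> columns forces the determinant to vanish, since no permutation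
  avoids it.\<close>

lemma det1_zero_block:
  assumes "r \<in> {1..n}" "\<And>i j. i \<in> {r..n} \<Longrightarrow> j \<in> {1..r} \<Longrightarrow> A i j = 0"
  shows "det1 n A = 0"
  unfolding det1_leibniz
proof (rule sum.neutral, intro ballI)
  fix p assume "p \<in> {p. p permutes {1..n}}"
  then have p: "p permutes {1..n}" by simp
  have "\<exists>i\<in>{r..n}. p i \<in> {1..r}"
  proof (rule ccontr)
    assume *: "\<not> (\<exists>i\<in>{r..n}. p i \<in> {1..r})"
    have "p ` {r..n} \<subseteq> {Suc r..n}"
    proof
      fix z assume "z \<in> p ` {r..n}"
      then obtain i where i: "i \<in> {r..n}" "z = p i" by blast
      then have "i \<in> {1..n}" using assms(1) by auto
      then have "p i \<in> {1..n}" using permutes_in_image[OF p, of i] by (rule iffD2[rotated])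
      then show "z \<in> {Suc r..n}" using * i by force
    qed
    from card_mono[OF _ this] have "card (p ` {r..n}) \<le> n - r" by simp
    moreover have "card (p ` {r..n}) = Suc n - r"
      by (subst card_image[OF permutes_inj_on[OF p]]) simp
    ultimately show False using assms(1) by auto
  qed
  then obtain i where i: "i \<in> {r..n}" "p i \<in> {1..r}" by blast
  have "(\<Prod>i\<in>{1..n}. A i (p i)) = 0"
    by (rule prod_zero) (use i assms in \<open>auto intro!: bexI[of _ i]\<close>)
  then show "of_int (sign p) * (\<Prod>i\<in>{1..n}. A i (p i)) = 0" by simp
qed

text \<open>Factorial powers are expanded into ordinary powers, and the determinant is expanded by Cauchy-Binet.
  If \<open>\<mu>\<close> is not contained in \<open>\<lambda>\<close>, the coefficient has a zero block.  The right-hand side repeats the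
  definition of \<^const>\<open>S_tilde\<close> with \<open>S\<^sub>\<mu>\<close> replaced by the ordinary alternant.\<close>

lemma alternant_expand:
  assumes lam: "lam \<in> box n k"
  shows "alternant n t lam y = (\<Sum>mu | mu \<in> box n k \<and> part_sub mu lam.
     (-1) ^ (sum_list lam - sum_list mu) *
     det1 n (\<lambda>i j. elem_sym (int (part lam i) - int (part mu j) - int i + int j)
                     (n + part lam i - i) t) * alternant n (\<lambda>_. 0) mu y)"
proof -
  let ?D = "\<lambda>mu. det1 n (\<lambda>i j. elem_sym (int (part lam i) - int (part mu j) - int i + int j)
                     (n + part lam i - i) t)"
  let ?E = "\<lambda>i j mu. elem_sym (int (expo n lam i) - int (expo n mu j)) (expo n lam i) t"
  have "alternant n t lam y =
     det1 n (\<lambda>i j. \<Sum>c<n + k. elem_sym (int (expo n lam i) - int c) (expo n lam i) (\<lambda>i. - t i) * y j ^ c)"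
    unfolding alternant_def by (rule det1_cong) (rule fact_power_expand, rule expo_less[OF lam])
  also have "\<dots> = (\<Sum>mu\<in>box n k.
      det1 n (\<lambda>i j. elem_sym (int (expo n lam i) - int (expo n mu j)) (expo n lam i) (\<lambda>i. - t i)) *
      alternant n (\<lambda>_. 0) mu y)"
    unfolding alternant_def fact_power_zero by (rule cauchy_binet_box)
  also have "\<dots> = (\<Sum>mu\<in>box n k. if part_sub mu lam then
     (-1) ^ (sum_list lam - sum_list mu) * ?D mu * alternant n (\<lambda>_. 0) mu y else 0)"
  proof (rule sum.cong[OF refl])
    fix mu assume mu: "mu \<in> box n k"
    have D: "?D mu = det1 n (\<lambda>i j. ?E i j mu)"
      by (rule det1_cong) (auto simp: expo_def of_nat_diff algebra_simps)
    have "det1 n (\<lambda>i j. elem_sym (int (expo n lam i) - int (expo n mu j)) (expo n lam i) (\<lambda>i. - t i)) =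
      det1 n (\<lambda>i j. (-1) ^ expo n lam i * ((-1) ^ expo n mu j * ?E i j mu))"
      by (simp only: elem_sym_uminus)
    also have "\<dots> = (\<Prod>i\<in>{1..n}. (-1) ^ expo n lam i) * ((\<Prod>j\<in>{1..n}. (-1) ^ expo n mu j) * ?D mu)"
      unfolding D det1_scale_rows det1_scale_cols ..
    also have "\<dots> = (-1) ^ (sum_list lam + sum_list mu) * ?D mu"
    proof -
      have "even ((\<Sum>i\<in>{1..n}. expo n lam i) + (\<Sum>i\<in>{1..n}. expo n mu i)) \<longleftrightarrow>
          even (sum_list lam + sum_list mu)"
        unfolding sum_expo[OF lam] sum_expo[OF mu] even_add by blast
      then have "(-1 :: 'a) ^ ((\<Sum>i\<in>{1..n}. expo n lam i) + (\<Sum>i\<in>{1..n}. expo n mu i)) =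
          (-1) ^ (sum_list lam + sum_list mu)"
        by (simp only: minus_one_power_iff)
      then show ?thesis by (simp only: power_sum[symmetric] power_add mult.assoc[symmetric])
    qed
    finally have 1: "det1 n (\<lambda>i j. elem_sym (int (expo n lam i) - int (expo n mu j)) (expo n lam i) (\<lambda>i. - t i)) =
        (-1) ^ (sum_list lam + sum_list mu) * ?D mu" .
    show "det1 n (\<lambda>i j. elem_sym (int (expo n lam i) - int (expo n mu j)) (expo n lam i) (\<lambda>i. - t i)) *
        alternant n (\<lambda>_. 0) mu y = (if part_sub mu lam then
        (-1) ^ (sum_list lam - sum_list mu) * ?D mu * alternant n (\<lambda>_. 0) mu y else 0)"
    proof (cases "part_sub mu lam")
      case True
      then have "sum_list mu \<le> sum_list lam"
        unfolding part_sub_def by (induction rule: list_all2_induct) auto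
      then have "even (sum_list lam + sum_list mu) = even (sum_list lam - sum_list mu)" by simp
      then have "(-1 :: 'a) ^ (sum_list lam + sum_list mu) = (-1) ^ (sum_list lam - sum_list mu)"
        by (simp add: minus_one_power_iff)
      with 1 True show ?thesis by simp
    next
      case False
      then obtain r where r: "r \<in> {1..n}" "part lam r < part mu r"
        using part_sub_iff[OF mu lam] not_le by blast
      have "?D mu = 0" unfolding D
      proof (rule det1_zero_block[OF r(1)])
        fix i j assume i: "i \<in> {r..n}" and j: "j \<in> {1..r}"
        have "part lam i \<le> part lam r" "part mu r \<le> part mu j"
          using boxD(3)[OF lam r(1), of i] boxD(3)[OF mu _ r(1), of j] i j r(1) by auto
        then have "expo n lam i < expo n mu j" using i j r by (auto simp: expo_def)
        then show "?E i j mu = 0" by (intro elem_sym_eq_0) auto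
      qed
      with 1 False show ?thesis by simp
    qed
  qed
  also have "\<dots> = (\<Sum>mu | mu \<in> box n k \<and> part_sub mu lam.
     (-1) ^ (sum_list lam - sum_list mu) * ?D mu * alternant n (\<lambda>_. 0) mu y)"
    by (rule sum.mono_neutral_cong_right) (auto simp: finite_box)
  finally show ?thesis .
qed

lemma box_0: "box n 0 = {replicate n 0}"
proof -
  have "lam = replicate n 0" if "lam \<in> box n 0" for lam
    using boxD(1)[OF that] that by (auto simp: box_def intro: replicate_eqI)
  moreover have "replicate n 0 \<in> box n 0" by (simp add: box_def sorted_wrt_iff_nth_less)
  ultimately show ?thesis by blast
qed

lemma replicate_box: "replicate n 0 \<in> box n k"
  by (simp add: box_def sorted_wrt_iff_nth_less)

lemma part_replicate: "i \<in> {1..n} \<Longrightarrow> part (replicate n 0) i = 0"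
  by (auto simp: part_def)

lemma expo_replicate: "i \<in> {1..n} \<Longrightarrow> expo n (replicate n 0) i = n - i"
  by (simp add: expo_def part_replicate)

text \<open>The multiplicativity of the determinant in the form that \<open>cauchy_binet_box\<close> takes for \<open>k = 0\<close>, with rows and columns
  in the order of decreasing exponents.\<close>

lemma cauchy_binet_square:
  fixes A B :: "nat \<Rightarrow> nat \<Rightarrow> 'a::comm_ring_1"
  shows "det1 n (\<lambda>i j. \<Sum>m<n. A i m * B m j) =
    det1 n (\<lambda>i j. A i (n - j)) * det1 n (\<lambda>i j. B (n - i) j)"
proof -
  have "det1 n (\<lambda>i j. \<Sum>m<n. A i m * B m j) =
      det1 n (\<lambda>i j. A i (expo n (replicate n 0) j)) * det1 n (\<lambda>i j. B (expo n (replicate n 0) i) j)"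
    using cauchy_binet_box[where n = n and k = 0 and A = A and B = B] by (simp add: box_0)
  also have "det1 n (\<lambda>i j. A i (expo n (replicate n 0) j)) = det1 n (\<lambda>i j. A i (n - j))"
    by (rule det1_cong) (simp add: expo_replicate)
  also have "det1 n (\<lambda>i j. B (expo n (replicate n 0) i) j) = det1 n (\<lambda>i j. B (n - i) j)"
    by (rule det1_cong) (simp add: expo_replicate)
  finally show ?thesis .
qed

lemma det1_triangular:
  assumes "\<And>i j. i \<in> {1..n} \<Longrightarrow> j \<in> {1..n} \<Longrightarrow> j < i \<Longrightarrow> A i j = 0"
  shows "det1 n A = (\<Prod>i\<in>{1..n}. A i i)"
proof -
  let ?M = "mat n n (\<lambda>(i, j). A (i + 1) (j + 1))"
  have "upper_triangular ?M" using assms by (auto intro!: upper_triangularI)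
  then have "det ?M = prod_list (diag_mat ?M)" by (intro det_upper_triangular[of _ n]) auto
  also have "\<dots> = (\<Prod>i\<in>{1..n}. A i i)"
    by (simp add: prod_list_diag_prod prod.atLeast1_atMost_eq atLeast0LessThan)
  finally show ?thesis by (simp add: det1_def)
qed

text \<open>The factorial powers \<open>(y|t)\<^sup>0, \<dots>, (y|t)\<^bsup>n-1\<^esup>\<close> arise from the powers of \<open>y\<close> by a unitriangular matrix.\<close>

lemma alternant_empty: "alternant n t (replicate n 0) y = vandermonde n y"
proof -
  have "alternant n t (replicate n 0) y =
      det1 n (\<lambda>i j. \<Sum>c<n. elem_sym (int (n - i) - int c) (n - i) (\<lambda>i. - t i) * y j ^ c)"
    unfolding alternant_def
    by (rule det1_cong) (subst expo_replicate, assumption, rule fact_power_expand, auto)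
  also have "\<dots> = det1 n (\<lambda>i j. elem_sym (int (n - i) - int (n - j)) (n - i) (\<lambda>i. - t i)) *
      vandermonde n y"
    by (rule cauchy_binet_square)
  also have "det1 n (\<lambda>i j. elem_sym (int (n - i) - int (n - j)) (n - i) (\<lambda>i. - t i)) = 1"
  proof (subst det1_triangular)
    fix i j assume "i \<in> {1..n}" "j \<in> {1..n}" "j < i"
    then show "elem_sym (int (n - i) - int (n - j)) (n - i) (\<lambda>i. - t i) = 0"
      by (intro elem_sym_eq_0) auto
  next
    have 0: "elem_sym 0 m s = 1" for m and s :: "nat \<Rightarrow> 'a"
      by (induction m) (simp_all add: elem_sym_0 elem_sym_Suc elem_sym_eq_0)
    show "(\<Prod>i\<in>{1..n}. elem_sym (int (n - i) - int (n - i)) (n - i) (\<lambda>i. - t i)) = 1"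
      by (rule prod.neutral) (simp add: 0)
  qed
  finally show ?thesis by simp
qed

section \<open>The factorial Cauchy identity\<close>

text \<open>Replacing in \<open>(x|t)\<^sup>N\<close> the first \<open>m\<close> factors \<open>x - t\<^sub>i\<close> by \<open>y - t\<^sub>i\<close> interpolates between the two terms on
  the right, and passing from \<open>m\<close> to \<open>m + 1\<close> changes one factor by \<open>x - y\<close>.\<close>

lemma fact_power_telescope:
  fixes x y :: "'a::comm_ring_1"
  shows "(x - y) * (\<Sum>m<N. fact_power t y m * fact_power (rev_params N t) x (N - 1 - m)) =
    fact_power t x N - fact_power t y N"
proof -
  let ?Q = "\<lambda>m. fact_power t y m * (\<Prod>i\<in>{Suc m..N}. x - t i)"
  have rev: "fact_power (rev_params N t) x (N - 1 - m) = (\<Prod>i\<in>{Suc (Suc m)..N}. x - t i)" if "m < N" for m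
    unfolding fact_power_def rev_params_def
    by (rule prod.reindex_bij_witness[where i = "\<lambda>i. N + 1 - i" and j = "\<lambda>i. N + 1 - i"]) (use that in auto)
  have "(x - y) * (fact_power t y m * fact_power (rev_params N t) x (N - 1 - m)) = ?Q m - ?Q (Suc m)"
    if "m < N" for m
  proof -
    have "{Suc m..N} = insert (Suc m) {Suc (Suc m)..N}" using that by auto
    then have "(\<Prod>i\<in>{Suc m..N}. x - t i) = (x - t (Suc m)) * (\<Prod>i\<in>{Suc (Suc m)..N}. x - t i)" by simp
    moreover have "fact_power t y (Suc m) = fact_power t y m * (y - t (Suc m))"
      by (simp add: fact_power_def)
    ultimately show ?thesis unfolding rev[OF that] by (simp only:) (simp only: algebra_simps)
  qed
  then have "(x - y) * (\<Sum>m<N. fact_power t y m * fact_power (rev_params N t) x (N - 1 - m)) =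
      (\<Sum>m<N. ?Q m - ?Q (Suc m))"
    by (simp add: sum_distrib_left)
  also have "\<dots> = ?Q 0 - ?Q N" by (rule sum_lessThan_telescope')
  finally show ?thesis by (simp add: fact_power_def)
qed

lemma fact_power_hom:
  assumes "comm_ring_hom f"
  shows "f (fact_power a x r) = fact_power (\<lambda>i. f (a i)) (f x) r"
proof -
  interpret comm_ring_hom f by fact
  show ?thesis by (simp add: fact_power_def hom_distribs)
qed

lemma comm_ring_hom_poly: "comm_ring_hom (\<lambda>p. poly p (x :: 'a::comm_ring_1))"
  by unfold_locales auto

text \<open>The telescope with the variables \<open>y\<close> themselves as parameters, where the second term vanishes.  The factor
  \<open>x - y\<^sub>j\<close> is cancelled for an indeterminate \<open>x\<close>, so that \<open>x = y\<^sub>j\<close> is included.\<close>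

lemma lagrange_telescope:
  fixes x :: "'a::idom"
  assumes j: "j \<in> {1..n}"
  shows "(\<Sum>m<n. fact_power y (y j) m * fact_power (rev_params n y) x (n - 1 - m)) =
    (\<Prod>l\<in>{1..n} - {j}. x - y l)"
proof -
  interpret p: comm_ring_hom "\<lambda>p. poly p x" by (rule comm_ring_hom_poly)
  let ?y = "\<lambda>i. [:y i:]" and ?X = "[:0, 1:] :: 'a poly"
  let ?S = "\<Sum>m<n. fact_power ?y (?y j) m * fact_power (rev_params n ?y) ?X (n - 1 - m)"
  have "(?X - ?y j) * ?S = fact_power ?y ?X n - fact_power ?y (?y j) n"
    by (rule fact_power_telescope)
  also have "fact_power ?y (?y j) n = 0"
    unfolding fact_power_def by (rule prod_zero) (use j in auto)
  also have "fact_power ?y ?X n - 0 = (?X - ?y j) * (\<Prod>l\<in>{1..n} - {j}. ?X - ?y l)"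
    unfolding fact_power_def diff_zero by (rule prod.remove) (use j in auto)
  finally have "?S = (\<Prod>l\<in>{1..n} - {j}. ?X - ?y l)"
    by (subst (asm) mult_left_cancel) auto
  then have "poly ?S x = poly (\<Prod>l\<in>{1..n} - {j}. ?X - ?y l) x" by simp
  then show ?thesis
    by (simp add: poly_sum poly_prod fact_power_hom[OF comm_ring_hom_poly] rev_params_def[abs_def])
qed

text \<open>The numerator of the Cauchy determinant.  By \<open>lagrange_telescope\<close> its entries are a product of two
  matrices of factorial powers, and the parameters drop out by \<open>alternant_empty\<close>.\<close>

lemma det1_cauchy_numerator:
  fixes x y :: "nat \<Rightarrow> 'a::idom"
  shows "det1 n (\<lambda>i j. \<Prod>l\<in>{1..n} - {j}. x i - y l) = rev_sign n * (vandermonde n x * vandermonde n y)"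
proof -
  have "det1 n (\<lambda>i j. \<Prod>l\<in>{1..n} - {j}. x i - y l) =
    det1 n (\<lambda>i j. \<Sum>m<n. fact_power (rev_params n y) (x i) (n - 1 - m) * fact_power y (y j) m)"
    by (rule det1_cong) (simp add: lagrange_telescope[symmetric] mult.commute del: One_nat_def)
  also have "\<dots> = det1 n (\<lambda>i j. fact_power (rev_params n y) (x i) (n - 1 - (n - j))) *
     det1 n (\<lambda>i j. fact_power y (y j) (n - i))"
    by (rule cauchy_binet_square)
  also have "det1 n (\<lambda>i j. fact_power y (y j) (n - i)) = alternant n y (replicate n 0) y"
    unfolding alternant_def by (rule det1_cong) (simp add: expo_replicate)
  also have "det1 n (\<lambda>i j. fact_power (rev_params n y) (x i) (n - 1 - (n - j))) =
     det1 n (\<lambda>i j. fact_power (rev_params n y) (x i) (n - (n + 1 - j)))"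
    by (rule det1_cong) (simp add: Suc_diff_le)
  also have "\<dots> = rev_sign n * det1 n (\<lambda>i j. fact_power (rev_params n y) (x i) (n - j))"
    by (rule det1_reverse_cols)
  also have "det1 n (\<lambda>i j. fact_power (rev_params n y) (x i) (n - j)) =
     det1 n (\<lambda>i j. fact_power (rev_params n y) (x j) (n - i))"
    by (rule det1_transpose[symmetric])
  also have "\<dots> = alternant n (rev_params n y) (replicate n 0) x"
    unfolding alternant_def by (rule det1_cong) (simp add: expo_replicate)
  finally show ?thesis by (simp add: alternant_empty mult.assoc)
qed

text \<open>For \<open>x = y\<close> the matrix of \<open>det1_cauchy_numerator\<close> is diagonal.  This spares the product formula for the
  Vandermonde determinant.\<close>

lemma vandermonde_nonzero:
  fixes y :: "nat \<Rightarrow> 'a::idom"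
  assumes "inj_on y {1..n}"
  shows "vandermonde n y \<noteq> 0"
proof -
  have "det1 n (\<lambda>i j. \<Prod>l\<in>{1..n} - {j}. y i - y l) = (\<Prod>i\<in>{1..n}. \<Prod>l\<in>{1..n} - {i}. y i - y l)"
  proof (rule det1_triangular)
    fix i j assume "i \<in> {1..n}" "j < i"
    then show "(\<Prod>l\<in>{1..n} - {j}. y i - y l) = 0" by (intro prod_zero) auto
  qed
  also have "\<dots> \<noteq> 0"
  proof -
    have "y i - y l \<noteq> 0" if "i \<in> {1..n}" "l \<in> {1..n} - {i}" for i l
      using inj_onD[OF assms, of i l] that by auto
    then show ?thesis by (simp only: prod_zero_iff finite_atLeastAtMost finite_Diff) blast
  qed
  finally show ?thesis unfolding det1_cauchy_numerator by auto
qed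

text \<open>The hypothesis says that \<open>P i\<close> is the numerator of the divided difference of \<open>(x|t)\<^bsup>n+k\<^esup>\<close> at \<open>x\<^sub>i\<close> and \<open>y\<^sub>j\<close>.
  It does not depend on \<open>j\<close> exactly when the \<open>y\<^sub>j\<close> solve one and the same Bethe equation.\<close>

lemma cauchy_identity:
  fixes x y :: "nat \<Rightarrow> 'a::idom"
  assumes P: "\<And>i j. i \<in> {1..n} \<Longrightarrow> j \<in> {1..n} \<Longrightarrow>
    fact_power t (x i) (n + k) - fact_power t (y j) (n + k) = P i"
  shows "(\<Prod>i\<in>{1..n}. \<Prod>j\<in>{1..n}. x i - y j) *
      (\<Sum>nu\<in>box n k. alternant n (rev_params (n + k) t) (compl_part k nu) x * alternant n t nu y) =
    (\<Prod>i\<in>{1..n}. P i) * (vandermonde n x * vandermonde n y)"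
proof -
  let ?T = "rev_params (n + k) t" and ?N = "n + k"
  let ?psi = "\<lambda>i j. \<Sum>m<?N. fact_power ?T (x i) (?N - 1 - m) * fact_power t (y j) m"
  have "det1 n ?psi = (\<Sum>nu\<in>box n k. det1 n (\<lambda>i j. fact_power ?T (x i) (?N - 1 - expo n nu j)) * alternant n t nu y)"
    unfolding alternant_def by (rule cauchy_binet_box)
  also have "\<dots> = (\<Sum>nu\<in>box n k. rev_sign n * (alternant n ?T (compl_part k nu) x * alternant n t nu y))"
  proof (rule sum.cong[OF refl])
    fix nu assume nu: "nu \<in> box n k"
    have "det1 n (\<lambda>i j. fact_power ?T (x i) (?N - 1 - expo n nu j)) =
       det1 n (\<lambda>i j. fact_power ?T (x i) (expo n (compl_part k nu) (n + 1 - j)))"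
      by (rule det1_cong) (subst expo_compl_part[OF nu], auto)
    also have "\<dots> = rev_sign n * det1 n (\<lambda>i j. fact_power ?T (x i) (expo n (compl_part k nu) j))"
      by (rule det1_reverse_cols)
    also have "det1 n (\<lambda>i j. fact_power ?T (x i) (expo n (compl_part k nu) j)) = alternant n ?T (compl_part k nu) x"
      unfolding alternant_def by (rule det1_transpose[symmetric])
    finally show "det1 n (\<lambda>i j. fact_power ?T (x i) (?N - 1 - expo n nu j)) * alternant n t nu y =
        rev_sign n * (alternant n ?T (compl_part k nu) x * alternant n t nu y)" by (simp add: mult.assoc)
  qed
  finally have 1: "det1 n ?psi = rev_sign n *
      (\<Sum>nu\<in>box n k. alternant n ?T (compl_part k nu) x * alternant n t nu y)"
    by (simp add: sum_distrib_left)
  have "(\<Prod>i\<in>{1..n}. \<Prod>j\<in>{1..n}. x i - y j) * det1 n ?psi =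
      det1 n (\<lambda>i j. (\<Prod>j\<in>{1..n}. x i - y j) * ?psi i j)"
    by (rule det1_scale_rows[symmetric])
  also have "\<dots> = det1 n (\<lambda>i j. P i * (\<Prod>l\<in>{1..n} - {j}. x i - y l))"
  proof (rule det1_cong)
    fix i j assume i: "i \<in> {1..n}" and j: "j \<in> {1..n}"
    have 1: "(\<Prod>j\<in>{1..n}. x i - y j) = (x i - y j) * (\<Prod>l\<in>{1..n} - {j}. x i - y l)"
      by (rule prod.remove) (use j in auto)
    have 2: "(x i - y j) * ?psi i j = P i"
      using fact_power_telescope[of "x i" "y j" t ?N] P[OF i j] by (simp add: mult.commute)
    have "(\<Prod>j\<in>{1..n}. x i - y j) * ?psi i j =
        (x i - y j) * ?psi i j * (\<Prod>l\<in>{1..n} - {j}. x i - y l)"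
      unfolding 1 by (simp only: mult_ac)
    then show "(\<Prod>j\<in>{1..n}. x i - y j) * ?psi i j = P i * (\<Prod>l\<in>{1..n} - {j}. x i - y l)"
      unfolding 2 .
  qed
  also have "\<dots> = (\<Prod>i\<in>{1..n}. P i) * (rev_sign n * (vandermonde n x * vandermonde n y))"
    by (simp only: det1_scale_rows det1_cauchy_numerator)
  finally have "rev_sign n * ((\<Prod>i\<in>{1..n}. \<Prod>j\<in>{1..n}. x i - y j) *
      (\<Sum>nu\<in>box n k. alternant n ?T (compl_part k nu) x * alternant n t nu y)) =
      rev_sign n * ((\<Prod>i\<in>{1..n}. P i) * (vandermonde n x * vandermonde n y))"
    unfolding 1 by (simp only: mult.left_commute)
  moreover have "rev_sign n \<noteq> (0::'a)" using rev_sign_square[of n] by (metis mult_zero_left zero_neq_one)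
  ultimately show ?thesis by simp
qed

section \<open>The dual Jacobi-Trudi identity\<close>

lemma det1_upper_right_zero:
  fixes A :: "nat \<Rightarrow> nat \<Rightarrow> 'a::idom"
  assumes "\<And>i j. i \<in> {1..n} \<Longrightarrow> j \<in> {1..k} \<Longrightarrow> A i (n + j) = 0"
  shows "det1 (n + k) A = det1 n A * det1 k (\<lambda>i j. A (n + i) (n + j))"
proof -
  let ?M1 = "mat n n (\<lambda>(i, j). A (i + 1) (j + 1))"
  let ?M3 = "mat k n (\<lambda>(i, j). A (n + i + 1) (j + 1))"
  let ?M4 = "mat k k (\<lambda>(i, j). A (n + (i + 1)) (n + (j + 1)))"
  have z: "A (Suc i) (Suc j) = 0" if "i < n" "\<not> j < n" "j < n + k" for i j
  proof -
    have "Suc j - n \<in> {1..k}" "Suc i \<in> {1..n}" "n + (Suc j - n) = Suc j" using that by auto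
    then show ?thesis using assms[of "Suc i" "Suc j - n"] by simp
  qed
  have "mat (n + k) (n + k) (\<lambda>(i, j). A (i + 1) (j + 1)) = four_block_mat ?M1 (0\<^sub>m n k) ?M3 ?M4"
    by (rule eq_matI) (auto simp: z)
  then show ?thesis
    unfolding det1_def by (simp only:) (rule det_four_block_mat_upper_right_zero, auto)
qed

lemma det1_lower_left_zero:
  fixes A :: "nat \<Rightarrow> nat \<Rightarrow> 'a::idom"
  assumes "\<And>i j. i \<in> {1..n} \<Longrightarrow> j \<in> {1..k} \<Longrightarrow> A (n + j) i = 0"
  shows "det1 (n + k) A = det1 n A * det1 k (\<lambda>i j. A (n + i) (n + j))"
  using det1_upper_right_zero[of n k "\<lambda>i j. A j i", OF assms]
  by (simp only: det1_transpose[of "n + k" A] det1_transpose[of n A] det1_transpose[of k "\<lambda>i j. A (n + i) (n + j)"])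

lemma nat_eqI_le:
  fixes a b :: nat
  assumes "a \<le> n" "b \<le> n" "\<And>r. r \<in> {1..n} \<Longrightarrow> r \<le> a \<longleftrightarrow> r \<le> b"
  shows "a = b"
proof -
  have "a \<le> b" using assms(3)[of a] assms(1) by (cases "a = 0") auto
  moreover have "b \<le> a" using assms(3)[of b] assms(2) by (cases "b = 0") auto
  ultimately show ?thesis by simp
qed

text \<open>Removing the last box of the last nonempty row \<open>i\<close>, which lies in the column \<open>a\<close>, exchanges the
  particle \<open>i\<close> with the hole \<open>a\<close> and leaves everything else in place.\<close>

lemma remove_box:
  assumes lam: "lam \<in> box n k" and pos: "0 < (\<Sum>j\<in>{1..k}. part (conj_part k lam) j)"
  obtains mu i a where "mu \<in> box n k" "i \<in> {1..n}" "a \<in> {1..k}"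
    and "expo n lam i = expo n mu i + 1" "\<And>r. r \<in> {1..n} \<Longrightarrow> r \<noteq> i \<Longrightarrow> expo n mu r = expo n lam r"
    and "part (conj_part k lam) a = part (conj_part k mu) a + 1"
    and "\<And>j. j \<in> {1..k} \<Longrightarrow> j \<noteq> a \<Longrightarrow> part (conj_part k mu) j = part (conj_part k lam) j"
    and "coexpo n k lam a = expo n mu i" "coexpo n k mu a = expo n lam i"
proof -
  note c = conj_part_box(1)[OF lam] and iff = part_conj_part_iff[OF lam]
  have "\<exists>j\<in>{1..k}. 0 < part (conj_part k lam) j"
    by (rule ccontr) (use pos in simp)
  then obtain j0 where j0: "j0 \<in> {1..k}" "0 < part (conj_part k lam) j0" by blast
  \<comment> \<open>the number of nonempty rows\<close>
  define i where "i = part (conj_part k lam) 1"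
  have k1: "1 \<in> {1..k}" using j0 by auto
  have "1 \<le> i" using boxD(3)[OF c k1 j0(1)] j0 by (auto simp: i_def)
  moreover have "i \<le> n" unfolding i_def by (rule boxD(2)[OF c k1])
  ultimately have i: "i \<in> {1..n}" by simp
  define a where "a = part lam i"
  have a: "a \<in> {1..k}" using iff[OF i k1] boxD(2)[OF lam i] by (auto simp: a_def i_def)
  have zero: "part lam r = 0" if "r \<in> {1..n}" "i < r" for r
    using iff[OF that(1) k1] that(2) by (simp add: i_def)
  define f where "f r = (if r = i then a - 1 else part lam r)" for r
  define mu where "mu = map f [1..<n + 1]"
  have mu_part: "part mu r = f r" if "r \<in> {1..n}" for r
    unfolding mu_def by (rule part_map[OF that])
  have mu: "mu \<in> box n k"
    unfolding mu_def
  proof (rule box_mapI)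
    fix r assume r: "r \<in> {1..n}"
    show "f r \<le> k" using boxD(2)[OF lam r] a by (auto simp: f_def)
    assume r1: "r + 1 \<in> {1..n}"
    have "part lam (r + 1) \<le> part lam r" by (rule boxD(3)[OF lam r r1]) simp
    then show "f (r + 1) \<le> f r"
      using zero[OF r1] by (auto simp: f_def a_def)
  qed
  note iff' = part_conj_part_iff[OF mu]
  have le: "part (conj_part k lam) j \<le> n" "part (conj_part k mu) j \<le> n" if "j \<in> {1..k}" for j
    using boxD(2)[OF c that] boxD(2)[OF conj_part_box(1)[OF mu] that] .
  have ca: "part (conj_part k lam) a = i"
  proof (rule nat_eqI_le[OF le(1)[OF a]])
    show "i \<le> n" using i by simp
    fix r assume r: "r \<in> {1..n}"
    show "r \<le> part (conj_part k lam) a \<longleftrightarrow> r \<le> i"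
      unfolding iff[OF r a] using boxD(3)[OF lam r i] zero[OF r] a by (cases "r \<le> i") (auto simp: a_def)
  qed
  have cma: "part (conj_part k mu) a = i - 1"
  proof (rule nat_eqI_le[OF le(2)[OF a]])
    show "i - 1 \<le> n" using i by auto
    fix r assume r: "r \<in> {1..n}"
    consider "r < i" | "r = i" | "i < r" by linarith
    then show "r \<le> part (conj_part k mu) a \<longleftrightarrow> r \<le> i - 1"
      unfolding iff'[OF r a] mu_part[OF r]
      using boxD(3)[OF lam r i] zero[OF r] a i by cases (auto simp: f_def a_def)
  qed
  have cj: "part (conj_part k mu) j = part (conj_part k lam) j" if j: "j \<in> {1..k}" "j \<noteq> a" for j
  proof (rule nat_eqI_le[OF le(2)[OF j(1)] le(1)[OF j(1)]])
    fix r assume r: "r \<in> {1..n}"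
    show "r \<le> part (conj_part k mu) j \<longleftrightarrow> r \<le> part (conj_part k lam) j"
      unfolding iff'[OF r j(1)] iff[OF r j(1)] mu_part[OF r] using j(2) by (auto simp: f_def a_def)
  qed
  have ex: "expo n lam i = a + n - i" "expo n mu i = a - 1 + n - i"
    using i by (simp_all add: expo_def mu_part f_def a_def)
  show ?thesis
  proof (rule that[OF mu i a _ _ _ cj])
    show "expo n lam i = expo n mu i + 1" using ex a i by auto
    show "expo n mu r = expo n lam r" if "r \<in> {1..n}" "r \<noteq> i" for r
      using that by (simp add: expo_def mu_part f_def)
    show "part (conj_part k lam) a = part (conj_part k mu) a + 1" using ca cma i by simp
    show "coexpo n k lam a = expo n mu i" "coexpo n k mu a = expo n lam i"
      using ex a i by (auto simp: coexpo_def ca cma)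
  qed
qed

text \<open>The row of an \<open>(n + k) \<times> (n + k)\<close> matrix attached to the monomial \<open>z\<^sup>c\<close>: its values at the \<open>n\<close>
  points \<open>y\<close>, followed by its coefficients at \<open>z\<^sup>n, \<dots>, z\<^bsup>n+k-1\<^esup>\<close>.\<close>

definition confluent_row :: "nat \<Rightarrow> (nat \<Rightarrow> 'a::comm_ring_1) \<Rightarrow> nat \<Rightarrow> nat \<Rightarrow> 'a" where
  "confluent_row n y c j = (if j \<le> n then y j ^ c else if c = j - 1 then 1 else 0)"

text \<open>This computes the sign of the permutation that lists the particles before the holes: every
  removed box contributes one transposition of rows.\<close>

lemma det1_shuffled_rows:
  fixes y :: "nat \<Rightarrow> 'a::idom"
  assumes "lam \<in> box n k"
  shows "det1 (n + k) (\<lambda>r. confluent_row n y (if r \<le> n then expo n lam r else coexpo n k lam (r - n))) =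
    (-1) ^ (\<Sum>j\<in>{1..k}. part (conj_part k lam) j) * vandermonde n y"
  using assms
proof (induction "\<Sum>j\<in>{1..k}. part (conj_part k lam) j" arbitrary: lam)
  case 0
  note lam = 0(2)
  have z: "part (conj_part k lam) j = 0" if "j \<in> {1..k}" for j
    using 0(1) that by (simp add: eq_commute[of 0])
  have e: "expo n lam i = n - i" if "i \<in> {1..n}" for i
  proof -
    have "part lam i = 0"
      using part_conj_part_iff[OF lam that, of "part lam i"] z[of "part lam i"] boxD(2)[OF lam that] that
      by (cases "part lam i = 0") auto
    then show ?thesis by (simp add: expo_def)
  qed
  have d: "coexpo n k lam j = n + j - 1" if "j \<in> {1..k}" for j
    using z[OF that] by (simp add: coexpo_def)
  let ?A = "\<lambda>r. confluent_row n y (if r \<le> n then expo n lam r else coexpo n k lam (r - n))"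
  have "det1 (n + k) ?A = det1 n ?A * det1 k (\<lambda>i j. ?A (n + i) (n + j))"
    by (rule det1_upper_right_zero) (auto simp: confluent_row_def e)
  also have "det1 n ?A = vandermonde n y"
    by (rule det1_cong) (auto simp: confluent_row_def e)
  also have "det1 k (\<lambda>i j. ?A (n + i) (n + j)) = (\<Prod>i\<in>{1..k}. ?A (n + i) (n + i))"
    by (rule det1_triangular) (auto simp: confluent_row_def d)
  also have "\<dots> = 1"
    by (rule prod.neutral) (auto simp: confluent_row_def d)
  finally show ?case using 0(1) by simp
next
  case (Suc s)
  obtain mu i a where mu: "mu \<in> box n k" and i: "i \<in> {1..n}" and a: "a \<in> {1..k}"
    and ei: "expo n lam i = expo n mu i + 1" and er: "\<And>r. r \<in> {1..n} \<Longrightarrow> r \<noteq> i \<Longrightarrow> expo n mu r = expo n lam r"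
    and ca: "part (conj_part k lam) a = part (conj_part k mu) a + 1"
    and cj: "\<And>j. j \<in> {1..k} \<Longrightarrow> j \<noteq> a \<Longrightarrow> part (conj_part k mu) j = part (conj_part k lam) j"
    and co: "coexpo n k lam a = expo n mu i" "coexpo n k mu a = expo n lam i"
    by (rule remove_box[OF Suc.prems]) (use Suc.hyps(2) in auto)
  let ?R = "\<lambda>lam r. if r \<le> n then expo n lam r else coexpo n k lam (r - n)"
  have s: "s = (\<Sum>j\<in>{1..k}. part (conj_part k mu) j)"
  proof -
    have "(\<Sum>j\<in>{1..k}. part (conj_part k nu) j) = part (conj_part k nu) a +
        (\<Sum>j\<in>{1..k} - {a}. part (conj_part k nu) j)" for nu
      by (rule sum.remove) (use a in auto)
    moreover have "(\<Sum>j\<in>{1..k} - {a}. part (conj_part k mu) j) = (\<Sum>j\<in>{1..k} - {a}. part (conj_part k lam) j)"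
      by (rule sum.cong) (auto simp: cj)
    ultimately show ?thesis using Suc.hyps(2) ca by simp
  qed
  let ?t = "transpose i (n + a)"
  have t: "?t permutes {1..n + k}" by (rule permutes_swap_id) (use i a in auto)
  have R: "?R lam (?t r) = ?R mu r" if r: "r \<in> {1..n + k}" for r
  proof -
    consider "r = i" | "r = n + a" | "r \<noteq> i" "r \<noteq> n + a" "r \<le> n" | "r \<noteq> n + a" "\<not> r \<le> n" by blast
    then show ?thesis
    proof cases
      case 1
      then show ?thesis using i a co by auto
    next
      case 2
      then show ?thesis using i a co by auto
    next
      case 3
      then show ?thesis using er[of r] r by simp
    next
      case 4
      then have "r - n \<in> {1..k}" "r - n \<noteq> a" using r by auto
      then have "coexpo n k mu (r - n) = coexpo n k lam (r - n)"
        by (simp add: coexpo_def cj)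
      then show ?thesis using 4 i by simp
    qed
  qed
  have "det1 (n + k) (\<lambda>r. confluent_row n y (?R mu r)) = det1 (n + k) (\<lambda>r. confluent_row n y (?R lam (?t r)))"
    by (rule det1_cong) (simp only: R)
  also have "\<dots> = of_int (sign ?t) * det1 (n + k) (\<lambda>r. confluent_row n y (?R lam r))"
    by (rule det1_permute_rows[OF t])
  also have "sign ?t = -1" using i a by (simp add: sign_swap_id)
  finally have "det1 (n + k) (\<lambda>r. confluent_row n y (?R lam r)) = - det1 (n + k) (\<lambda>r. confluent_row n y (?R mu r))"
    by simp
  also have "\<dots> = (-1) ^ Suc s * vandermonde n y"
    using Suc.hyps(1)[OF s mu] s by simp
  finally show ?case using Suc.hyps(2) by simp
qed

text \<open>Consider the matrix \<open>X\<close> of the polynomials \<open>z\<^sup>c\<close>, for the exponents \<open>c\<close> of \<open>\<lambda>\<close>, and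
  \<open>u\<^sub>i = z\<^bsup>i-1\<^esup> \<Prod>\<^sub>a (z - y\<^sub>a)\<close> for \<open>1 \<le> i \<le> k\<close>, in the sense of \<^const>\<open>confluent_row\<close>.  The \<open>u\<^sub>i\<close> vanish at the points
  \<open>y\<close> and are monic, so \<open>X\<close> is block triangular and its determinant is the alternant of \<open>\<lambda>\<close>.
  On the other hand the \<open>u\<^sub>i\<close> are combinations of monomials whose coefficients are elementary symmetric
  polynomials; modulo the rows already present only the exponents of the holes count, and this gives the determinant
  of elementary symmetric polynomials times the Vandermonde determinant.  The signs of the
  coefficients cancel the sign of \<open>det1_shuffled_rows\<close>.\<close>

lemma dual_jacobi_trudi:
  fixes y :: "nat \<Rightarrow> 'a::idom"
  assumes lam: "lam \<in> box n k"
  shows "det1 k (\<lambda>i j. elem_sym (int (part (conj_part k lam) i) - int i + int j) n y) * vandermonde n y =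
    alternant n (\<lambda>_. 0) lam y"
proof -
  let ?N = "n + k" and ?U = "\<lambda>i c. elem_sym (int n + int i - 1 - int c) n (\<lambda>a. - y a)"
  let ?c = "part (conj_part k lam)"
  let ?R = "\<lambda>r. if r \<le> n then expo n lam r else coexpo n k lam (r - n)"
  let ?v = "confluent_row n y"
  let ?u = "\<lambda>i j. \<Sum>c<?N. ?U i c * ?v c j"
  let ?X = "\<lambda>r j. if r \<le> n then ?v (expo n lam r) j else ?u (r - n) j"
  let ?M = "\<lambda>r s. if r \<le> n then (if r = s then 1 else 0) else ?U (r - n) (?R s)"
  \<comment> \<open>particles followed by holes exhaust all exponents\<close>
  have bij: "bij_betw ?R {1..?N} {..<?N}"
  proof -
    have 1: "{1..?N} = {1..n} \<union> {n + 1..?N}" by auto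
    have 2: "?R ` {1..n} = expo n lam ` {1..n}" by (rule image_cong) auto
    have "{n + 1..?N} = (\<lambda>j. n + j) ` {1..k}" by (simp add: image_add_atLeastAtMost)
    then have "?R ` {n + 1..?N} = (\<lambda>j. ?R (n + j)) ` {1..k}" by (simp only: image_image)
    also have "\<dots> = coexpo n k lam ` {1..k}" by (rule image_cong) auto
    finally have 3: "?R ` {n + 1..?N} = coexpo n k lam ` {1..k}" .
    have "expo n lam ` {1..n} \<subseteq> {..<?N}" using expo_less[OF lam] by blast
    then have im: "?R ` {1..?N} = {..<?N}"
      by (simp only: 1 image_Un 2 3 coexpo_image[OF lam] atLeast0LessThan) blast
    have "inj_on ?R {1..?N}"
      by (rule eq_card_imp_inj_on) (simp_all only: im, simp_all)
    then show ?thesis using im by (simp add: bij_betw_def)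
  qed
  have X_eq: "?X r j = (\<Sum>s\<in>{1..?N}. ?M r s * ?v (?R s) j)" if r: "r \<in> {1..?N}" for r j
  proof (cases "r \<le> n")
    case True
    then have "(\<Sum>s\<in>{1..?N}. ?M r s * ?v (?R s) j) = (\<Sum>s\<in>{1..?N}. if r = s then ?v (?R s) j else 0)"
      by (intro sum.cong) auto
    also have "\<dots> = ?v (?R r) j" using r by (simp only: sum.delta' finite_atLeastAtMost if_True)
    finally show ?thesis using True by simp
  next
    case False
    then have "(\<Sum>s\<in>{1..?N}. ?M r s * ?v (?R s) j) = (\<Sum>s\<in>{1..?N}. ?U (r - n) (?R s) * ?v (?R s) j)"
      by (intro sum.cong) simp_all
    also have "\<dots> = ?u (r - n) j" by (rule sum.reindex_bij_betw[OF bij])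
    finally show ?thesis using False by simp
  qed
  have u_low: "?u i j = 0" if i: "i \<in> {1..k}" and j: "j \<in> {1..n}" for i j
  proof -
    have "?u i j = (\<Sum>c<?N. ?U i c * y j ^ c)" using j by (simp add: confluent_row_def)
    also have "\<dots> = (\<Sum>c\<in>{i - 1..<i - 1 + (n + 1)}. ?U i c * y j ^ c)"
      by (rule sum.mono_neutral_right) (use i in \<open>auto intro!: elem_sym_eq_0\<close>)
    also have "\<dots> = (\<Sum>c<n + 1. ?U i (i - 1 + c) * y j ^ (i - 1 + c))"
      by (rule sum.reindex_bij_witness[where i = "\<lambda>c. i - 1 + c" and j = "\<lambda>c. c - (i - 1)"]) auto
    also have "\<dots> = (\<Sum>c<n + 1. y j ^ (i - 1) * (elem_sym (int n - int c) n (\<lambda>a. - y a) * y j ^ c))"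
    proof (rule sum.cong[OF refl])
      fix c
      have "int n + int i - 1 - int (i - 1 + c) = int n - int c" using i by auto
      then show "?U i (i - 1 + c) * y j ^ (i - 1 + c) =
          y j ^ (i - 1) * (elem_sym (int n - int c) n (\<lambda>a. - y a) * y j ^ c)"
        by (simp only: power_add mult_ac)
    qed
    also have "\<dots> = y j ^ (i - 1) * (\<Prod>a\<in>{1..n}. y j + - y a)"
      by (subst prod_add_elem_sym[of n "n + 1"]) (simp, simp only: sum_distrib_left)
    also have "(\<Prod>a\<in>{1..n}. y j + - y a) = 0"
      by (rule prod_zero) (use j in auto)
    finally show ?thesis by simp
  qed
  have u_high: "?u i (n + j) = elem_sym (int i - int j) n (\<lambda>a. - y a)" if "j \<in> {1..k}" for i j
  proof -
    have "?u i (n + j) = (\<Sum>c<?N. if c = n + j - 1 then ?U i c else 0)"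
      by (rule sum.cong) (use that in \<open>auto simp: confluent_row_def\<close>)
    also have "\<dots> = ?U i (n + j - 1)" using that by (subst sum.delta) auto
    finally show ?thesis using that by (simp add: of_nat_diff algebra_simps)
  qed
  have e0: "elem_sym 0 m z = 1" for m and z :: "nat \<Rightarrow> 'a"
    by (induction m) (simp_all add: elem_sym_0 elem_sym_Suc elem_sym_eq_0)
  have "det1 ?N ?X = det1 n ?X * det1 k (\<lambda>i j. ?X (n + i) (n + j))"
    by (rule det1_lower_left_zero) (use u_low in auto)
  also have "det1 n ?X = alternant n (\<lambda>_. 0) lam y"
    unfolding alternant_def by (rule det1_cong) (simp add: confluent_row_def fact_power_zero)
  also have "det1 k (\<lambda>i j. ?X (n + i) (n + j)) = 1"
  proof -
    have "det1 k (\<lambda>i j. ?X (n + i) (n + j)) = det1 k (\<lambda>i j. elem_sym (int i - int j) n (\<lambda>a. - y a))"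
      by (rule det1_cong) (use u_high in auto)
    also have "\<dots> = det1 k (\<lambda>i j. elem_sym (int j - int i) n (\<lambda>a. - y a))"
      by (rule det1_transpose[symmetric])
    also have "\<dots> = (\<Prod>i\<in>{1..k}. elem_sym (int i - int i) n (\<lambda>a. - y a))"
      by (rule det1_triangular) (simp add: elem_sym_eq_0)
    finally show ?thesis by (simp add: e0)
  qed
  finally have 1: "det1 ?N ?X = alternant n (\<lambda>_. 0) lam y" by simp
  have "det1 ?N ?X = det1 ?N (\<lambda>r j. \<Sum>s\<in>{1..?N}. ?M r s * ?v (?R s) j)"
    by (rule det1_cong) (rule X_eq)
  also have "\<dots> = det1 ?N ?M * det1 ?N (\<lambda>s j. ?v (?R s) j)" by (rule det1_mult)
  also have "det1 ?N (\<lambda>s j. ?v (?R s) j) = (-1) ^ (\<Sum>j\<in>{1..k}. ?c j) * vandermonde n y"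
    by (rule det1_shuffled_rows[OF lam])
  also have "det1 ?N ?M = det1 n ?M * det1 k (\<lambda>i j. ?M (n + i) (n + j))"
    by (rule det1_upper_right_zero) auto
  also have "det1 n ?M = 1"
    by (subst det1_triangular) auto
  also have "det1 k (\<lambda>i j. ?M (n + i) (n + j)) =
      det1 k (\<lambda>i j. (-1) ^ i * ((-1) ^ (?c j + j) * elem_sym (int (?c j) - int j + int i) n y))"
  proof (rule det1_cong)
    fix i j assume i: "i \<in> {1..k}" and j: "j \<in> {1..k}"
    have e: "int n + int i - 1 - int (coexpo n k lam j) = int (?c j + i) - int j"
      using coexpo_eq(3)[OF lam j] by linarith
    have "?M (n + i) (n + j) = elem_sym (int n + int i - 1 - int (coexpo n k lam j)) n (\<lambda>a. - y a)"
      using i j by simp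
    also have "\<dots> = (-1) ^ (?c j + i) * ((-1) ^ j * elem_sym (int (?c j + i) - int j) n y)"
      unfolding e by (rule elem_sym_uminus)
    also have "int (?c j + i) - int j = int (?c j) - int j + int i" by simp
    finally show "?M (n + i) (n + j) = (-1) ^ i * ((-1) ^ (?c j + j) * elem_sym (int (?c j) - int j + int i) n y)"
      by (simp add: power_add mult_ac)
  qed
  also have "\<dots> = (\<Prod>i\<in>{1..k}. (-1) ^ i) * ((\<Prod>j\<in>{1..k}. (-1) ^ (?c j + j)) *
      det1 k (\<lambda>i j. elem_sym (int (?c j) - int j + int i) n y))"
    unfolding det1_scale_rows det1_scale_cols ..
  also have "det1 k (\<lambda>i j. elem_sym (int (?c j) - int j + int i) n y) =
      det1 k (\<lambda>i j. elem_sym (int (?c i) - int i + int j) n y)"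
    by (rule det1_transpose)
  finally have 2: "alternant n (\<lambda>_. 0) lam y = ((\<Prod>i\<in>{1..k}. (-1) ^ i) * (\<Prod>j\<in>{1..k}. (-1) ^ (?c j + j)) *
      (-1) ^ (\<Sum>j\<in>{1..k}. ?c j)) * (det1 k (\<lambda>i j. elem_sym (int (?c i) - int i + int j) n y) * vandermonde n y)"
    unfolding 1 by (simp only: mult_ac mult_1)
  have "even (\<Sum>{1..k} + (\<Sum>j\<in>{1..k}. ?c j + j) + (\<Sum>j\<in>{1..k}. ?c j))"
    unfolding sum.distrib even_add by blast
  then have "(\<Prod>i\<in>{1..k}. (-1 :: 'a) ^ i) * (\<Prod>j\<in>{1..k}. (-1) ^ (?c j + j)) * (-1) ^ (\<Sum>j\<in>{1..k}. ?c j) = 1"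
    unfolding power_sum[symmetric] power_add[symmetric] by (rule neg_one_even_power)
  with 2 show ?thesis by simp
qed

section \<open>Alternants separate tensors\<close>

text \<open>The sums are the contractions of an antisymmetric tensor with \<open>n\<close> columns of the square matrix of factorial powers at
  the points \<open>b\<close>.  Its determinant is a nonzero Vandermonde determinant \<open>d\<close>, so the contraction can be undone, up to
  the factor \<open>d\<^sup>n\<close>, by contracting each index with the adjugate matrix.\<close>

lemma alternants_separate:
  fixes b :: "nat \<Rightarrow> 'a::idom"
  assumes inj: "inj_on b {1..n + k}"
    and zero: "\<And>g. g \<in> {1..n} \<rightarrow> {1..n + k} \<Longrightarrow> (\<Sum>nu\<in>box n k. f nu * alternant n t nu (\<lambda>j. b (g j))) = 0"
    and lam: "lam \<in> box n k"
  shows "f lam = 0"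
proof -
  let ?N = "n + k"
  let ?A = "mat ?N ?N (\<lambda>(i, j). fact_power t (b (j + 1)) (?N - (i + 1)))"
  define d where "d = det ?A"
  define B where "B j s = adj_mat ?A $$ (j - 1, s)" for j s
  have "d = alternant ?N t (replicate ?N 0) b"
    unfolding d_def alternant_def det1_def
    by (intro arg_cong[of _ _ det] eq_matI) (simp_all add: expo_def part_def)
  then have d: "d \<noteq> 0" using vandermonde_nonzero[OF inj] by (simp only: alternant_empty) simp
  have adj: "(\<Sum>m\<in>{1..?N}. B m (?N - 1 - s) * fact_power t (b m) r) = (if r = s then d else 0)"
    if r: "r < ?N" and s: "s < ?N" for r s
  proof -
    have dim: "adj_mat ?A \<in> carrier_mat ?N ?N" by (rule adj_mat(1)) simp
    have "(?A * adj_mat ?A) $$ (?N - 1 - r, ?N - 1 - s) = (d \<cdot>\<^sub>m 1\<^sub>m ?N) $$ (?N - 1 - r, ?N - 1 - s)"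
      unfolding d_def by (subst adj_mat(2)[of _ ?N]) simp_all
    also have "\<dots> = (if r = s then d else 0)" using r s by auto
    also have "(?A * adj_mat ?A) $$ (?N - 1 - r, ?N - 1 - s) =
        (\<Sum>m\<in>{0..<?N}. fact_power t (b (m + 1)) r * adj_mat ?A $$ (m, ?N - 1 - s))"
      using r s dim by (auto simp: scalar_prod_def intro!: sum.cong)
    also have "\<dots> = (\<Sum>m\<in>{1..?N}. B m (?N - 1 - s) * fact_power t (b m) r)"
      by (simp add: B_def sum.atLeast1_atMost_eq atLeast0LessThan mult.commute)
    finally show ?thesis .
  qed
  let ?G = "{1..n} \<rightarrow>\<^sub>E {1..?N}"
  \<comment> \<open>orthogonality: contracting with the adjugate isolates the coefficient of \<open>lam\<close>\<close>
  have key: "(\<Sum>g\<in>?G. (\<Prod>i\<in>{1..n}. B (g i) (?N - 1 - expo n lam i)) * alternant n t nu (\<lambda>j. b (g j))) =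
      (if nu = lam then d ^ n else 0)" if nu: "nu \<in> box n k" for nu
  proof -
    have "(\<Sum>g\<in>?G. (\<Prod>i\<in>{1..n}. B (g i) (?N - 1 - expo n lam i)) * alternant n t nu (\<lambda>j. b (g j))) =
      (\<Sum>g\<in>?G. (\<Prod>i\<in>{1..n}. B (g i) (?N - 1 - expo n lam i)) *
         det1 n (\<lambda>i j. fact_power t (b (g i)) (expo n nu j)))"
      unfolding alternant_def by (intro sum.cong refl arg_cong2[of _ _ _ _ "(*)"] det1_transpose[symmetric])
    also have "\<dots> = det1 n (\<lambda>i j. \<Sum>m\<in>{1..?N}. B m (?N - 1 - expo n lam i) * fact_power t (b m) (expo n nu j))"
      by (rule det1_expand_rows[symmetric]) simp
    also have "\<dots> = det1 n (\<lambda>i j. if expo n nu j = expo n lam i then d else 0)"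
      by (rule det1_cong) (intro adj expo_less[OF nu] expo_less[OF lam])
    also have "\<dots> = (if nu = lam then d ^ n else 0)"
    proof (cases "nu = lam")
      case True
      have "det1 n (\<lambda>i j. if expo n nu j = expo n lam i then d else 0) = (\<Prod>i\<in>{1..n}. d)"
      proof (subst det1_triangular)
        fix i j assume "i \<in> {1..n}" "j \<in> {1..n}" "j < i"
        then have "expo n nu j \<noteq> expo n lam i" using expo_strict[OF lam, of j i] True by simp
        then show "(if expo n nu j = expo n lam i then d else 0) = 0" by simp
      qed (simp add: True)
      then show ?thesis using True by simp
    next
      case False
      have "expo n nu ` {1..n} \<noteq> expo n lam ` {1..n}"
        using inj_onD[OF bij_betw_imp_inj_on[OF bij_betw_box_subsets] _ nu lam] False by auto
      moreover have "card (expo n nu ` {1..n}) = card (expo n lam ` {1..n})"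
        by (simp only: card_image[OF inj_on_expo[OF nu]] card_image[OF inj_on_expo[OF lam]])
      ultimately have "\<not> expo n lam ` {1..n} \<subseteq> expo n nu ` {1..n}"
        using card_subset_eq[of "expo n nu ` {1..n}" "expo n lam ` {1..n}"] by auto
      then obtain i where i: "i \<in> {1..n}" "expo n lam i \<notin> expo n nu ` {1..n}" by blast
      have "expo n nu m \<noteq> expo n lam i" if "m \<in> {1..n}" for m
        using i(2) imageI[OF that, of "expo n nu"] by metis
      then have "det1 n (\<lambda>i j. if expo n nu j = expo n lam i then d else 0) = 0"
        by (intro det1_row_zero[OF i(1)]) simp
      then show ?thesis using False by simp
    qed
    finally show ?thesis .
  qed
  have "0 = (\<Sum>g\<in>?G. (\<Prod>i\<in>{1..n}. B (g i) (?N - 1 - expo n lam i)) *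
      (\<Sum>nu\<in>box n k. f nu * alternant n t nu (\<lambda>j. b (g j))))"
    by (rule sum.neutral[symmetric]) (simp add: zero PiE_iff Pi_iff)
  also have "\<dots> = (\<Sum>nu\<in>box n k. f nu * (\<Sum>g\<in>?G. (\<Prod>i\<in>{1..n}. B (g i) (?N - 1 - expo n lam i)) *
       alternant n t nu (\<lambda>j. b (g j))))"
    by (simp only: sum_distrib_left mult.left_commute) (rule sum.swap)
  also have "\<dots> = (\<Sum>nu\<in>box n k. if nu = lam then f nu * d ^ n else 0)"
    by (rule sum.cong[OF refl]) (simp only: key, simp)
  also have "\<dots> = f lam * d ^ n" using lam by (simp add: finite_box)
  finally show ?thesis using d by simp
qed

section \<open>Rows of the lattice as exterior powers\<close>

text \<open>The matrix element \<open>\<langle>I|M\<^sub>a\<^sub>b|K\<rangle>\<close> of the monodromy matrix \<open>M = L\<^sub>j \<cdots> L\<^sub>1\<close> of the first \<open>j\<close> columns.\<close>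

definition open_weight :: "(nat \<Rightarrow> 'a::comm_ring_1 oper2) \<Rightarrow> nat \<Rightarrow> bool \<Rightarrow> bool \<Rightarrow> nat set \<Rightarrow> nat set \<Rightarrow> 'a" where
  "open_weight L j a b K I = (\<Sum>h\<in>open_rows j a b.
     \<Prod>i\<in>{1..j}. vertex_weight L i (i \<in> h) (i - 1 \<in> h) (i \<in> I) (i \<in> K))"

text \<open>The value of a functional \<open>D\<close> at the vector \<open>M\<^sub>a\<^sub>b|K\<rangle>\<close>.  Functionals behave better than vectors under
  induction on the columns: the new column only changes \<open>D\<close>.\<close>

definition open_sum :: "(nat \<Rightarrow> 'a::comm_ring_1 oper2) \<Rightarrow> nat \<Rightarrow> bool \<Rightarrow> bool \<Rightarrow> nat set \<Rightarrow> (nat set \<Rightarrow> 'a) \<Rightarrow> 'a" where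
  "open_sum L j a b K D = (\<Sum>I\<in>Pow {1..j}. open_weight L j a b K I * D I)"

lemma open_sum_cong:
  "(\<And>I. I \<subseteq> {1..j} \<Longrightarrow> D I = D' I) \<Longrightarrow> open_sum L j a b K D = open_sum L j a b K D'"
  unfolding open_sum_def by (rule sum.cong) auto

lemma open_sum_linear:
  "open_sum L j a b K (\<lambda>I. u * D I + v * D' I) = u * open_sum L j a b K D + v * open_sum L j a b K D'"
  by (simp add: open_sum_def sum_distrib_left sum.distrib algebra_simps)

lemma open_sum_0: "open_sum L 0 a b K D = (if a = b then D {} else 0)"
proof -
  have "open_rows 0 a b = (if a = b then {if a then {0} else {}} else {})"
    by (auto simp: open_rows_def)
  then show ?thesis by (simp add: open_sum_def open_weight_def)
qed

lemma open_weight_cong: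
  assumes "\<And>i. i \<in> {1..j} \<Longrightarrow> i \<in> I \<longleftrightarrow> i \<in> I'"
  shows "open_weight L j a b K I = open_weight L j a b K I'"
  unfolding open_weight_def by (intro sum.cong prod.cong refl) (simp only: assms)

lemma open_weight_Suc:
  "open_weight L (Suc j) a b K I =
    (\<Sum>c\<in>UNIV. vertex_weight L (Suc j) a c (Suc j \<in> I) (Suc j \<in> K) * open_weight L j c b K I)"
  unfolding open_weight_def sum_open_rows_Suc sum_distrib_left
proof (intro sum.cong refl)
  fix c h assume "h \<in> open_rows j c b"
  then have h: "Suc j \<notin> h" "j \<in> h \<longleftrightarrow> c" by (auto simp: open_rows_def)
  let ?h = "if a then insert (Suc j) h else h"
  have "(\<Prod>i\<in>{1..j}. vertex_weight L i (i \<in> ?h) (i - 1 \<in> ?h) (i \<in> I) (i \<in> K)) =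
      (\<Prod>i\<in>{1..j}. vertex_weight L i (i \<in> h) (i - 1 \<in> h) (i \<in> I) (i \<in> K))"
  proof (rule prod.cong[OF refl])
    fix i assume "i \<in> {1..j}"
    then have "i \<noteq> Suc j" "i - 1 \<noteq> Suc j" by auto
    then show "vertex_weight L i (i \<in> ?h) (i - 1 \<in> ?h) (i \<in> I) (i \<in> K) =
        vertex_weight L i (i \<in> h) (i - 1 \<in> h) (i \<in> I) (i \<in> K)" by simp
  qed
  moreover have "(Suc j \<in> ?h) = a" "(j \<in> ?h) = c" using h by auto
  ultimately show "(\<Prod>i\<in>{1..Suc j}. vertex_weight L i (i \<in> ?h) (i - 1 \<in> ?h) (i \<in> I) (i \<in> K)) =
      vertex_weight L (Suc j) a c (Suc j \<in> I) (Suc j \<in> K) *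
      (\<Prod>i\<in>{1..j}. vertex_weight L i (i \<in> h) (i - 1 \<in> h) (i \<in> I) (i \<in> K))"
    by (simp add: mult.commute del: One_nat_def)
qed

lemma open_sum_Suc:
  "open_sum L (Suc j) a b K D = (\<Sum>e\<in>UNIV. \<Sum>c\<in>UNIV. vertex_weight L (Suc j) a c e (Suc j \<in> K) *
     open_sum L j c b K (\<lambda>I. D (if e then insert (Suc j) I else I)))"
proof -
  have w: "open_weight L (Suc j) a b K (if e then insert (Suc j) I else I) =
      (\<Sum>c\<in>UNIV. vertex_weight L (Suc j) a c e (Suc j \<in> K) * open_weight L j c b K I)"
    if I: "I \<in> Pow {1..j}" for e I
  proof -
    have "open_weight L j c b K (if e then insert (Suc j) I else I) = open_weight L j c b K I" for c
      by (rule open_weight_cong) auto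
    moreover have "(Suc j \<in> (if e then insert (Suc j) I else I)) = e" using I by auto
    ultimately show ?thesis by (simp only: open_weight_Suc)
  qed
  have "open_sum L (Suc j) a b K D = (\<Sum>e\<in>UNIV. \<Sum>I\<in>Pow {1..j}. \<Sum>c\<in>UNIV.
      vertex_weight L (Suc j) a c e (Suc j \<in> K) * (open_weight L j c b K I * D (if e then insert (Suc j) I else I)))"
    unfolding open_sum_def sum_Pow_Suc
    by (intro sum.cong refl) (simp only: w sum_distrib_right mult.assoc)
  also have "\<dots> = (\<Sum>e\<in>UNIV. \<Sum>c\<in>UNIV. \<Sum>I\<in>Pow {1..j}.
      vertex_weight L (Suc j) a c e (Suc j \<in> K) * (open_weight L j c b K I * D (if e then insert (Suc j) I else I)))"
    by (rule sum.cong[OF refl], rule sum.swap)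
  finally show ?thesis by (simp only: open_sum_def sum_distrib_left)
qed

lemma twisted_trace_pairing:
  assumes L: "site_local L"
  shows "(\<Sum>I\<in>Pow {1..N}. twisted_trace q (monodromy L N) f I * D I) =
    (\<Sum>K\<in>Pow {1..N}. f K * (open_sum L N False False K D + q * open_sum L N True True K D))"
proof -
  have "twisted_trace q (monodromy L N) f I =
      (\<Sum>K\<in>Pow {1..N}. (open_weight L N False False K I + q * open_weight L N True True K I) * f K)"
    if "I \<in> Pow {1..N}" for I
  proof -
    have "I - {1..N} \<union> K = K" for K using that by auto
    then show ?thesis
      by (simp only: twisted_trace_def monodromy_expand[OF L] open_weight_def[symmetric]
          distrib_right sum.distrib sum_distrib_left mult.assoc)
  qed
  then have "(\<Sum>I\<in>Pow {1..N}. twisted_trace q (monodromy L N) f I * D I) =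
      (\<Sum>I\<in>Pow {1..N}. \<Sum>K\<in>Pow {1..N}. (open_weight L N False False K I + q * open_weight L N True True K I) * f K * D I)"
    by (intro sum.cong refl) (simp only: sum_distrib_right)
  also have "\<dots> = (\<Sum>K\<in>Pow {1..N}. \<Sum>I\<in>Pow {1..N}. (open_weight L N False False K I + q * open_weight L N True True K I) * f K * D I)"
    by (rule sum.swap)
  also have "\<dots> = (\<Sum>K\<in>Pow {1..N}. f K * (open_sum L N False False K D + q * open_sum L N True True K D))"
    by (intro sum.cong refl)
      (simp add: open_sum_def sum_distrib_left sum.distrib[symmetric] algebra_simps)
  finally show ?thesis .
qed

lemma open_sum_osc:
  "Suc j \<notin> K \<Longrightarrow> open_sum (L_osc t x) (Suc j) False b K D =
     open_sum (L_osc t x) j False b K D + x * open_sum (L_osc t x) j True b K (\<lambda>I. D (insert (Suc j) I))"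
  "Suc j \<notin> K \<Longrightarrow> open_sum (L_osc t x) (Suc j) True b K D = 0"
  "Suc j \<in> K \<Longrightarrow> open_sum (L_osc t x) (Suc j) False b K D =
     (1 + x * t (Suc j)) * open_sum (L_osc t x) j False b K (\<lambda>I. D (insert (Suc j) I))"
  "Suc j \<in> K \<Longrightarrow> open_sum (L_osc t x) (Suc j) True b K D =
     open_sum (L_osc t x) j False b K D + x * open_sum (L_osc t x) j True b K (\<lambda>I. D (insert (Suc j) I))"
  by (simp_all add: open_sum_Suc UNIV_bool vertex_weight_def basis_vec_def sigma_plus_def sigma_minus_def)

lemma open_sum_vic:
  "Suc j \<notin> K \<Longrightarrow> open_sum (L_vic t x) (Suc j) False b K D =
     (1 - x * t (Suc j)) * open_sum (L_vic t x) j False b K D +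
     x * open_sum (L_vic t x) j True b K (\<lambda>I. D (insert (Suc j) I))"
  "Suc j \<notin> K \<Longrightarrow> open_sum (L_vic t x) (Suc j) True b K D = x * open_sum (L_vic t x) j True b K D"
  "Suc j \<in> K \<Longrightarrow> open_sum (L_vic t x) (Suc j) False b K D =
     open_sum (L_vic t x) j False b K (\<lambda>I. D (insert (Suc j) I))"
  "Suc j \<in> K \<Longrightarrow> open_sum (L_vic t x) (Suc j) True b K D = open_sum (L_vic t x) j False b K D"
  by (simp_all add: open_sum_Suc UNIV_bool vertex_weight_def basis_vec_def sigma_plus_def sigma_minus_def)

text \<open>A multilinear alternating function of a list of \<open>n\<close> functions, here represented by their values at
  \<open>y\<^sub>1, \<dots>, y\<^sub>n\<close>.  The value \<open>0\<close> for lists of any other length makes the rules below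
  unconditional and encodes the conservation of the number of particles.\<close>

definition wedge :: "nat \<Rightarrow> (nat \<Rightarrow> 'a::comm_ring_1) \<Rightarrow> ('a \<Rightarrow> 'a) list \<Rightarrow> 'a" where
  "wedge n y us = (if length us = n then det1 n (\<lambda>i j. (us ! (i - 1)) (y j)) else 0)"

lemma wedge_linear:
  assumes "\<And>j. j \<in> {1..n} \<Longrightarrow> w (y j) = \<alpha> * u (y j) + \<beta> * v (y j)"
  shows "wedge n y (us @ w # vs) = \<alpha> * wedge n y (us @ u # vs) + \<beta> * wedge n y (us @ v # vs)"
proof (cases "length us + length vs + 1 = n")
  case True
  have other: "(us @ a # vs) ! (i - 1) = (us @ b # vs) ! (i - 1)"
    if "i \<in> {1..n}" "i \<noteq> length us + 1" for a b i
    using that by (auto simp: nth_append nth_Cons split: nat.splits)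
  have "det1 n (\<lambda>i j. ((us @ w # vs) ! (i - 1)) (y j)) =
      \<alpha> * det1 n (\<lambda>i j. ((us @ u # vs) ! (i - 1)) (y j)) +
      \<beta> * det1 n (\<lambda>i j. ((us @ v # vs) ! (i - 1)) (y j))"
  proof (rule det1_row_linear[of "length us + 1"])
    show "length us + 1 \<in> {1..n}" using True by simp
    show "((us @ u # vs) ! (i - 1)) (y j) = ((us @ w # vs) ! (i - 1)) (y j)"
      "((us @ v # vs) ! (i - 1)) (y j) = ((us @ w # vs) ! (i - 1)) (y j)"
      if "i \<in> {1..n}" "i \<noteq> length us + 1" for i j
      by (simp_all only: other[OF that, of u w] other[OF that, of v w])
  qed (simp add: assms)
  then show ?thesis using True by (simp add: wedge_def)
qed (simp add: wedge_def)

lemma wedge_adjacent: "wedge n y (us @ u # u # vs) = 0"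
proof (cases "length us + length vs + 2 = n")
  case True
  have "det1 n (\<lambda>i j. ((us @ u # u # vs) ! (i - 1)) (y j)) = 0"
    by (rule det1_identical_rows[of "length us + 1" n "length us + 2"]) (use True in \<open>auto simp: nth_append\<close>)
  then show ?thesis by (simp add: wedge_def)
qed (simp add: wedge_def)

text \<open>The usual polarisation of \<open>u + v\<close>.\<close>

lemma wedge_swap: "wedge n y (us @ u # v # vs) = - wedge n y (us @ v # u # vs)"
proof -
  let ?s = "\<lambda>z. u z + v z"
  have "0 = wedge n y (us @ ?s # ?s # vs)" by (simp add: wedge_adjacent)
  also have "\<dots> = wedge n y (us @ u # ?s # vs) + wedge n y (us @ v # ?s # vs)"
    using wedge_linear[of n ?s y 1 u 1 v us "?s # vs"] by simp
  also have "wedge n y (us @ u # ?s # vs) = wedge n y (us @ u # v # vs)"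
    using wedge_linear[of n ?s y 1 u 1 v "us @ [u]" vs] by (simp add: wedge_adjacent)
  also have "wedge n y (us @ v # ?s # vs) = wedge n y (us @ v # u # vs)"
    using wedge_linear[of n ?s y 1 u 1 v "us @ [v]" vs] by (simp add: wedge_adjacent)
  finally show ?thesis by (simp add: eq_neg_iff_add_eq_0)
qed

lemma wedge_rotate: "wedge n y (vs @ [u]) = (-1) ^ (n - 1) * wedge n y (u # vs)"
proof -
  have "wedge n y (us @ vs @ [u]) = (-1) ^ length vs * wedge n y (us @ u # vs)" for us
  proof (induction vs arbitrary: us)
    case (Cons v vs)
    have "wedge n y (us @ (v # vs) @ [u]) = (-1) ^ length vs * wedge n y (us @ v # u # vs)"
      using Cons.IH[of "us @ [v]"] by simp
    then show ?case using wedge_swap[of n y us v u vs] by simp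
  qed simp
  from this[of "[]"] show ?thesis
    by (cases "length vs = n - 1") (auto simp: wedge_def)
qed

lemma wedge_scale: "wedge n y (map (\<lambda>u z. c z * u z) us) = (\<Prod>j\<in>{1..n}. c (y j)) * wedge n y us"
proof (cases "length us = n")
  case True
  have "det1 n (\<lambda>i j. (map (\<lambda>u z. c z * u z) us ! (i - 1)) (y j)) =
      det1 n (\<lambda>i j. c (y j) * (us ! (i - 1)) (y j))"
    by (rule det1_cong) (use True in auto)
  also have "\<dots> = (\<Prod>j\<in>{1..n}. c (y j)) * det1 n (\<lambda>i j. (us ! (i - 1)) (y j))"
    by (rule det1_scale_cols)
  finally show ?thesis using True by (simp add: wedge_def)
qed (simp add: wedge_def)

definition desc :: "nat set \<Rightarrow> nat list" where
  "desc I = rev (sorted_list_of_set I)"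

lemma desc_empty [simp]: "desc {} = []"
  by (simp add: desc_def)

lemma desc_insert: "I \<subseteq> {1..j} \<Longrightarrow> desc (insert (Suc j) I) = Suc j # desc I"
proof -
  assume I: "I \<subseteq> {1..j}"
  then have "finite I" by (rule finite_subset) simp
  then have "sorted_list_of_set (insert (Suc j) I) = insort (Suc j) (sorted_list_of_set (I - {Suc j}))"
    by (rule sorted_list_of_set_insert_remove)
  also have "I - {Suc j} = I" using I by auto
  also have "insort (Suc j) (sorted_list_of_set I) = sorted_list_of_set I @ [Suc j]"
    by (rule sorted_insort_is_snoc) (use I \<open>finite I\<close> in auto)
  finally show ?thesis by (simp add: desc_def)
qed

lemma desc_Int_Suc:
  "Suc j \<in> K \<Longrightarrow> desc (K \<inter> {1..Suc j}) = Suc j # desc (K \<inter> {1..j})"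
  "Suc j \<notin> K \<Longrightarrow> desc (K \<inter> {1..Suc j}) = desc (K \<inter> {1..j})"
proof -
  assume "Suc j \<in> K"
  then have "K \<inter> {1..Suc j} = insert (Suc j) (K \<inter> {1..j})" by auto
  then show "desc (K \<inter> {1..Suc j}) = Suc j # desc (K \<inter> {1..j})" by (simp add: desc_insert)
next
  assume "Suc j \<notin> K"
  then have "K \<inter> {1..Suc j} = K \<inter> {1..j}" by (auto simp: le_Suc_eq)
  then show "desc (K \<inter> {1..Suc j}) = desc (K \<inter> {1..j})" by simp
qed

lemma card_Int_Suc:
  "Suc j \<in> K \<Longrightarrow> card (K \<inter> {1..Suc j}) = Suc (card (K \<inter> {1..j}))"
  "Suc j \<notin> K \<Longrightarrow> card (K \<inter> {1..Suc j}) = card (K \<inter> {1..j})"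
proof -
  have l: "length (desc (K \<inter> {1..j})) = card (K \<inter> {1..j})" for j by (simp add: desc_def)
  show "Suc j \<in> K \<Longrightarrow> card (K \<inter> {1..Suc j}) = Suc (card (K \<inter> {1..j}))"
    "Suc j \<notin> K \<Longrightarrow> card (K \<inter> {1..Suc j}) = card (K \<inter> {1..j})"
    unfolding l[symmetric] by (simp_all add: desc_Int_Suc del: One_nat_def)
qed

text \<open>The vector \<open>w\<^sub>m\<close> in the realisation of \<open>W\<close> by functions of \<open>y\<close>, on which \<open>Y\<close> is the
  multiplication by \<open>y\<close>.\<close>

definition site_fun :: "(nat \<Rightarrow> 'a::comm_ring_1) \<Rightarrow> nat \<Rightarrow> 'a \<Rightarrow> 'a" where
  "site_fun t m z = fact_power t z (m - 1)"

lemma site_fun_step: "z * site_fun t (Suc j) z = t (Suc j) * site_fun t (Suc j) z + site_fun t (Suc (Suc j)) z"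
  by (simp add: site_fun_def fact_power_def algebra_simps)

text \<open>The lists \<open>us\<close> and \<open>vs\<close> hold factors that have to be carried through the induction on the columns:
  a path leaving through the right edge of the row is recorded in \<open>us\<close>, a path entering from the left in \<open>vs\<close>.\<close>

definition wedge_set :: "nat \<Rightarrow> (nat \<Rightarrow> 'a) \<Rightarrow> (nat \<Rightarrow> 'a \<Rightarrow> 'a) \<Rightarrow> ('a \<Rightarrow> 'a) list \<Rightarrow>
    ('a \<Rightarrow> 'a) list \<Rightarrow> nat set \<Rightarrow> 'a::comm_ring_1" where
  "wedge_set n y w us vs I = wedge n y (us @ map w (desc I) @ vs)"

lemma open_sum_wedge_insert:
  "open_sum L j a b K (\<lambda>I. wedge_set n y w us vs (insert (Suc j) I)) =
   open_sum L j a b K (wedge_set n y w (us @ [w (Suc j)]) vs)"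
  by (rule open_sum_cong) (simp add: wedge_set_def desc_insert)

lemma wedge_set_Int_Suc:
  "Suc j \<in> K \<Longrightarrow> wedge_set n y w us vs (K \<inter> {1..Suc j}) = wedge_set n y w (us @ [w (Suc j)]) vs (K \<inter> {1..j})"
  "Suc j \<notin> K \<Longrightarrow> wedge_set n y w us vs (K \<inter> {1..Suc j}) = wedge_set n y w us vs (K \<inter> {1..j})"
  unfolding wedge_set_def by (simp_all add: desc_Int_Suc del: One_nat_def)

lemma wedge_set_linear:
  assumes "\<And>z. w z = \<alpha> * u z + \<beta> * v z"
  shows "wedge_set n y r (us @ [w]) vs I = \<alpha> * wedge_set n y r (us @ [u]) vs I + \<beta> * wedge_set n y r (us @ [v]) vs I"
  using wedge_linear[of n w y \<alpha> u \<beta> v us "map r (desc I) @ vs"] assms by (simp add: wedge_set_def)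

lemma wedge_set_adjacent: "wedge_set n y r ((us @ [u]) @ [u]) vs I = 0"
  using wedge_adjacent[of n y us u "map r (desc I) @ vs"] by (simp add: wedge_set_def)

lemma open_sum_wedge_linear:
  assumes "\<And>z. w z = \<alpha> * u z + \<beta> * v z"
  shows "open_sum L j a b K (wedge_set n y r (us @ [w]) vs) =
    \<alpha> * open_sum L j a b K (wedge_set n y r (us @ [u]) vs) + \<beta> * open_sum L j a b K (wedge_set n y r (us @ [v]) vs)"
  unfolding open_sum_linear[symmetric] by (rule open_sum_cong) (rule wedge_set_linear, rule assms)

lemma open_sum_wedge_adjacent: "open_sum L j a b K (wedge_set n y r ((us @ [u]) @ [u]) vs) = 0"
  unfolding open_sum_def wedge_set_adjacent by simp

text \<open>The exterior power of \<open>1 + x Y\<close>, computed column by column.  A particle at the site \<open>j + 1\<close> either stays, with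
  weight \<open>1 + x t\<^bsub>j+1\<^esub>\<close>, or becomes a path pending on the edge to the right, which contributes the factor
  \<open>x w\<^bsub>j+2\<^esub>\<close>.  Two paths meeting at a site cancel by antisymmetry, which accounts for the vertices that
  the osculating model forbids.\<close>

lemma osc_row_open:
  assumes w: "\<And>j z. w (Suc j) z = (1 + x * t (Suc j)) * th (Suc j) z + x * th (Suc (Suc j)) z"
  shows "open_sum (L_osc t x) j False False K (wedge_set n y th us []) +
   x * open_sum (L_osc t x) j True False K (wedge_set n y th (us @ [th (Suc j)]) []) =
   wedge_set n y w us [] (K \<inter> {1..j})"
proof (induction j arbitrary: us)
  case 0
  then show ?case by (simp add: open_sum_0 wedge_set_def)
next
  case (Suc j)
  show ?case
  proof (cases "Suc j \<in> K")
    case False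
    show ?thesis
      unfolding wedge_set_Int_Suc(2)[OF False] open_sum_osc(1,2)[OF False] open_sum_wedge_insert
        mult_zero_right add_0_right by (rule Suc.IH)
  next
    case True
    show ?thesis
      unfolding wedge_set_Int_Suc(1)[OF True] open_sum_osc(3,4)[OF True] open_sum_wedge_insert
        wedge_set_linear[OF w] Suc.IH[symmetric] open_sum_wedge_adjacent
      by (simp only: algebra_simps mult_zero_right mult_zero_left add_0_right add_0_left)
  qed
qed

text \<open>A path entering from the left ends up as an additional factor \<open>x w\<^sub>1\<close> at the right end of the product.  At
  least one column is needed, as the empty row merely transmits the path.\<close>

lemma osc_row_wrapped:
  "open_sum (L_osc t x) (Suc j) a True K (wedge_set n y th us []) =
   x * open_sum (L_osc t x) (Suc j) a False K (wedge_set n y th us [th 1])"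
proof (induction j arbitrary: a us)
  case 0
  have "desc {Suc 0} = [Suc 0]" using desc_insert[of "{}" 0] by simp
  then show ?case
    using wedge_adjacent[of n y us "th 1" "[]"]
    by (cases a; cases "Suc 0 \<in> K") (simp_all add: open_sum_osc open_sum_0 wedge_set_def)
next
  case (Suc j)
  show ?case
  proof (cases "Suc (Suc j) \<in> K")
    case True
    show ?thesis
      by (cases a) (simp_all only: open_sum_osc(3,4)[OF True] open_sum_wedge_insert Suc.IH, simp_all only: algebra_simps)
  next
    case False
    show ?thesis
      by (cases a) (simp_all only: open_sum_osc(1,2)[OF False] open_sum_wedge_insert Suc.IH mult_zero_right, simp_all only: algebra_simps)
  qed
qed

text \<open>The counterpart of \<open>osc_row_open\<close> for the inverse exterior power: the particles carry \<open>1 - x Y\<close> on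
  the side of the image, and the product telescopes to the eigenvalue \<open>\<Prod> (1 - x t\<^sub>i)\<close> of the open row.\<close>

lemma vic_row_open:
  assumes w: "\<And>j z. w (Suc j) z = (1 - x * t (Suc j)) * th (Suc j) z + (- x) * th (Suc (Suc j)) z"
  shows "open_sum (L_vic t x) j False False K (wedge_set n y w us []) +
   x * open_sum (L_vic t x) j True False K (wedge_set n y w (us @ [th (Suc j)]) []) =
   (\<Prod>i\<in>{1..j}. 1 - x * t i) * wedge_set n y th us [] (K \<inter> {1..j})"
proof (induction j arbitrary: us)
  case 0
  then show ?case by (simp add: open_sum_0 wedge_set_def)
next
  case (Suc j)
  let ?P = "\<Prod>i\<in>{1..j}. 1 - x * t i"
  have P: "(\<Prod>i\<in>{1..Suc j}. 1 - x * t i) = (1 - x * t (Suc j)) * ?P" by simp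
  show ?case
  proof (cases "Suc j \<in> K")
    case False
    show ?thesis
      unfolding wedge_set_Int_Suc(2)[OF False] open_sum_vic(1,2)[OF False] open_sum_wedge_insert
        open_sum_wedge_linear[OF w] P mult.assoc[of _ ?P] Suc.IH[symmetric]
      by (simp add: algebra_simps)
  next
    case True
    have *: "?P * wedge_set n y th (us @ [th (Suc j)]) [] (K \<inter> {1..j}) =
        open_sum (L_vic t x) j False False K (wedge_set n y w (us @ [th (Suc j)]) [])"
      using Suc.IH[of "us @ [th (Suc j)]"] by (simp only: open_sum_wedge_adjacent mult_zero_right add_0_right)
    show ?thesis
      unfolding wedge_set_Int_Suc(1)[OF True] open_sum_vic(3,4)[OF True] open_sum_wedge_insert
        open_sum_wedge_linear[OF w] P mult.assoc[of _ ?P] *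
      by (simp add: algebra_simps)
  qed
qed

text \<open>Rows with and without a path entering from the left are compared, where an additional factor \<open>w\<^sub>1\<close> replaces the
  path.  For the complete row and \<open>n\<close> particles the difference is \<open>(-1)\<^sup>n x\<^sup>N\<close> times the identity; this is the contribution of the
  corner entry of \<open>Y\<close> to \<open>det(1 - x Y)\<close>, up to the factor \<open>q\<close>.  The two statements feed each other in the induction step.\<close>

lemma vic_row_wrapped:
  assumes w: "\<And>j z. w (Suc j) z = (1 - x * t (Suc j)) * th (Suc j) z + (- x) * th (Suc (Suc j)) z"
  shows "(\<forall>us. open_sum (L_vic t x) j True True K (wedge_set n y w us []) =
      x * open_sum (L_vic t x) j True False K (wedge_set n y w us [th 1]) +
      (-1) ^ card (K \<inter> {1..j}) * x ^ j * wedge_set n y th us [] (K \<inter> {1..j})) \<and>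
    (\<forall>us. open_sum (L_vic t x) j False True K (wedge_set n y w us []) =
      x * open_sum (L_vic t x) j False False K (wedge_set n y w us [th 1]) -
      x * ((-1) ^ card (K \<inter> {1..j}) * x ^ j * wedge_set n y th (us @ [th (Suc j)]) [] (K \<inter> {1..j})))"
proof (induction j)
  case 0
  then show ?case by (simp add: open_sum_0 wedge_set_def)
next
  case (Suc j)
  note Y = Suc.IH[THEN conjunct1, rule_format] and X = Suc.IH[THEN conjunct2, rule_format]
  let ?s = "(-1) ^ card (K \<inter> {1..j}) * x ^ j"
  show ?case
  proof (cases "Suc j \<in> K")
    case False
    have s: "(-1) ^ card (K \<inter> {1..Suc j}) * x ^ Suc j = x * ?s"
      unfolding card_Int_Suc(2)[OF False] by (simp only: power_Suc mult_ac)
    show ?thesis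
      unfolding s wedge_set_Int_Suc(2)[OF False] open_sum_vic(1,2)[OF False] open_sum_wedge_insert
        X Y wedge_set_linear[OF w, where I = "K \<inter> {1..j}"]
      by (simp add: algebra_simps)
  next
    case True
    have s: "(-1) ^ card (K \<inter> {1..Suc j}) * x ^ Suc j = - x * ?s"
      unfolding card_Int_Suc(1)[OF True] by (simp add: mult.left_commute)
    have swap: "wedge_set n y th ((us @ [w (Suc j)]) @ [th (Suc j)]) [] I =
        - x * wedge_set n y th ((us @ [th (Suc (Suc j))]) @ [th (Suc j)]) [] I" for us I
      using wedge_linear[of n "w (Suc j)" y "1 - x * t (Suc j)" "th (Suc j)" "- x" "th (Suc (Suc j))" us
          "th (Suc j) # map th (desc I)"]
        wedge_adjacent[of n y us "th (Suc j)" "map th (desc I)"]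
      by (simp add: wedge_set_def w)
    show ?thesis
      unfolding s wedge_set_Int_Suc(1)[OF True] open_sum_vic(3,4)[OF True] open_sum_wedge_insert X swap
      by (simp add: algebra_simps)
  qed
qed

section \<open>Bethe functionals and eigenvalues\<close>

definition pairing :: "nat \<Rightarrow> nat \<Rightarrow> (nat \<Rightarrow> 'a::comm_ring_1) \<Rightarrow> (nat \<Rightarrow> 'a) \<Rightarrow> 'a tensor \<Rightarrow> 'a" where
  "pairing n k t y f = (\<Sum>nu\<in>box n k. f (positions n nu) * alternant n t nu y)"

lemma desc_positions:
  assumes "nu \<in> box n k"
  shows "desc (positions n nu) = map (\<lambda>i. Suc (expo n nu i)) [1..<n + 1]"
  unfolding desc_def positions_eq_expo image_image
  by (rule rev_sorted_list_of_image) (use expo_strict[OF assms] in auto)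

lemma wedge_positions:
  assumes "nu \<in> box n k"
  shows "wedge n y (map (site_fun t) (desc (positions n nu))) = alternant n t nu y"
proof -
  have "length (map (site_fun t) (desc (positions n nu))) = n"
    unfolding desc_positions[OF assms] by simp
  then have "wedge n y (map (site_fun t) (desc (positions n nu))) =
      det1 n (\<lambda>i j. (map (site_fun t) (desc (positions n nu)) ! (i - 1)) (y j))"
    by (simp add: wedge_def)
  also have "\<dots> = alternant n t nu y"
    unfolding alternant_def desc_positions[OF assms]
    by (rule det1_cong) (auto simp: site_fun_def simp del: upt_Suc)
  finally show ?thesis .
qed

lemma bij_betw_positions:
  "bij_betw (positions n) (box n k) {I. I \<subseteq> {1..n + k} \<and> card I = n}"
proof -
  have "bij_betw ((`) Suc) {M. M \<subseteq> {0..<n + k} \<and> card M = n} {I. I \<subseteq> {1..n + k} \<and> card I = n}"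
  proof (rule bij_betw_byWitness[where f' = "(`) (\<lambda>i. i - 1)"])
    show "(`) Suc ` {M. M \<subseteq> {0..<n + k} \<and> card M = n} \<subseteq> {I. I \<subseteq> {1..n + k} \<and> card I = n}"
      by (auto simp: card_image)
    show "\<forall>M\<in>{M. M \<subseteq> {0..<n + k} \<and> card M = n}. (\<lambda>i. i - 1) ` Suc ` M = M"
      by (simp add: image_image)
    show "\<forall>I\<in>{I. I \<subseteq> {1..n + k} \<and> card I = n}. Suc ` (\<lambda>i. i - 1) ` I = I"
    proof
      fix I assume I: "I \<in> {I. I \<subseteq> {1..n + k} \<and> card I = n}"
      have "Suc ` (\<lambda>i. i - 1) ` I = (\<lambda>i. i) ` I"
        unfolding image_image by (rule image_cong) (use I in auto)
      then show "Suc ` (\<lambda>i. i - 1) ` I = I" by simp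
    qed
    show "(`) (\<lambda>i. i - 1) ` {I. I \<subseteq> {1..n + k} \<and> card I = n} \<subseteq> {M. M \<subseteq> {0..<n + k} \<and> card M = n}"
    proof (rule image_subsetI)
      fix I assume I: "I \<in> {I. I \<subseteq> {1..n + k} \<and> card I = n}"
      have "inj_on (\<lambda>i::nat. i - 1) I"
      proof (rule inj_onI)
        fix a b assume "a \<in> I" "b \<in> I" "a - 1 = b - 1"
        moreover from this have "1 \<le> a" "1 \<le> b" using I by auto
        ultimately show "a = b" by simp
      qed
      then have "card ((\<lambda>i. i - 1) ` I) = n" using I by (simp add: card_image)
      then show "(\<lambda>i. i - 1) ` I \<in> {M. M \<subseteq> {0..<n + k} \<and> card M = n}"
        using I by force
    qed
  qed
  from bij_betw_trans[OF bij_betw_box_subsets this] show ?thesis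
    by (rule bij_betw_cong[THEN iffD1, rotated]) (simp add: positions_eq_expo)
qed

lemma pairing_eq_wedge:
  "(\<Sum>I\<in>Pow {1..n + k}. f I * wedge_set n y (site_fun t) [] [] I) = pairing n k t y f"
proof -
  have "wedge_set n y (site_fun t) [] [] I = 0" if "card I \<noteq> n" for I
    using that by (auto simp: wedge_set_def wedge_def desc_def)
  then have "(\<Sum>I\<in>Pow {1..n + k}. f I * wedge_set n y (site_fun t) [] [] I) =
      (\<Sum>I\<in>{I. I \<subseteq> {1..n + k} \<and> card I = n}. f I * wedge_set n y (site_fun t) [] [] I)"
    by (intro sum.mono_neutral_right) auto
  also have "\<dots> = (\<Sum>nu\<in>box n k. f (positions n nu) * wedge_set n y (site_fun t) [] [] (positions n nu))"
    by (rule sum.reindex_bij_betw[OF bij_betw_positions, symmetric])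
  also have "\<dots> = pairing n k t y f"
    unfolding pairing_def by (intro sum.cong refl) (simp add: wedge_set_def wedge_positions)
  finally show ?thesis .
qed

lemma pairing_sum:
  "pairing n k t y (\<lambda>I. \<Sum>a\<in>S. c a * f a I) = (\<Sum>a\<in>S. c a * pairing n k t y (f a))"
proof -
  have "pairing n k t y (\<lambda>I. \<Sum>a\<in>S. c a * f a I) =
      (\<Sum>nu\<in>box n k. \<Sum>a\<in>S. c a * (f a (positions n nu) * alternant n t nu y))"
    by (simp add: pairing_def sum_distrib_right mult.assoc)
  also have "\<dots> = (\<Sum>a\<in>S. \<Sum>nu\<in>box n k. c a * (f a (positions n nu) * alternant n t nu y))"
    by (rule sum.swap)
  finally show ?thesis by (simp add: pairing_def sum_distrib_left)
qed

lemma pairing_scale: "pairing n k t y (\<lambda>I. c * f I) = c * pairing n k t y f"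
  by (simp add: pairing_def sum_distrib_left mult.assoc)

lemma pairing_diff: "pairing n k t y (\<lambda>I. f I - g I) = pairing n k t y f - pairing n k t y g"
  by (simp add: pairing_def sum_subtractf algebra_simps)

lemma pairing_basis_vec:
  assumes "mu \<in> box n k"
  shows "pairing n k t y (basis_vec (positions n mu)) = alternant n t mu y"
proof -
  have "positions n nu = positions n mu \<longleftrightarrow> nu = mu" if "nu \<in> box n k" for nu
    using bij_betw_imp_inj_on[OF bij_betw_positions, of n k] that assms by (auto dest: inj_onD)
  then have "pairing n k t y (basis_vec (positions n mu)) =
      (\<Sum>nu\<in>box n k. if nu = mu then alternant n t nu y else 0)"
    unfolding pairing_def basis_vec_def by (intro sum.cong refl) simp
  then show ?thesis using assms by (simp add: finite_box)
qed

text \<open>The Bethe equation is the characteristic equation of \<open>Y\<close>.\<close>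

definition bethe_roots :: "nat \<Rightarrow> nat \<Rightarrow> (nat \<Rightarrow> 'a::comm_ring_1) \<Rightarrow> 'a \<Rightarrow> (nat \<Rightarrow> 'a) \<Rightarrow> bool" where
  "bethe_roots n k t q y \<longleftrightarrow> (\<forall>j\<in>{1..n}. fact_power t (y j) (n + k) = (-1) ^ (n - 1) * q)"

text \<open>The pending path at the right edge re-enters at the first site with weight \<open>q\<close>: the sign in the Bethe
  equation compensates the rotation of the wedge product.\<close>

lemma open_sum_wedge_wrap:
  assumes "bethe_roots n k t q y"
  shows "open_sum L j a b K (wedge_set n y w [site_fun t (Suc (n + k))] []) =
    q * open_sum L j a b K (wedge_set n y w [] [site_fun t 1])"
proof -
  have "wedge_set n y w [site_fun t (Suc (n + k))] [] I = q * wedge_set n y w [] [site_fun t 1] I" for I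
  proof -
    let ?R = "map w (desc I)"
    have "wedge n y ([] @ site_fun t (Suc (n + k)) # ?R) =
        ((-1) ^ (n - 1) * q) * wedge n y ([] @ site_fun t 1 # ?R) + 0 * wedge n y ([] @ site_fun t 1 # ?R)"
      by (rule wedge_linear) (use assms in \<open>simp add: bethe_roots_def site_fun_def fact_power_def\<close>)
    also have "\<dots> = q * wedge n y (?R @ [site_fun t 1])"
      unfolding wedge_rotate by (simp add: mult_ac)
    finally show ?thesis by (simp add: wedge_set_def)
  qed
  then have "open_sum L j a b K (wedge_set n y w [site_fun t (Suc (n + k))] []) =
      open_sum L j a b K (\<lambda>I. q * wedge_set n y w [] [site_fun t 1] I + 0 * 0)"
    by (intro open_sum_cong) simp
  also have "\<dots> = q * open_sum L j a b K (wedge_set n y w [] [site_fun t 1])"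
    unfolding open_sum_linear by simp
  finally show ?thesis .
qed

lemma wedge_set_scale:
  "wedge_set n y (\<lambda>m z. c z * site_fun t m z) [] [] I = (\<Prod>j\<in>{1..n}. c (y j)) * wedge_set n y (site_fun t) [] [] I"
  using wedge_scale[of n y c "map (site_fun t) (desc I)"] by (simp add: wedge_set_def o_def)

text \<open>Combines \<open>osc_row_open\<close> and \<open>osc_row_wrapped\<close>: the two ways of recording a path across
  the gluing line agree, so the twisted trace is the exterior power of \<open>1 + x Y\<close>.\<close>

lemma pairing_E_op:
  assumes "bethe_roots n k t q y" and "0 < n"
  shows "pairing n k t y (E_op (n + k) t q x f) = (\<Prod>j\<in>{1..n}. 1 + x * y j) * pairing n k t y f"
proof -
  let ?D = "wedge_set n y (site_fun t)" and ?w = "\<lambda>m z. (1 + x * z) * site_fun t m z"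
  obtain N where N: "n + k = Suc N" using assms(2) by (cases "n + k") auto
  have "pairing n k t y (E_op (n + k) t q x f) = (\<Sum>K\<in>Pow {1..n + k}. f K *
      (open_sum (L_osc t x) (n + k) False False K (?D [] []) +
       q * open_sum (L_osc t x) (n + k) True True K (?D [] [])))"
    unfolding pairing_eq_wedge[symmetric] E_op_def by (rule twisted_trace_pairing[OF site_local_L_osc])
  also have "\<dots> = (\<Sum>K\<in>Pow {1..n + k}. f K * ((\<Prod>j\<in>{1..n}. 1 + x * y j) * ?D [] [] K))"
  proof (intro sum.cong refl arg_cong2[of _ _ _ _ "(*)"])
    fix K assume K: "K \<in> Pow {1..n + k}"
    have "open_sum (L_osc t x) (n + k) False False K (?D [] []) +
       q * open_sum (L_osc t x) (n + k) True True K (?D [] []) =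
       open_sum (L_osc t x) (n + k) False False K (?D [] []) +
       x * (q * open_sum (L_osc t x) (n + k) True False K (?D [] [site_fun t 1]))"
      unfolding N osc_row_wrapped by (simp only: mult_ac)
    also have "\<dots> = open_sum (L_osc t x) (n + k) False False K (?D [] []) +
       x * open_sum (L_osc t x) (n + k) True False K (?D ([] @ [site_fun t (Suc (n + k))]) [])"
      by (simp add: open_sum_wedge_wrap[OF assms(1)])
    also have "\<dots> = wedge_set n y ?w [] [] (K \<inter> {1..n + k})"
    proof (rule osc_row_open)
      fix j z
      have "?w (Suc j) z = site_fun t (Suc j) z + x * (z * site_fun t (Suc j) z)"
        by (simp only: algebra_simps mult_1)
      then show "?w (Suc j) z = (1 + x * t (Suc j)) * site_fun t (Suc j) z + x * site_fun t (Suc (Suc j)) z"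
        unfolding site_fun_step by (simp add: algebra_simps)
    qed
    also have "K \<inter> {1..n + k} = K" using K by auto
    finally show "open_sum (L_osc t x) (n + k) False False K (?D [] []) +
       q * open_sum (L_osc t x) (n + k) True True K (?D [] []) = (\<Prod>j\<in>{1..n}. 1 + x * y j) * ?D [] [] K"
      by (simp only: wedge_set_scale)
  qed
  also have "\<dots> = (\<Prod>j\<in>{1..n}. 1 + x * y j) * pairing n k t y f"
    unfolding pairing_eq_wedge[symmetric] by (simp add: sum_distrib_left mult.left_commute)
  finally show ?thesis .
qed

text \<open>Combines \<open>vic_row_open\<close> and \<open>vic_row_wrapped\<close>.  The first factor on the right is \<open>det(1 - x Y)\<close>.\<close>

lemma pairing_H_op:
  assumes "bethe_roots n k t q y" and "0 < n"
  shows "(\<Prod>j\<in>{1..n}. 1 - x * y j) * pairing n k t y (H_op (n + k) t q x f) =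
    ((\<Prod>i\<in>{1..n + k}. 1 - x * t i) + (-1) ^ n * q * x ^ (n + k)) * pairing n k t y f"
proof -
  let ?w = "\<lambda>m z. (1 - x * z) * site_fun t m z"
  let ?D = "wedge_set n y ?w" and ?V = "wedge_set n y (site_fun t)"
  let ?P = "(\<Prod>i\<in>{1..n + k}. 1 - x * t i) + (-1) ^ n * q * x ^ (n + k)"
  have w: "?w (Suc j) z = (1 - x * t (Suc j)) * site_fun t (Suc j) z + (- x) * site_fun t (Suc (Suc j)) z" for j z
  proof -
    have "?w (Suc j) z = site_fun t (Suc j) z - x * (z * site_fun t (Suc j) z)" by (simp only: algebra_simps mult_1)
    then show ?thesis unfolding site_fun_step by (simp add: algebra_simps)
  qed
  have "(\<Prod>j\<in>{1..n}. 1 - x * y j) * pairing n k t y (H_op (n + k) t q x f) =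
      (\<Sum>I\<in>Pow {1..n + k}. H_op (n + k) t q x f I * ?D [] [] I)"
    unfolding pairing_eq_wedge[symmetric] sum_distrib_left
  proof (intro sum.cong refl)
    fix I
    have D: "?D [] [] I = (\<Prod>j\<in>{1..n}. 1 - x * y j) * ?V [] [] I"
      by (rule wedge_set_scale)
    show "(\<Prod>j\<in>{1..n}. 1 - x * y j) * (H_op (n + k) t q x f I * ?V [] [] I) =
        H_op (n + k) t q x f I * ?D [] [] I"
      unfolding D by (rule mult.left_commute)
  qed
  also have "\<dots> = (\<Sum>K\<in>Pow {1..n + k}. f K *
      (open_sum (L_vic t x) (n + k) False False K (?D [] []) +
       q * open_sum (L_vic t x) (n + k) True True K (?D [] [])))"
    unfolding H_op_def by (rule twisted_trace_pairing[OF site_local_L_vic])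
  also have "\<dots> = (\<Sum>K\<in>Pow {1..n + k}. f K * (?P * ?V [] [] K))"
  proof (intro sum.cong refl arg_cong2[of _ _ _ _ "(*)"])
    fix K assume K: "K \<in> Pow {1..n + k}"
    have KN: "K \<inter> {1..n + k} = K" using K by auto
    have sgn: "(-1) ^ card K * x ^ (n + k) * ?V [] [] K = (-1) ^ n * x ^ (n + k) * ?V [] [] K"
      by (cases "card K = n") (simp_all add: wedge_set_def wedge_def desc_def)
    have "open_sum (L_vic t x) (n + k) True True K (?D [] []) =
        x * open_sum (L_vic t x) (n + k) True False K (?D [] [site_fun t 1]) +
        (-1) ^ card (K \<inter> {1..n + k}) * x ^ (n + k) * ?V [] [] (K \<inter> {1..n + k})"
      using vic_row_wrapped[where w = ?w and th = "site_fun t", OF w] by blast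
    then have "q * open_sum (L_vic t x) (n + k) True True K (?D [] []) =
        x * (q * open_sum (L_vic t x) (n + k) True False K (?D [] [site_fun t 1])) +
        (-1) ^ n * q * x ^ (n + k) * ?V [] [] K"
      unfolding KN sgn by (simp add: algebra_simps)
    also have "q * open_sum (L_vic t x) (n + k) True False K (?D [] [site_fun t 1]) =
        open_sum (L_vic t x) (n + k) True False K (?D ([] @ [site_fun t (Suc (n + k))]) [])"
      by (simp add: open_sum_wedge_wrap[OF assms(1)])
    finally have "open_sum (L_vic t x) (n + k) False False K (?D [] []) +
       q * open_sum (L_vic t x) (n + k) True True K (?D [] []) =
       (open_sum (L_vic t x) (n + k) False False K (?D [] []) +
        x * open_sum (L_vic t x) (n + k) True False K (?D ([] @ [site_fun t (Suc (n + k))]) [])) +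
        (-1) ^ n * q * x ^ (n + k) * ?V [] [] K"
      by (simp only: add.assoc)
    also have "open_sum (L_vic t x) (n + k) False False K (?D [] []) +
        x * open_sum (L_vic t x) (n + k) True False K (?D ([] @ [site_fun t (Suc (n + k))]) []) =
        (\<Prod>i\<in>{1..n + k}. 1 - x * t i) * ?V [] [] (K \<inter> {1..n + k})"
      by (rule vic_row_open[where w = ?w and th = "site_fun t", OF w])
    finally show "open_sum (L_vic t x) (n + k) False False K (?D [] []) +
       q * open_sum (L_vic t x) (n + k) True True K (?D [] []) = ?P * ?V [] [] K"
      unfolding KN by (simp only: distrib_right)
  qed
  also have "\<dots> = ?P * pairing n k t y f"
    unfolding pairing_eq_wedge[symmetric] by (simp add: sum_distrib_left mult.left_commute)
  finally show ?thesis .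
qed

lemma comm_ring_hom_const_poly: "comm_ring_hom (\<lambda>c :: 'a::comm_ring_1. [:c:])"
  by unfold_locales (auto simp: one_pCons)

lemma alternant_hom:
  assumes "comm_ring_hom h"
  shows "h (alternant n t lam y) = alternant n (\<lambda>i. h (t i)) lam (\<lambda>j. h (y j))"
  by (simp add: alternant_def det1_hom[OF assms] fact_power_hom[OF assms])

text \<open>Extraction of the coefficient of \<open>x\<^sup>r\<close> from \<open>pairing_E_op\<close> over the polynomial ring, to which
  the Bethe equation carries over.\<close>

lemma pairing_E_coeff:
  assumes "bethe_roots n k t q y" and "0 < n"
  shows "pairing n k t y (E_coeff (n + k) t q r f) = elem_sym r n y * pairing n k t y f"
proof (cases "r < 0")
  case True
  then show ?thesis by (simp add: pairing_def E_coeff_def elem_sym_eq_0)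
next
  case False
  interpret c: comm_ring_hom "\<lambda>c :: 'a. [:c:]" by (rule comm_ring_hom_const_poly)
  let ?t = "\<lambda>j. [:t j:]" and ?y = "\<lambda>j. [:y j:]"
  let ?E = "E_op (n + k) ?t [:q:] [:0, 1:] (\<lambda>J. [:f J:])"
  have roots: "bethe_roots n k ?t [:q:] ?y"
    unfolding bethe_roots_def
  proof
    fix j assume "j \<in> {1..n}"
    then have "[:fact_power t (y j) (n + k):] = [:(-1) ^ (n - 1) * q:]"
      using assms(1) by (simp add: bethe_roots_def)
    then show "fact_power ?t [:y j:] (n + k) = (-1) ^ (n - 1) * [:q:]"
      by (simp only: fact_power_hom[OF comm_ring_hom_const_poly] c.hom_mult c.hom_power c.hom_uminus c.hom_one)
  qed
  have p: "pairing n k ?t ?y g = (\<Sum>nu\<in>box n k. smult (alternant n t nu y) (g (positions n nu)))" for g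
    by (simp add: pairing_def alternant_hom[OF comm_ring_hom_const_poly, symmetric] mult.commute)
  have "coeff (pairing n k ?t ?y ?E) (nat r) = pairing n k t y (E_coeff (n + k) t q r f)"
    unfolding p using False by (simp add: coeff_sum pairing_def E_coeff_def mult.commute)
  moreover have "pairing n k ?t ?y (\<lambda>J. [:f J:]) = [:pairing n k t y f:]"
    by (simp add: pairing_def alternant_hom[OF comm_ring_hom_const_poly, symmetric] c.hom_sum mult.commute)
  then have "pairing n k ?t ?y ?E = smult (pairing n k t y f) (\<Prod>j\<in>{1..n}. 1 + [:0, 1:] * [:y j:])"
    using pairing_E_op[OF roots assms(2), of "[:0, 1:]" "\<lambda>J. [:f J:]"] by (simp add: mult.commute)
  ultimately show ?thesis using False by (simp only: coeff_smult coeff_prod_elem_sym) (simp add: mult.commute)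
qed

lemma pairing_S_op:
  assumes "bethe_roots n k t q y" and "0 < n"
  shows "pairing n k t y (S_op n k t q lam f) =
    det1 k (\<lambda>i j. elem_sym (int (part (conj_part k lam) i) - int i + int j) n y) * pairing n k t y f"
proof -
  have fold: "pairing n k t y (foldr (\<lambda>i. E_coeff (n + k) t q (c i)) is f) =
      (\<Prod>i\<leftarrow>is. elem_sym (c i) n y) * pairing n k t y f" for c "is"
    by (induction "is") (simp_all add: pairing_E_coeff[OF assms] mult.assoc)
  have "(\<Prod>i\<leftarrow>[1..<k + 1]. e i) = (\<Prod>i\<in>{1..k}. e i)" for e :: "nat \<Rightarrow> 'a"
    by (subst prod.distinct_set_conv_list[symmetric]) (auto intro: prod.cong)
  then show ?thesis
    unfolding S_op_def pairing_sum fold by (simp add: det1_leibniz sum_distrib_right mult.assoc)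
qed

text \<open>Multiplied by the Vandermonde determinant, the eigenvalue of \<open>S\<^sub>\<mu>\<close> is the ordinary alternant of \<open>\<mu>\<close>, and
  \<open>alternant_expand\<close> sums these up.\<close>

lemma pairing_S_tilde:
  fixes t y :: "nat \<Rightarrow> 'a::idom"
  assumes "bethe_roots n k t q y" and "0 < n" and lam: "lam \<in> box n k"
  shows "vandermonde n y * pairing n k t y (S_tilde n k t q lam f) = alternant n t lam y * pairing n k t y f"
proof -
  let ?c = "\<lambda>mu. (-1) ^ (sum_list lam - sum_list mu) *
     det1 n (\<lambda>i j. elem_sym (int (part lam i) - int (part mu j) - int i + int j) (n + part lam i - i) t)"
  have "vandermonde n y * pairing n k t y (S_tilde n k t q lam f) =
     (\<Sum>mu | mu \<in> box n k \<and> part_sub mu lam. vandermonde n y * (?c mu *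
        (det1 k (\<lambda>i j. elem_sym (int (part (conj_part k mu) i) - int i + int j) n y) * pairing n k t y f)))"
    unfolding S_tilde_def pairing_sum pairing_S_op[OF assms(1,2)] by (rule sum_distrib_left)
  also have "\<dots> = (\<Sum>mu | mu \<in> box n k \<and> part_sub mu lam. ?c mu * alternant n (\<lambda>_. 0) mu y * pairing n k t y f)"
  proof (rule sum.cong[OF refl])
    fix mu assume "mu \<in> {mu. mu \<in> box n k \<and> part_sub mu lam}"
    then have mu: "mu \<in> box n k" by simp
    show "vandermonde n y * (?c mu *
        (det1 k (\<lambda>i j. elem_sym (int (part (conj_part k mu) i) - int i + int j) n y) * pairing n k t y f)) =
        ?c mu * alternant n (\<lambda>_. 0) mu y * pairing n k t y f"
      unfolding dual_jacobi_trudi[OF mu, symmetric] by (simp only: mult_ac)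
  qed
  also have "\<dots> = alternant n t lam y * pairing n k t y f"
    unfolding alternant_expand[OF lam] sum_distrib_right ..
  finally show ?thesis .
qed

lemma pairing_E_fold:
  assumes "bethe_roots n k t q y" and "0 < n"
  shows "pairing n k t y (fold (\<lambda>i. E_op (n + k) t q (w i)) [1..<m + 1] f) =
    (\<Prod>i\<in>{1..m}. \<Prod>j\<in>{1..n}. 1 + w i * y j) * pairing n k t y f"
  by (induction m) (simp_all add: pairing_E_op[OF assms] mult_ac)

lemma pairing_H_fold:
  assumes "bethe_roots n k t q y" and "0 < n"
  shows "(\<Prod>i\<in>{1..m}. \<Prod>j\<in>{1..n}. 1 - w i * y j) * pairing n k t y (fold (\<lambda>i. H_op (n + k) t q (w i)) [1..<m + 1] f) =
    (\<Prod>i\<in>{1..m}. (\<Prod>l\<in>{1..n + k}. 1 - w i * t l) + (-1) ^ n * q * w i ^ (n + k)) * pairing n k t y f"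
proof (induction m)
  case (Suc m)
  let ?g = "fold (\<lambda>i. H_op (n + k) t q (w i)) [1..<m + 1] f"
  let ?A = "\<Prod>i\<in>{1..m}. \<Prod>j\<in>{1..n}. 1 - w i * y j" and ?a = "\<Prod>j\<in>{1..n}. 1 - w (Suc m) * y j"
  let ?b = "(\<Prod>l\<in>{1..n + k}. 1 - w (Suc m) * t l) + (-1) ^ n * q * w (Suc m) ^ (n + k)"
  have "(\<Prod>i\<in>{1..Suc m}. \<Prod>j\<in>{1..n}. 1 - w i * y j) *
      pairing n k t y (fold (\<lambda>i. H_op (n + k) t q (w i)) [1..<Suc m + 1] f) =
      ?A * (?a * pairing n k t y (H_op (n + k) t q (w (Suc m)) ?g))"
    by (simp add: mult_ac)
  also have "\<dots> = ?b * (?A * pairing n k t y ?g)"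
    unfolding pairing_H_op[OF assms] by (simp only: mult_ac)
  finally show ?case unfolding Suc.IH by (simp add: mult_ac)
qed simp

section \<open>Expansions of the partition functions\<close>

lemma alternant_not_inj:
  assumes "\<not> inj_on g {1..n}"
  shows "alternant n t nu (\<lambda>j. b (g j)) = 0"
proof -
  obtain i j where ij: "i \<in> {1..n}" "j \<in> {1..n}" "i \<noteq> j" "g i = g j"
    using assms by (auto simp: inj_on_def)
  have "det1 n (\<lambda>i j. fact_power t (b (g i)) (expo n nu j)) = 0"
    by (rule det1_identical_rows[OF ij(1,2,3)]) (simp add: ij(4))
  then show ?thesis
    unfolding alternant_def by (subst det1_transpose[symmetric])
qed

lemma pairing_separates:
  fixes b :: "nat \<Rightarrow> 'a::idom"
  assumes b: "inj_on b {1..n + k}"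
    and eq: "\<And>g. g \<in> {1..n} \<rightarrow> {1..n + k} \<Longrightarrow> inj_on g {1..n} \<Longrightarrow>
      pairing n k t (\<lambda>j. b (g j)) f = pairing n k t (\<lambda>j. b (g j)) f'"
    and lam: "lam \<in> box n k"
  shows "f (positions n lam) = f' (positions n lam)"
proof -
  have "(\<lambda>nu. f (positions n nu) - f' (positions n nu)) lam = 0"
  proof (rule alternants_separate[OF b _ lam])
    fix g assume g: "g \<in> {1..n} \<rightarrow> {1..n + k}"
    have "pairing n k t (\<lambda>j. b (g j)) (\<lambda>I. f I - f' I) = 0"
    proof (cases "inj_on g {1..n}")
      case True
      then show ?thesis unfolding pairing_diff using eq[OF g] by simp
    next
      case False
      then show ?thesis by (simp add: pairing_def alternant_not_inj)
    qed
    then show "(\<Sum>nu\<in>box n k. (f (positions n nu) - f' (positions n nu)) * alternant n t nu (\<lambda>j. b (g j))) = 0"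
      by (simp add: pairing_def)
  qed
  then show ?thesis by simp
qed

text \<open>In an integral domain the \<open>n + k\<close> distinct values are all the solutions of the Bethe equation, as its degree is \<open>n + k\<close>.\<close>

definition bethe_solution :: "nat \<Rightarrow> nat \<Rightarrow> (nat \<Rightarrow> 'a::comm_ring_1) \<Rightarrow> 'a \<Rightarrow> (nat \<Rightarrow> 'a) \<Rightarrow> bool" where
  "bethe_solution n k t q b \<longleftrightarrow> inj_on b {1..n + k} \<and>
     (\<forall>m\<in>{1..n + k}. fact_power t (b m) (n + k) = (-1) ^ (n - 1) * q)"

lemma bethe_solutionD:
  fixes b :: "nat \<Rightarrow> 'a::idom"
  assumes "bethe_solution n k t q b" "g \<in> {1..n} \<rightarrow> {1..n + k}"
  shows "bethe_roots n k t q (\<lambda>j. b (g j))"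
    and "inj_on g {1..n} \<Longrightarrow> vandermonde n (\<lambda>j. b (g j)) \<noteq> 0"
proof -
  show "bethe_roots n k t q (\<lambda>j. b (g j))"
    using assms by (auto simp: bethe_roots_def bethe_solution_def Pi_iff)
  assume g: "inj_on g {1..n}"
  have "inj_on (b \<circ> g) {1..n}"
  proof (rule comp_inj_on[OF g])
    show "inj_on b (g ` {1..n})"
      using assms by (auto simp: bethe_solution_def intro: inj_on_subset)
  qed
  then have "inj_on (\<lambda>j. b (g j)) {1..n}" by (simp only: o_def)
  then show "vandermonde n (\<lambda>j. b (g j)) \<noteq> 0" by (rule vandermonde_nonzero)
qed

text \<open>Stated at the sites of \<open>|\<lambda>\<rangle>\<close>, since the operators are only controlled on \<open>V\<^sub>n\<close>.\<close>

lemma S_tilde_empty: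
  fixes b :: "nat \<Rightarrow> 'a::idom"
  assumes b: "bethe_solution n k t q b" and n: "0 < n" and lam: "lam \<in> box n k"
  shows "S_tilde n k t q (replicate n 0) f (positions n lam) = f (positions n lam)"
proof (rule pairing_separates[OF _ _ lam])
  show "inj_on b {1..n + k}" using b by (simp add: bethe_solution_def)
  fix g assume g: "g \<in> {1..n} \<rightarrow> {1..n + k}" "inj_on g {1..n}"
  note roots = bethe_solutionD(1)[OF b g(1)] and nz = bethe_solutionD(2)[OF b g(1) g(2)]
  show "pairing n k t (\<lambda>j. b (g j)) (S_tilde n k t q (replicate n 0) f) = pairing n k t (\<lambda>j. b (g j)) f"
    using pairing_S_tilde[OF roots n replicate_box, of f] nz by (simp add: alternant_empty)
qed

text \<open>Applied to both sides, a Bethe functional yields the eigenvalues of \<open>H(w\<^sub>1), \<dots>, H(w\<^sub>n)\<close> on the left and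
  those of the operators \<open>S\<close>-tilde on the right.  With \<open>w\<^sub>i = 1 / x\<^sub>i\<close> the equality of the two is the factorial
  Cauchy identity.  Exchanging \<open>\<mu>\<close> and \<open>\<nu>\<close> is harmless, because the eigenvalue of \<open>S\<close>-tilde at
  \<open>\<mu>\<close> and the value of the functional at \<open>|\<mu>\<rangle>\<close> are the same alternant.\<close>

lemma Z_vic_expansion:
  fixes b :: "nat \<Rightarrow> 'a::idom"
  assumes b: "bethe_solution n k t q b" and n: "0 < n"
    and lam: "lam \<in> box n k" and mu: "mu \<in> box n k"
    and xw: "\<And>i. i \<in> {1..n} \<Longrightarrow> x i * w i = 1"
    and xb: "\<And>i m. i \<in> {1..n} \<Longrightarrow> m \<in> {1..n + k} \<Longrightarrow> x i \<noteq> b m"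
  shows "(\<Prod>i\<in>{1..n}. x i) ^ k * vandermonde n x * Z_vic n k t q w lam mu =
    (\<Sum>nu\<in>box n k. alternant n (rev_params (n + k) t) (compl_part k nu) x *
       S_tilde n k t q mu (basis_vec (positions n nu)) (positions n lam))"
proof -
  let ?alt = "\<lambda>nu. alternant n (rev_params (n + k) t) (compl_part k nu) x"
  let ?c = "(\<Prod>i\<in>{1..n}. x i) ^ k * vandermonde n x"
  let ?Z = "fold (\<lambda>i. H_op (n + k) t q (w i)) [1..<n + 1] (basis_vec (positions n mu))"
  let ?F = "\<lambda>I. ?c * ?Z I"
  let ?G = "\<lambda>I. \<Sum>nu\<in>box n k. ?alt nu * S_tilde n k t q mu (basis_vec (positions n nu)) I"
  have "?F (positions n lam) = ?G (positions n lam)"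
  proof (rule pairing_separates[OF _ _ lam])
    show "inj_on b {1..n + k}" using b by (simp add: bethe_solution_def)
    fix g assume g: "g \<in> {1..n} \<rightarrow> {1..n + k}" "inj_on g {1..n}"
    define y where "y = (\<lambda>j. b (g j))"
    have roots: "bethe_roots n k t q y" and nz: "vandermonde n y \<noteq> 0"
      unfolding y_def using bethe_solutionD[OF b g(1)] g(2) by auto
    define P where "P i = fact_power t (x i) (n + k) - (-1) ^ (n - 1) * q" for i
    let ?xy = "\<Prod>i\<in>{1..n}. \<Prod>j\<in>{1..n}. x i - y j"
    have xy: "?xy \<noteq> 0"
    proof -
      have "x i - y j \<noteq> 0" if "i \<in> {1..n}" "j \<in> {1..n}" for i j
        using xb[of i "g j"] that g(1) by (auto simp: y_def Pi_iff)
      then show ?thesis by (simp only: prod_zero_iff finite_atLeastAtMost) blast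
    qed
    have cauchy: "?xy * (\<Sum>nu\<in>box n k. ?alt nu * alternant n t nu y) =
        (\<Prod>i\<in>{1..n}. P i) * (vandermonde n x * vandermonde n y)"
      by (rule cauchy_identity) (use roots in \<open>simp add: bethe_roots_def P_def\<close>)
    have Z: "?xy * ((\<Prod>i\<in>{1..n}. x i) ^ k * pairing n k t y ?Z) = (\<Prod>i\<in>{1..n}. P i) * alternant n t mu y"
    proof -
      have 1: "x i ^ n * (\<Prod>j\<in>{1..n}. 1 - w i * y j) = (\<Prod>j\<in>{1..n}. x i - y j)" if "i \<in> {1..n}" for i
      proof -
        have "x i ^ n * (\<Prod>j\<in>{1..n}. 1 - w i * y j) = (\<Prod>j\<in>{1..n}. x i * (1 - w i * y j))"
          by (simp add: prod.distrib)
        also have "\<dots> = (\<Prod>j\<in>{1..n}. x i - y j)"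
          by (simp add: right_diff_distrib mult.assoc[symmetric] xw[OF that])
        finally show ?thesis .
      qed
      have 2: "x i ^ (n + k) * ((\<Prod>l\<in>{1..n + k}. 1 - w i * t l) + (-1) ^ n * q * w i ^ (n + k)) = P i"
        if "i \<in> {1..n}" for i
      proof -
        have "x i ^ (n + k) * (\<Prod>l\<in>{1..n + k}. 1 - w i * t l) = (\<Prod>l\<in>{1..n + k}. x i * (1 - w i * t l))"
          by (simp add: prod.distrib)
        also have "\<dots> = fact_power t (x i) (n + k)"
          by (simp add: fact_power_def right_diff_distrib mult.assoc[symmetric] xw[OF that])
        finally have "x i ^ (n + k) * (\<Prod>l\<in>{1..n + k}. 1 - w i * t l) = fact_power t (x i) (n + k)" .
        moreover have "x i ^ (n + k) * w i ^ (n + k) = 1"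
          by (simp add: power_mult_distrib[symmetric] xw[OF that])
        moreover have "(-1 :: 'a) ^ n = - ((-1) ^ (n - 1))"
          using n by (cases n) auto
        moreover have "x i ^ (n + k) * ((\<Prod>l\<in>{1..n + k}. 1 - w i * t l) + (-1) ^ n * q * w i ^ (n + k)) =
            x i ^ (n + k) * (\<Prod>l\<in>{1..n + k}. 1 - w i * t l) + (-1) ^ n * q * (x i ^ (n + k) * w i ^ (n + k))"
          by (simp only: distrib_left mult_ac)
        ultimately show ?thesis by (simp add: P_def)
      qed
      have "?xy * ((\<Prod>i\<in>{1..n}. x i) ^ k * pairing n k t y ?Z) =
          (\<Prod>i\<in>{1..n}. x i) ^ n * (\<Prod>i\<in>{1..n}. x i) ^ k *
          ((\<Prod>i\<in>{1..n}. \<Prod>j\<in>{1..n}. 1 - w i * y j) * pairing n k t y ?Z)"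
      proof -
        have "?xy = (\<Prod>i\<in>{1..n}. x i ^ n * (\<Prod>j\<in>{1..n}. 1 - w i * y j))"
          by (rule prod.cong) (simp_all only: 1)
        then have "?xy = (\<Prod>i\<in>{1..n}. x i) ^ n * (\<Prod>i\<in>{1..n}. \<Prod>j\<in>{1..n}. 1 - w i * y j)"
          by (simp only: prod.distrib prod_power_distrib)
        then show ?thesis by (simp only: mult_ac)
      qed
      also have "\<dots> = (\<Prod>i\<in>{1..n}. x i) ^ (n + k) *
          (\<Prod>i\<in>{1..n}. (\<Prod>l\<in>{1..n + k}. 1 - w i * t l) + (-1) ^ n * q * w i ^ (n + k)) * alternant n t mu y"
        unfolding pairing_H_fold[OF roots n] pairing_basis_vec[OF mu] by (simp only: power_add mult_ac)
      also have "(\<Prod>i\<in>{1..n}. x i) ^ (n + k) *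
          (\<Prod>i\<in>{1..n}. (\<Prod>l\<in>{1..n + k}. 1 - w i * t l) + (-1) ^ n * q * w i ^ (n + k)) = (\<Prod>i\<in>{1..n}. P i)"
        unfolding prod_power_distrib prod.distrib[symmetric] by (rule prod.cong) (simp_all only: 2)
      finally show ?thesis .
    qed
    have "(vandermonde n y * ?xy) * pairing n k t y ?F = (vandermonde n y * ?xy) * pairing n k t y ?G"
    proof -
      have "(vandermonde n y * ?xy) * pairing n k t y ?F =
          vandermonde n x * vandermonde n y * (?xy * ((\<Prod>i\<in>{1..n}. x i) ^ k * pairing n k t y ?Z))"
        unfolding pairing_scale by (simp only: mult_ac)
      also have "\<dots> = alternant n t mu y * ((\<Prod>i\<in>{1..n}. P i) * (vandermonde n x * vandermonde n y))"
        unfolding Z by (simp only: mult_ac)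
      also have "\<dots> = ?xy * (\<Sum>nu\<in>box n k. ?alt nu * (alternant n t mu y * alternant n t nu y))"
        unfolding cauchy[symmetric] by (simp only: sum_distrib_left mult_ac)
      also have "\<dots> = ?xy * (\<Sum>nu\<in>box n k. ?alt nu * (vandermonde n y *
          pairing n k t y (S_tilde n k t q mu (basis_vec (positions n nu)))))"
        by (simp add: pairing_S_tilde[OF roots n mu] pairing_basis_vec)
      also have "\<dots> = (vandermonde n y * ?xy) * pairing n k t y ?G"
        unfolding pairing_sum by (simp only: sum_distrib_left mult_ac)
      finally show ?thesis .
    qed
    then show "pairing n k t (\<lambda>j. b (g j)) ?F = pairing n k t (\<lambda>j. b (g j)) ?G"
      unfolding y_def[symmetric] using nz xy by simp
  qed
  then show ?thesis unfolding Z_vic_operator[OF lam mu] .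
qed

lemma Z_vic_from_empty:
  fixes b :: "nat \<Rightarrow> 'a::idom"
  assumes b: "bethe_solution n k t q b" and n: "0 < n" and lam: "lam \<in> box n k"
    and xw: "\<And>i. i \<in> {1..n} \<Longrightarrow> x i * w i = 1"
    and xb: "\<And>i m. i \<in> {1..n} \<Longrightarrow> m \<in> {1..n + k} \<Longrightarrow> x i \<noteq> b m"
  shows "(\<Prod>i\<in>{1..n}. x i) ^ k * vandermonde n x * Z_vic n k t q w lam (replicate n 0) =
    alternant n (rev_params (n + k) t) (compl_part k lam) x"
proof -
  let ?alt = "\<lambda>nu. alternant n (rev_params (n + k) t) (compl_part k nu) x"
  have "(\<Prod>i\<in>{1..n}. x i) ^ k * vandermonde n x * Z_vic n k t q w lam (replicate n 0) =
      (\<Sum>nu\<in>box n k. ?alt nu * basis_vec (positions n nu) (positions n lam))"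
    by (subst Z_vic_expansion[OF b n lam replicate_box]) (use xw xb in \<open>simp_all add: S_tilde_empty[OF b n lam]\<close>)
  also have "\<dots> = (\<Sum>nu\<in>box n k. if nu = lam then ?alt nu else 0)"
    using bij_betw_imp_inj_on[OF bij_betw_positions, of n k] lam
    by (intro sum.cong) (auto simp: basis_vec_def dest: inj_onD)
  also have "\<dots> = ?alt lam" using lam by (simp add: finite_box)
  finally show ?thesis .
qed

text \<open>The hypothesis is only about \<open>\<mu> = \<emptyset>\<close>.  All rows of the osculating model are diagonal in the Bethe functionals, and
  so the dependence of the partition function on \<open>\<mu>\<close> is the factor \<open>s\<^sub>\<mu>(y|t)\<close>, which is the
  eigenvalue of \<open>S\<close>-tilde.\<close>

lemma Z_osc_expansion:
  fixes b :: "nat \<Rightarrow> 'a::idom"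
  assumes b: "bethe_solution n k t q b" and n: "0 < n"
    and lam: "lam \<in> box n k" and mu: "mu \<in> box n k"
    and a: "\<And>nu. nu \<in> box n k \<Longrightarrow> c * Z_osc n k t q w nu (replicate n 0) = a nu"
  shows "c * Z_osc n k t q w lam mu =
    (\<Sum>nu\<in>box n k. a nu * S_tilde n k t q mu (basis_vec (positions n nu)) (positions n lam))"
proof -
  let ?Z = "\<lambda>mu. fold (\<lambda>i. E_op (n + k) t q (w i)) [1..<k + 1] (basis_vec (positions n mu))"
  let ?F = "\<lambda>I. c * ?Z mu I"
  let ?G = "\<lambda>I. \<Sum>nu\<in>box n k. a nu * S_tilde n k t q mu (basis_vec (positions n nu)) I"
  have "?F (positions n lam) = ?G (positions n lam)"
  proof (rule pairing_separates[OF _ _ lam])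
    show "inj_on b {1..n + k}" using b by (simp add: bethe_solution_def)
    fix g assume g: "g \<in> {1..n} \<rightarrow> {1..n + k}" "inj_on g {1..n}"
    define y where "y = (\<lambda>j. b (g j))"
    have roots: "bethe_roots n k t q y" and nz: "vandermonde n y \<noteq> 0"
      unfolding y_def using bethe_solutionD[OF b g(1)] g(2) by auto
    let ?e = "\<Prod>i\<in>{1..k}. \<Prod>j\<in>{1..n}. 1 + w i * y j"
    have F: "pairing n k t y (\<lambda>I. c * ?Z nu I) = c * (?e * alternant n t nu y)" if "nu \<in> box n k" for nu
      unfolding pairing_scale pairing_E_fold[OF roots n] pairing_basis_vec[OF that] ..
    have "c * (?e * vandermonde n y) = pairing n k t y (\<lambda>I. c * ?Z (replicate n 0) I)"
      unfolding F[OF replicate_box] alternant_empty ..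
    also have "\<dots> = (\<Sum>nu\<in>box n k. a nu * alternant n t nu y)"
      unfolding pairing_def
      by (intro sum.cong refl) (simp only: a[symmetric] Z_osc_operator[OF _ replicate_box])
    finally have G: "c * (?e * vandermonde n y) = (\<Sum>nu\<in>box n k. a nu * alternant n t nu y)" .
    have "vandermonde n y * pairing n k t y ?F = alternant n t mu y * (c * (?e * vandermonde n y))"
      unfolding F[OF mu] by (simp only: mult_ac)
    also have "\<dots> = (\<Sum>nu\<in>box n k. a nu * (alternant n t mu y * alternant n t nu y))"
      unfolding G by (simp only: sum_distrib_left mult_ac)
    also have "\<dots> = (\<Sum>nu\<in>box n k. a nu * (vandermonde n y *
          pairing n k t y (S_tilde n k t q mu (basis_vec (positions n nu)))))"
      by (simp add: pairing_S_tilde[OF roots n mu] pairing_basis_vec)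
    also have "\<dots> = vandermonde n y * pairing n k t y ?G"
      unfolding pairing_sum by (simp only: sum_distrib_left mult_ac)
    finally show "pairing n k t (\<lambda>j. b (g j)) ?F = pairing n k t (\<lambda>j. b (g j)) ?G"
      unfolding y_def[symmetric] using nz by simp
  qed
  then show ?thesis unfolding Z_osc_operator[OF lam mu] .
qed

section \<open>Particle-hole duality\<close>

definition dual_sites :: "nat \<Rightarrow> nat set \<Rightarrow> nat set" where
  "dual_sites N I = (\<lambda>p. N + 1 - p) ` ({1..N} - I)"

definition mirror_edges :: "nat \<Rightarrow> nat set \<Rightarrow> nat set" where
  "mirror_edges N h = (\<lambda>e. N - e) ` h"

definition dual_params :: "nat \<Rightarrow> (nat \<Rightarrow> 'a::comm_ring_1) \<Rightarrow> nat \<Rightarrow> 'a" where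
  "dual_params N t j = - t (N + 1 - j)"

lemma mem_dual_sites:
  assumes "j \<in> {1..N}"
  shows "N + 1 - j \<in> dual_sites N I \<longleftrightarrow> j \<notin> I"
proof
  assume "N + 1 - j \<in> dual_sites N I"
  then obtain p where "p \<in> {1..N}" "p \<notin> I" "N + 1 - j = N + 1 - p" by (auto simp: dual_sites_def)
  moreover from this have "p = j" using assms by auto
  ultimately show "j \<notin> I" by simp
next
  assume "j \<notin> I"
  then show "N + 1 - j \<in> dual_sites N I" using assms by (auto simp: dual_sites_def)
qed

lemma dual_sites_subset: "dual_sites N I \<subseteq> {1..N}"
  by (auto simp: dual_sites_def)

lemma dual_sites_involution:
  assumes "I \<subseteq> {1..N}"
  shows "dual_sites N (dual_sites N I) = I"
proof (rule Set.set_eqI)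
  fix j
  show "j \<in> dual_sites N (dual_sites N I) \<longleftrightarrow> j \<in> I"
  proof (cases "j \<in> {1..N}")
    case True
    then have "N + 1 - j \<in> {1..N}" "N + 1 - (N + 1 - j) = j" by auto
    with mem_dual_sites[OF True, of I] mem_dual_sites[of "N + 1 - j" N "dual_sites N I"]
    show ?thesis by simp
  next
    case False
    then show ?thesis using assms dual_sites_subset[of N "dual_sites N I"] by blast
  qed
qed

lemma mem_mirror_edges:
  assumes "h \<subseteq> {0..N}" "e \<le> N"
  shows "N - e \<in> mirror_edges N h \<longleftrightarrow> e \<in> h"
proof
  assume "N - e \<in> mirror_edges N h"
  then obtain d where d: "d \<in> h" "N - e = N - d" by (auto simp: mirror_edges_def)
  then have "d \<le> N" using assms(1) by auto
  then have "d = e" using d(2) assms(2) by simp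
  then show "e \<in> h" using d(1) by simp
qed (auto simp: mirror_edges_def)

lemma mirror_edges_involution:
  assumes "h \<subseteq> {0..N}"
  shows "mirror_edges N (mirror_edges N h) = h"
proof -
  have "mirror_edges N (mirror_edges N h) = (\<lambda>e. e) ` h"
    unfolding mirror_edges_def image_image by (rule image_cong) (use assms in auto)
  then show ?thesis by simp
qed

lemma mirror_edges_row: "h \<in> row_configs N \<Longrightarrow> mirror_edges N h \<in> row_configs N"
  using mem_mirror_edges[of h N 0] mem_mirror_edges[of h N N]
  by (auto simp: row_configs_def mirror_edges_def)

text \<open>Exchanging particles with holes and the two horizontal edges turns one \<open>L\<close>-operator into the other, up to
  the gauge transformation by \<open>diag(1, x)\<close> in the horizontal space.\<close>

lemma vertex_weight_dual:
  assumes "j \<in> {1..N}"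
  shows "vertex_weight (L_osc t x) j a b e' e * (if a then x else 1) =
    vertex_weight (L_vic (dual_params N t) x) (N + 1 - j) b a (\<not> e') (\<not> e) * (if b then x else 1)"
proof -
  have "dual_params N t (N + 1 - j) = - t j" using assms by (simp add: dual_params_def)
  then show ?thesis
    by (cases a; cases b; cases e; cases e')
      (simp_all add: vertex_weight_def basis_vec_def sigma_plus_def sigma_minus_def)
qed

text \<open>The gauge factors of neighbouring columns cancel around the cylinder.\<close>

lemma prod_shift_cyclic: "f 0 * (\<Prod>j\<in>{1..N}. f j) = f N * (\<Prod>j\<in>{1..N}. f (j - 1 :: nat))"
  for f :: "nat \<Rightarrow> 'a::comm_ring_1"
proof (induction N)
  case (Suc N)
  have "f 0 * (\<Prod>j\<in>{1..Suc N}. f j) = f (Suc N) * (f 0 * (\<Prod>j\<in>{1..N}. f j))" by (simp add: mult_ac)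
  also have "\<dots> = f (Suc N) * (\<Prod>j\<in>{1..Suc N}. f (j - 1))" unfolding Suc.IH by (simp add: mult_ac)
  finally show ?case .
qed simp

lemma row_weight_dual:
  fixes x :: "'a::idom"
  assumes x: "x \<noteq> 0" and h: "h \<in> row_configs N"
  shows "row_weight (L_vic (dual_params N t) x) N q (dual_sites N A) (dual_sites N B) (mirror_edges N h) =
    row_weight (L_osc t x) N q A B h"
proof -
  have hs: "h \<subseteq> {0..N}" and h0: "0 \<in> h \<longleftrightarrow> N \<in> h" using h by (auto simp: row_configs_def)
  let ?v = "vertex_weight (L_vic (dual_params N t) x)" and ?o = "vertex_weight (L_osc t x)"
  let ?f = "\<lambda>e. if e \<in> h then x else 1"
  let ?h = "mirror_edges N h" and ?A = "dual_sites N A" and ?B = "dual_sites N B"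
  let ?V = "\<Prod>j\<in>{1..N}. ?v (N + 1 - j) (j - 1 \<in> h) (j \<in> h) (j \<notin> B) (j \<notin> A)"
  let ?O = "\<Prod>j\<in>{1..N}. ?o j (j \<in> h) (j - 1 \<in> h) (j \<in> B) (j \<in> A)"
  have "(\<Prod>j\<in>{1..N}. ?v j (j \<in> ?h) (j - 1 \<in> ?h) (j \<in> ?B) (j \<in> ?A)) =
      (\<Prod>j\<in>{1..N}. ?v (N + 1 - j) (N + 1 - j \<in> ?h) (N + 1 - j - 1 \<in> ?h) (N + 1 - j \<in> ?B) (N + 1 - j \<in> ?A))"
    by (rule prod.reindex_bij_witness[where i = "\<lambda>j. N + 1 - j" and j = "\<lambda>j. N + 1 - j"]) auto
  also have "\<dots> = ?V"
  proof (rule prod.cong[OF refl])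
    fix j assume j: "j \<in> {1..N}"
    then have e: "N + 1 - j = N - (j - 1)" "N + 1 - j - 1 = N - j" by auto
    have "N + 1 - j \<in> ?h \<longleftrightarrow> j - 1 \<in> h" unfolding e(1) by (rule mem_mirror_edges[OF hs]) (use j in auto)
    moreover have "N + 1 - j - 1 \<in> ?h \<longleftrightarrow> j \<in> h" unfolding e(2) by (rule mem_mirror_edges[OF hs]) (use j in auto)
    ultimately show "?v (N + 1 - j) (N + 1 - j \<in> ?h) (N + 1 - j - 1 \<in> ?h) (N + 1 - j \<in> ?B) (N + 1 - j \<in> ?A) =
        ?v (N + 1 - j) (j - 1 \<in> h) (j \<in> h) (j \<notin> B) (j \<notin> A)"
      by (simp only: mem_dual_sites[OF j])
  qed
  finally have V: "(\<Prod>j\<in>{1..N}. ?v j (j \<in> ?h) (j - 1 \<in> ?h) (j \<in> ?B) (j \<in> ?A)) = ?V" .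
  have "?O * (\<Prod>j\<in>{1..N}. ?f j) = ?V * (\<Prod>j\<in>{1..N}. ?f (j - 1))"
    unfolding prod.distrib[symmetric] by (rule prod.cong) (simp_all only: vertex_weight_dual)
  moreover have "(\<Prod>j\<in>{1..N}. ?f j) = (\<Prod>j\<in>{1..N}. ?f (j - 1))"
  proof -
    have nz: "?f N \<noteq> 0" and "?f 0 = ?f N" using x h0 by auto
    then have "?f N * (\<Prod>j\<in>{1..N}. ?f j) = ?f N * (\<Prod>j\<in>{1..N}. ?f (j - 1))"
      using prod_shift_cyclic[of ?f N] by (simp only:)
    then show ?thesis by (rule mult_left_cancel[OF nz, THEN iffD1])
  qed
  moreover have "(\<Prod>j\<in>{1..N}. ?f j) \<noteq> 0" using x by auto
  ultimately have "?O = ?V" by (simp only: mult_right_cancel simp_thms)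
  moreover have "0 \<in> ?h \<longleftrightarrow> 0 \<in> h"
    using mem_mirror_edges[OF hs, of N] h0 by simp
  ultimately show ?thesis unfolding row_weight_def V by simp
qed

lemma cylinder_sum_dual:
  fixes x :: "nat \<Rightarrow> 'a::idom"
  assumes x: "\<And>i. i \<in> {1..m} \<Longrightarrow> x i \<noteq> 0" and A: "A \<subseteq> {1..N}" and B: "B \<subseteq> {1..N}"
  shows "cylinder_sum (\<lambda>i. L_osc t (x i)) N m q A B =
    cylinder_sum (\<lambda>i. L_vic (dual_params N t) (x i)) N m q (dual_sites N A) (dual_sites N B)"
proof -
  let ?d = "\<lambda>v. restrict (\<lambda>i. dual_sites N (v i)) {0..m}"
  let ?r = "\<lambda>h. restrict (\<lambda>i. mirror_edges N (h i)) {1..m}"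
  let ?w = "\<lambda>v h. \<Prod>i\<in>{1..m}. row_weight (L_vic (dual_params N t) (x i)) N q (v (i - 1)) (v i) (h i)"
  let ?H = "{1..m} \<rightarrow>\<^sub>E row_configs N"
  have rr: "?r (?r h) = h" and rH: "?r h \<in> ?H" if "h \<in> ?H" for h
  proof -
    have "h i \<subseteq> {0..N}" if "i \<in> {1..m}" for i
      using \<open>h \<in> ?H\<close> that by (auto simp: PiE_iff row_configs_def)
    then show "?r (?r h) = h"
      using that by (intro extensionalityI[where A = "{1..m}"]) (auto simp: mirror_edges_involution PiE_iff)
    show "?r h \<in> ?H" using that mirror_edges_row by (auto simp: PiE_iff)
  qed
  have dd: "?d (?d v) = v" if "v \<in> vertical_configs N m A' B'" for v A' B'
  proof -
    have "v i \<subseteq> {1..N}" if "i \<in> {0..m}" for i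
      using \<open>v \<in> vertical_configs N m A' B'\<close> that by (auto simp: vertical_configs_def PiE_iff)
    then show ?thesis
      using that by (intro extensionalityI[where A = "{0..m}"])
        (auto simp: dual_sites_involution vertical_configs_def PiE_iff)
  qed
  have dV: "?d v \<in> vertical_configs N m (dual_sites N A') (dual_sites N B')"
    if "v \<in> vertical_configs N m A' B'" for v A' B'
    using that dual_sites_subset by (fastforce simp: vertical_configs_def)
  have "(\<Sum>h\<in>?H. \<Prod>i\<in>{1..m}. row_weight (L_osc t (x i)) N q (v (i - 1)) (v i) (h i)) =
      (\<Sum>h\<in>?H. ?w (?d v) h)" for v
  proof (rule sum.reindex_bij_witness[where i = ?r and j = ?r])
    fix h assume h: "h \<in> ?H"
    show "?w (?d v) (?r h) = (\<Prod>i\<in>{1..m}. row_weight (L_osc t (x i)) N q (v (i - 1)) (v i) (h i))"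
    proof (rule prod.cong[OF refl])
      fix i assume i: "i \<in> {1..m}"
      then have "i - 1 \<in> {0..m}" "i \<in> {0..m}" by auto
      moreover have "h i \<in> row_configs N" using h i by auto
      ultimately show "row_weight (L_vic (dual_params N t) (x i)) N q (?d v (i - 1)) (?d v i) (?r h i) =
          row_weight (L_osc t (x i)) N q (v (i - 1)) (v i) (h i)"
        using i by (simp only: restrict_apply' row_weight_dual[OF x[OF i]])
    qed
  qed (use rr rH in auto)
  then have "cylinder_sum (\<lambda>i. L_osc t (x i)) N m q A B =
      (\<Sum>v\<in>vertical_configs N m A B. \<Sum>h\<in>?H. ?w (?d v) h)"
    unfolding cylinder_sum_def by simp
  also have "\<dots> = (\<Sum>v\<in>vertical_configs N m (dual_sites N A) (dual_sites N B). \<Sum>h\<in>?H. ?w v h)"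
    by (rule sum.reindex_bij_witness[where i = ?d and j = ?d])
      (use dd dV[of _ A B] dV[of _ "dual_sites N A" "dual_sites N B"] dual_sites_involution[OF A] dual_sites_involution[OF B] in auto)
  finally show ?thesis by (simp only: cylinder_sum_def)
qed

lemma Z_osc_dual:
  fixes x :: "nat \<Rightarrow> 'a::idom"
  assumes lam: "lam \<in> box n k" and mu: "mu \<in> box n k" and x: "\<And>i. i \<in> {1..k} \<Longrightarrow> x i \<noteq> 0"
  shows "Z_osc n k t q x lam mu =
    Z_vic k n (dual_params (n + k) t) q x (conj_part k lam) (conj_part k mu)"
  unfolding Z_osc_def Z_vic_def add.commute[of k n]
    positions_conj_part[OF lam, folded dual_sites_def] positions_conj_part[OF mu, folded dual_sites_def]
  by (rule cylinder_sum_dual[OF x positions_subset[OF mu] positions_subset[OF lam]])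

section \<open>Change of the coefficient ring\<close>

lemma L_vic_hom:
  assumes "comm_ring_hom h"
  shows "h (L_vic t x j a b f I) = L_vic (\<lambda>i. h (t i)) (h x) j a b (\<lambda>I. h (f I)) I"
proof -
  interpret comm_ring_hom h by fact
  show ?thesis by (cases a; cases b) (simp_all add: sigma_plus_def sigma_minus_def hom_distribs)
qed

lemma L_osc_hom:
  assumes "comm_ring_hom h"
  shows "h (L_osc t x j a b f I) = L_osc (\<lambda>i. h (t i)) (h x) j a b (\<lambda>I. h (f I)) I"
proof -
  interpret comm_ring_hom h by fact
  show ?thesis by (cases a; cases b) (simp_all add: sigma_plus_def sigma_minus_def hom_distribs)
qed

lemma basis_vec_hom:
  assumes "comm_ring_hom h"
  shows "(\<lambda>I. h (basis_vec J I)) = basis_vec J"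
proof -
  interpret comm_ring_hom h by fact
  show ?thesis by (auto simp: basis_vec_def)
qed

lemma Z_vic_hom:
  assumes h: "comm_ring_hom h"
  shows "h (Z_vic n k t q w lam mu) = Z_vic n k (\<lambda>i. h (t i)) (h q) (\<lambda>i. h (w i)) lam mu"
proof -
  interpret comm_ring_hom h by fact
  have 1: "h (vertex_weight (L_vic t x) j a b e' e) = vertex_weight (L_vic (\<lambda>i. h (t i)) (h x)) j a b e' e" for x j a b e' e
    unfolding vertex_weight_def L_vic_hom[OF h] basis_vec_hom[OF h] ..
  have 2: "h (row_weight (L_vic t x) N q A B r) = row_weight (L_vic (\<lambda>i. h (t i)) (h x)) N (h q) A B r" for x N A B r
    by (simp add: row_weight_def hom_mult hom_prod 1)
  show ?thesis by (simp add: Z_vic_def cylinder_sum_def hom_sum hom_prod 2)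
qed

lemma Z_osc_hom:
  assumes h: "comm_ring_hom h"
  shows "h (Z_osc n k t q w lam mu) = Z_osc n k (\<lambda>i. h (t i)) (h q) (\<lambda>i. h (w i)) lam mu"
proof -
  interpret comm_ring_hom h by fact
  have 1: "h (vertex_weight (L_osc t x) j a b e' e) = vertex_weight (L_osc (\<lambda>i. h (t i)) (h x)) j a b e' e" for x j a b e' e
    unfolding vertex_weight_def L_osc_hom[OF h] basis_vec_hom[OF h] ..
  have 2: "h (row_weight (L_osc t x) N q A B r) = row_weight (L_osc (\<lambda>i. h (t i)) (h x)) N (h q) A B r" for x N A B r
    by (simp add: row_weight_def hom_mult hom_prod 1)
  show ?thesis by (simp add: Z_osc_def cylinder_sum_def hom_sum hom_prod 2)
qed

lemma E_op_hom:
  assumes h: "comm_ring_hom h"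
  shows "h (E_op N t q x f I) = E_op N (\<lambda>i. h (t i)) (h q) (h x) (\<lambda>I. h (f I)) I"
proof -
  interpret comm_ring_hom h by fact
  have "h (monodromy (L_osc t x) M a b f I) = monodromy (L_osc (\<lambda>i. h (t i)) (h x)) M a b (\<lambda>I. h (f I)) I" for M a b I
    by (induction M arbitrary: a b I) (simp_all add: hom_sum L_osc_hom[OF h])
  then show ?thesis by (simp add: E_op_def twisted_trace_def hom_add hom_mult)
qed

lemma E_coeff_hom:
  assumes h: "comm_ring_hom h"
  shows "h (E_coeff N t q r f I) = E_coeff N (\<lambda>i. h (t i)) (h q) r (\<lambda>I. h (f I)) I"
proof -
  interpret map_poly_comm_ring_hom h by (rule map_poly_comm_ring_hom.intro[OF h])
  have H: "comm_ring_hom (map_poly h)" by unfold_locales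
  let ?p = "E_op N (\<lambda>j. [:t j:]) [:q:] [:0, 1:] (\<lambda>J. [:f J:]) I"
  have "h (coeff ?p (nat r)) = coeff (map_poly h ?p) (nat r)" by simp
  also have "map_poly h ?p = E_op N (\<lambda>j. [:h (t j):]) [:h q:] [:0, 1:] (\<lambda>J. [:h (f J):]) I"
    unfolding E_op_hom[OF H] by (simp add: base.map_poly_pCons_hom)
  finally show ?thesis by (simp add: E_coeff_def)
qed

lemma S_op_hom:
  assumes h: "comm_ring_hom h"
  shows "h (S_op n k t q lam f I) = S_op n k (\<lambda>i. h (t i)) (h q) lam (\<lambda>I. h (f I)) I"
proof -
  interpret comm_ring_hom h by fact
  have "(\<lambda>I. h (foldr (\<lambda>i. E_coeff N t q (c i)) is f I)) =
      foldr (\<lambda>i. E_coeff N (\<lambda>i. h (t i)) (h q) (c i)) is (\<lambda>I. h (f I))" for N c "is"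
    by (induction "is") (simp_all add: E_coeff_hom[OF h])
  then have F: "h (foldr (\<lambda>i. E_coeff N t q (c i)) is f I) =
      foldr (\<lambda>i. E_coeff N (\<lambda>i. h (t i)) (h q) (c i)) is (\<lambda>I. h (f I)) I" for N c "is"
    by (rule fun_cong)
  show ?thesis by (simp only: S_op_def hom_sum hom_mult hom_of_int F)
qed

lemma S_tilde_hom:
  assumes h: "comm_ring_hom h"
  shows "h (S_tilde n k t q lam (basis_vec J) I) = S_tilde n k (\<lambda>i. h (t i)) (h q) lam (basis_vec J) I"
proof -
  interpret comm_ring_hom h by fact
  have "h (elem_sym r m t) = elem_sym r m (\<lambda>i. h (t i))" for r m
    by (simp add: elem_sym_def hom_sum hom_prod)
  then show ?thesis
    by (simp add: S_tilde_def hom_sum hom_mult hom_power hom_uminus det1_hom[OF h] S_op_hom[OF h] basis_vec_hom[OF h])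
qed

section \<open>Specialisation of the structure constants\<close>

lemma subst_T_superset:
  assumes "finite S" "Poly_Mapping.keys p \<subseteq> S"
  shows "subst_T a p = (\<Sum>e\<in>S. of_int (Poly_Mapping.lookup p e) *
     (\<Prod>i\<in>Poly_Mapping.keys e. a i ^ Poly_Mapping.lookup e i))"
  unfolding subst_T_def
  by (rule sum.mono_neutral_left) (use assms in \<open>auto simp: in_keys_iff\<close>)

lemma subst_T_add: "subst_T a (p + r) = subst_T a p + subst_T a r"
proof -
  let ?S = "Poly_Mapping.keys p \<union> Poly_Mapping.keys r"
  have "Poly_Mapping.keys (p + r) \<subseteq> ?S" by (rule Poly_Mapping.keys_add)
  then show ?thesis
    by (simp add: subst_T_superset[of ?S] lookup_add distrib_right sum.distrib)
qed

lemma subst_T_single: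
  "subst_T a (Poly_Mapping.single e c) =
    of_int c * (\<Prod>i\<in>Poly_Mapping.keys e. a i ^ Poly_Mapping.lookup e i)"
  by (subst subst_T_superset[of "{e}"]) auto

lemma monomial_value_add:
  fixes a :: "nat \<Rightarrow> 'a::comm_ring_1" and e d :: "nat \<Rightarrow>\<^sub>0 nat"
  shows "(\<Prod>i\<in>Poly_Mapping.keys (e + d). a i ^ Poly_Mapping.lookup (e + d) i) =
    (\<Prod>i\<in>Poly_Mapping.keys e. a i ^ Poly_Mapping.lookup e i) *
    (\<Prod>i\<in>Poly_Mapping.keys d. a i ^ Poly_Mapping.lookup d i)"
proof -
  let ?S = "Poly_Mapping.keys e \<union> Poly_Mapping.keys d"
  have eq: "(\<Prod>i\<in>Poly_Mapping.keys c. a i ^ Poly_Mapping.lookup c i) = (\<Prod>i\<in>?S. a i ^ Poly_Mapping.lookup c i)"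
    if "Poly_Mapping.keys c \<subseteq> ?S" for c
    by (rule prod.mono_neutral_left) (use that in \<open>auto simp: in_keys_iff\<close>)
  show ?thesis
    unfolding eq[OF Poly_Mapping.keys_add] eq[OF Un_upper1] eq[OF Un_upper2]
    by (simp add: lookup_add power_add prod.distrib)
qed

lemma poly_mapping_add_induct [case_names zero single add]:
  assumes "P 0" "\<And>e c. P (Poly_Mapping.single e c)" "\<And>p r. P p \<Longrightarrow> P r \<Longrightarrow> P (p + r)"
  shows "P (p :: 'a \<Rightarrow>\<^sub>0 'b::comm_monoid_add)"
proof (induction p rule: update_induct)
  case const
  show ?case by (rule assms(1))
next
  case (update f a b)
  have "Poly_Mapping.update a b f = f + Poly_Mapping.single a b"
    using update(1) by (intro poly_mapping_eqI)
      (auto simp: lookup_update lookup_add lookup_single in_keys_iff when_def)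
  then show ?case using assms(2,3) update by simp
qed

lemma subst_T_mult: "subst_T a (p * r) = subst_T a p * subst_T a r"
proof (induction p rule: poly_mapping_add_induct)
  case zero
  then show ?case by (simp add: subst_T_def)
next
  case (add p p')
  then show ?case by (simp add: distrib_right subst_T_add)
next
  case (single e c)
  show ?case
  proof (induction r rule: poly_mapping_add_induct)
    case zero
    then show ?case by (simp add: subst_T_def)
  next
    case (single d c')
    show ?case by (simp add: mult_single subst_T_single monomial_value_add mult_ac)
  next
    case (add r r')
    then show ?case by (simp add: distrib_left subst_T_add)
  qed
qed

text \<open>Together with the naturality of \<^const>\<open>S_tilde\<close> this evaluates the generating function of the structure
  constants at arbitrary parameters, in \<open>sum_gw\<close>.\<close>

lemma comm_ring_hom_subst_T: "comm_ring_hom (subst_T a)"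
proof
  show "subst_T a 0 = 0" by (simp add: subst_T_def)
  show "subst_T a 1 = 1"
    unfolding single_one[symmetric] subst_T_single by simp
  show "subst_T a (p + r) = subst_T a p + subst_T a r" for p r by (rule subst_T_add)
  show "subst_T a (p * r) = subst_T a p * subst_T a r" for p r by (rule subst_T_mult)
qed

lemma sum_gw:
  fixes a :: "nat \<Rightarrow> 'a::comm_ring_1"
  shows "Sum_any (\<lambda>d. q ^ d * subst_T a (gw n k lam mu nu d)) =
    S_tilde n k (rev_params (n + k) a) q lam (basis_vec (positions n mu)) (positions n nu)"
proof -
  interpret s: comm_ring_hom "subst_T a" by (rule comm_ring_hom_subst_T)
  interpret m: map_poly_comm_ring_hom "subst_T a" ..
  let ?h = "\<lambda>p. poly (map_poly (subst_T a) p) q"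
  have h: "comm_ring_hom ?h" by unfold_locales (simp_all add: m.hom_add m.hom_mult)
  let ?P = "S_tilde n k (rev_params (n + k) (\<lambda>i. [:T_var i:])) [:0, 1:] lam
      (basis_vec (positions n mu)) (positions n nu)"
  have "Sum_any (\<lambda>d. q ^ d * subst_T a (gw n k lam mu nu d)) = (\<Sum>d\<le>degree ?P. q ^ d * subst_T a (coeff ?P d))"
    unfolding gw_def
    by (rule Sum_any.expand_superset) (auto intro: le_degree)
  also have "\<dots> = (\<Sum>d\<le>degree (map_poly (subst_T a) ?P). q ^ d * subst_T a (coeff ?P d))"
    by (rule sum.mono_neutral_right)
      (use degree_map_poly_le[of "subst_T a" ?P] in \<open>auto simp: coeff_eq_0 simp flip: s.coeff_map_poly_hom\<close>)
  also have "\<dots> = ?h ?P"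
    by (simp add: poly_altdef mult.commute)
  also have "\<dots> = S_tilde n k (\<lambda>i. ?h (rev_params (n + k) (\<lambda>i. [:T_var i:]) i)) (?h [:0, 1:]) lam
      (basis_vec (positions n mu)) (positions n nu)"
    by (rule S_tilde_hom[OF h])
  also have "(\<lambda>i. ?h (rev_params (n + k) (\<lambda>i. [:T_var i:]) i)) = rev_params (n + k) a"
    by (auto simp: rev_params_def subst_T_var s.map_poly_pCons_hom)
  also have "?h [:0, 1:] = q" by (simp add: s.map_poly_pCons_hom)
  finally show ?thesis .
qed

section \<open>Solving the Bethe equation in power series\<close>

lemma comm_ring_hom_fps_of_poly: "comm_ring_hom (fps_of_poly :: 'a::comm_ring_1 poly \<Rightarrow> 'a fps)"
  by unfold_locales (simp_all add: fps_of_poly_add fps_of_poly_mult)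

text \<open>In terms of \<open>z = b - t\<^sub>m\<close> the equation reads \<open>G(z) = c q\<close>, where \<open>G\<close> has no constant term and its linear coefficient is the
  product of the differences \<open>t\<^sub>m - t\<^sub>i\<close>.  As this is not zero, \<open>G / c\<close> has a compositional inverse.\<close>

lemma power_series_root:
  fixes t :: "nat \<Rightarrow> 'a::field"
  assumes inj: "inj_on t {1..N}" and m: "m \<in> {1..N}" and c: "c \<noteq> 0"
  shows "\<exists>b. fact_power (\<lambda>i. fps_const (t i)) b N = fps_const c * fps_X \<and> fps_nth b 0 = t m"
proof -
  define G where "G = (\<Prod>i\<in>{1..N}. fps_X + fps_const (t m - t i))"
  define r where "r = (\<Prod>i\<in>{1..N} - {m}. fps_X + fps_const (t m - t i))"
  have G: "G = fps_X * r"
    unfolding G_def r_def by (subst prod.remove[OF _ m]) simp_all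
  have "fps_nth r 0 = (\<Prod>i\<in>{1..N} - {m}. t m - t i)"
  proof -
    have "fps_nth (prod f S) 0 = (\<Prod>i\<in>S. fps_nth (f i) 0)" for f :: "nat \<Rightarrow> 'a fps" and S
      by (induction S rule: infinite_finite_induct) simp_all
    then show ?thesis by (simp add: r_def)
  qed
  also have "\<dots> \<noteq> 0"
  proof -
    have "t m - t i \<noteq> 0" if "i \<in> {1..N} - {m}" for i
      using inj_onD[OF inj, of m i] m that by auto
    then show ?thesis by (simp only: prod_zero_iff finite_Diff finite_atLeastAtMost) blast
  qed
  finally have r0: "fps_nth r 0 \<noteq> 0" .
  define A where "A = fps_const (inverse c) * G"
  have A0: "fps_nth A 0 = 0" and A1: "fps_nth A 1 \<noteq> 0" using r0 c by (simp_all add: A_def G)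
  define z where "z = fps_inv A"
  have z0: "fps_nth z 0 = 0" by (simp add: z_def fps_inv_def)
  have "A oo z = fps_X" unfolding z_def by (rule fps_inv_right[OF A0 A1])
  then have X: "fps_const (inverse c) * (G oo z) = fps_X"
    unfolding A_def by (subst (asm) fps_compose_mult_distrib[OF z0]) simp
  have "fps_const c * fps_const (inverse c) = 1" using c by simp
  then have "G oo z = fps_const c * fps_X"
    unfolding X[symmetric] by (simp only: mult.assoc[symmetric] mult_1)
  moreover have "G oo z = fact_power (\<lambda>i. fps_const (t i)) (z + fps_const (t m)) N"
    unfolding G_def fact_power_def fps_compose_prod_distrib[OF z0]
  proof (rule prod.cong[OF refl])
    fix i
    have "fps_const (t m - t i) = fps_const (t m) - fps_const (t i)" by simp
    then have "z + fps_const (t m - t i) = z + fps_const (t m) - fps_const (t i)"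
      by (simp only: add_diff_eq)
    then show "(fps_X + fps_const (t m - t i)) oo z = z + fps_const (t m) - fps_const (t i)"
      by (simp add: fps_compose_add_distrib z0 del: fps_const_sub)
  qed
  ultimately have "fact_power (\<lambda>i. fps_const (t i)) (z + fps_const (t m)) N = fps_const c * fps_X"
    by simp
  moreover have "fps_nth (z + fps_const (t m)) 0 = t m" using z0 by simp
  ultimately show ?thesis by blast
qed

text \<open>The indeterminate of the power series plays the role of \<open>q\<close>.  The constant terms also serve to keep the
  solutions apart from the variables \<open>x\<close>.\<close>

lemma bethe_solution_exists:
  fixes t :: "nat \<Rightarrow> 'a::field"
  assumes "inj_on t {1..n + k}"
  obtains b where "bethe_solution n k (\<lambda>i. fps_const (t i)) fps_X b"
    and "\<And>m. m \<in> {1..n + k} \<Longrightarrow> fps_nth (b m) 0 = t m"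
proof -
  have "\<forall>m\<in>{1..n + k}. \<exists>b. fact_power (\<lambda>i. fps_const (t i)) b (n + k) = fps_const ((-1) ^ (n - 1)) * fps_X \<and> fps_nth b 0 = t m"
    using power_series_root[OF assms] by simp
  then obtain b where b: "\<And>m. m \<in> {1..n + k} \<Longrightarrow>
      fact_power (\<lambda>i. fps_const (t i)) (b m) (n + k) = fps_const ((-1) ^ (n - 1)) * fps_X \<and> fps_nth (b m) 0 = t m"
    by metis
  have "inj_on b {1..n + k}"
    using assms b by (metis (no_types, lifting) inj_on_def)
  moreover have "fps_const ((-1) ^ (n - 1)) = (-1 :: 'a fps) ^ (n - 1)"
    by (simp flip: fps_const_power fps_const_neg)
  ultimately have "bethe_solution n k (\<lambda>i. fps_const (t i)) fps_X b"
    using b by (simp add: bethe_solution_def)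
  then show ?thesis using b that by blast
qed

section \<open>The expansions over a field\<close>

lemma vandermonde_hom:
  assumes "comm_ring_hom h"
  shows "h (vandermonde n x) = vandermonde n (\<lambda>i. h (x i))"
proof -
  interpret comm_ring_hom h by fact
  show ?thesis by (simp add: det1_hom[OF assms] hom_power)
qed

lemma rev_params_hom: "(\<lambda>i. h (rev_params N t i)) = rev_params N (\<lambda>i. h (t i))"
  by (rule ext) (simp add: rev_params_def)

lemma poly_identity_from_fps:
  fixes p p' :: "'a::comm_ring_1 poly"
  assumes "fps_of_poly p = fps_of_poly p'"
  shows "poly p q = poly p' q"
  using assms by (simp add: fps_of_poly_eq_iff)

text \<open>The identity holds over power series in \<open>q\<close>, with \<open>t\<close> and \<open>x\<close> constant.  As both sides come from
  polynomials in \<open>q\<close>, it holds for polynomials and may be evaluated at any \<open>q\<close>.\<close>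

lemma Z_vic_expansion_field:
  fixes t x :: "nat \<Rightarrow> 'a::field"
  assumes t: "inj_on t {1..n + k}" and n: "0 < n"
    and lam: "lam \<in> box n k" and mu: "mu \<in> box n k"
    and x0: "\<And>i. i \<in> {1..n} \<Longrightarrow> x i \<noteq> 0"
    and xt: "\<And>i m. i \<in> {1..n} \<Longrightarrow> m \<in> {1..n + k} \<Longrightarrow> x i \<noteq> t m"
  shows "(\<Prod>i\<in>{1..n}. x i) ^ k * vandermonde n x * Z_vic n k t q (\<lambda>i. inverse (x i)) lam mu =
    (\<Sum>nu\<in>box n k. alternant n (rev_params (n + k) t) (compl_part k nu) x *
       S_tilde n k t q mu (basis_vec (positions n nu)) (positions n lam))"
proof -
  obtain b where b: "bethe_solution n k (\<lambda>i. fps_const (t i)) fps_X b"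
    and b0: "\<And>m. m \<in> {1..n + k} \<Longrightarrow> fps_nth (b m) 0 = t m"
    by (rule bethe_solution_exists[OF t]) blast
  let ?t = "\<lambda>i. [:t i:]" and ?x = "\<lambda>i. [:x i:]" and ?w = "\<lambda>i. [:inverse (x i):]" and ?q = "[:0, 1:]"
  let ?L = "(\<Prod>i\<in>{1..n}. ?x i) ^ k * vandermonde n ?x * Z_vic n k ?t ?q ?w lam mu"
  let ?R = "\<Sum>nu\<in>box n k. alternant n (rev_params (n + k) ?t) (compl_part k nu) ?x *
       S_tilde n k ?t ?q mu (basis_vec (positions n nu)) (positions n lam)"
  interpret f: comm_ring_hom "fps_of_poly :: 'a poly \<Rightarrow> 'a fps" by (rule comm_ring_hom_fps_of_poly)
  note fh = comm_ring_hom_fps_of_poly and ph = comm_ring_hom_poly[of q]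
  have "fps_of_poly ?L = fps_of_poly ?R"
    unfolding f.hom_mult f.hom_power f.hom_prod f.hom_sum vandermonde_hom[OF fh] Z_vic_hom[OF fh]
      alternant_hom[OF fh] S_tilde_hom[OF fh] rev_params_hom fps_of_poly_const fps_of_poly_fps_X
  proof (rule Z_vic_expansion[OF b n lam mu])
    fix i assume i: "i \<in> {1..n}"
    show "fps_const (x i) * fps_const (inverse (x i)) = 1" using x0[OF i] by simp
    fix m assume m: "m \<in> {1..n + k}"
    show "fps_const (x i) \<noteq> b m" using xt[OF i m] b0[OF m] by (metis fps_nth_fps_const)
  qed
  then have "poly ?L q = poly ?R q" by (rule poly_identity_from_fps)
  then show ?thesis
    unfolding poly_mult poly_power poly_prod poly_sum vandermonde_hom[OF ph] Z_vic_hom[OF ph]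
      alternant_hom[OF ph] S_tilde_hom[OF ph] rev_params_hom[of "\<lambda>p. poly p q"] by simp
qed

lemma conj_part_empty: "conj_part k (replicate n 0) = replicate k 0"
proof (rule box_eqI)
  show c: "conj_part k (replicate n 0) \<in> box k n" by (rule conj_part_box[OF replicate_box[of n k]])
  show "replicate k 0 \<in> box k n" by (rule replicate_box)
  fix j assume j: "j \<in> {1..k}"
  have "\<not> 1 \<le> part (conj_part k (replicate n 0)) j"
  proof
    assume *: "1 \<le> part (conj_part k (replicate n 0)) j"
    then have n1: "1 \<in> {1..n}" using boxD(2)[OF c j] by simp
    show False
      using * part_conj_part_iff[OF replicate_box[of n k] n1 j] part_replicate[OF n1] j by simp
  qed
  then show "part (conj_part k (replicate n 0)) j = part (replicate k 0) j"
    using part_replicate[OF j] by simp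
qed

lemma compl_conj_part:
  assumes "lam \<in> box n k"
  shows "compl_part n (conj_part k lam) = star_part k lam"
  using compl_part_involution[OF star_part_box[OF assms]] by (simp add: compl_star_part[OF assms])

text \<open>Duality reduces the case \<open>\<mu> = \<emptyset>\<close> to \<open>Z_vic_from_empty\<close>.  That lemma needs solutions of the dual Bethe
  equation, whose parameters are \<open>-T\<close> and whose sign is \<open>(-1)\<^bsup>k-1\<^esup>\<close>; they are unrelated to the solutions used for
  \<open>Z_osc_expansion\<close>.\<close>

lemma Z_osc_expansion_field:
  fixes t x :: "nat \<Rightarrow> 'a::field"
  assumes t: "inj_on t {1..n + k}" and n: "0 < n" and k: "0 < k"
    and lam: "lam \<in> box n k" and mu: "mu \<in> box n k"
    and x0: "\<And>i. i \<in> {1..k} \<Longrightarrow> x i \<noteq> 0"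
    and xt: "\<And>i m. i \<in> {1..k} \<Longrightarrow> m \<in> {1..n + k} \<Longrightarrow> x i \<noteq> - t m"
  shows "(\<Prod>i\<in>{1..k}. x i) ^ n * vandermonde k x * Z_osc n k t q (\<lambda>i. inverse (x i)) lam mu =
    (\<Sum>nu\<in>box n k. alternant k (rev_params (n + k) (dual_params (n + k) t)) (star_part k nu) x *
       S_tilde n k t q mu (basis_vec (positions n nu)) (positions n lam))"
proof -
  let ?N = "n + k"
  have mirror: "?N + 1 - m \<in> {1..?N}" if "m \<in> {1..?N}" for m using that by auto
  obtain b where b: "bethe_solution n k (\<lambda>i. fps_const (t i)) fps_X b"
    by (rule bethe_solution_exists[OF t]) blast
  have "inj_on (dual_params ?N t) {1..k + n}"
  proof (rule inj_onI)
    fix i j assume i: "i \<in> {1..k + n}" and j: "j \<in> {1..k + n}" and "dual_params ?N t i = dual_params ?N t j"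
    then have "t (?N + 1 - i) = t (?N + 1 - j)" by (simp add: dual_params_def)
    then have "?N + 1 - i = ?N + 1 - j"
      by (rule inj_onD[OF t]) (use i j in auto)
    then show "i = j" using i j by auto
  qed
  then obtain d where d: "bethe_solution k n (\<lambda>i. fps_const (dual_params ?N t i)) fps_X d"
    and d0: "\<And>m. m \<in> {1..k + n} \<Longrightarrow> fps_nth (d m) 0 = dual_params ?N t m"
    by (rule bethe_solution_exists) blast
  have dual: "(\<lambda>i. fps_const (dual_params ?N t i)) = dual_params ?N (\<lambda>i. fps_const (t i))"
    by (auto simp: dual_params_def)
  let ?t = "\<lambda>i. [:t i:]" and ?x = "\<lambda>i. [:x i:]" and ?w = "\<lambda>i. [:inverse (x i):]" and ?q = "[:0, 1:]"
  let ?L = "(\<Prod>i\<in>{1..k}. ?x i) ^ n * vandermonde k ?x * Z_osc n k ?t ?q ?w lam mu"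
  let ?R = "\<Sum>nu\<in>box n k. alternant k (rev_params ?N (\<lambda>i. [:dual_params ?N t i:])) (star_part k nu) ?x *
       S_tilde n k ?t ?q mu (basis_vec (positions n nu)) (positions n lam)"
  interpret f: comm_ring_hom "fps_of_poly :: 'a poly \<Rightarrow> 'a fps" by (rule comm_ring_hom_fps_of_poly)
  note fh = comm_ring_hom_fps_of_poly and ph = comm_ring_hom_poly[of q]
  have "fps_of_poly ?L = fps_of_poly ?R"
    unfolding f.hom_mult f.hom_power f.hom_prod f.hom_sum vandermonde_hom[OF fh] Z_osc_hom[OF fh]
      alternant_hom[OF fh] S_tilde_hom[OF fh] rev_params_hom fps_of_poly_const fps_of_poly_fps_X
  proof (rule Z_osc_expansion[OF b n lam mu])
    fix nu assume nu: "nu \<in> box n k"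
    have "Z_osc n k (\<lambda>i. fps_const (t i)) fps_X (\<lambda>i. fps_const (inverse (x i))) nu (replicate n 0) =
        Z_vic k n (\<lambda>i. fps_const (dual_params ?N t i)) fps_X (\<lambda>i. fps_const (inverse (x i)))
          (conj_part k nu) (replicate k 0)"
      unfolding dual by (subst Z_osc_dual[OF nu replicate_box]) (use x0 in \<open>auto simp: conj_part_empty\<close>)
    moreover have "(\<Prod>i\<in>{1..k}. fps_const (x i)) ^ n * vandermonde k (\<lambda>i. fps_const (x i)) *
        Z_vic k n (\<lambda>i. fps_const (dual_params ?N t i)) fps_X (\<lambda>i. fps_const (inverse (x i)))
          (conj_part k nu) (replicate k 0) =
        alternant k (rev_params (k + n) (\<lambda>i. fps_const (dual_params ?N t i))) (compl_part n (conj_part k nu)) (\<lambda>i. fps_const (x i))"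
    proof (rule Z_vic_from_empty[OF d k conj_part_box(1)[OF nu]])
      fix i assume i: "i \<in> {1..k}"
      show "fps_const (x i) * fps_const (inverse (x i)) = 1" using x0[OF i] by simp
      fix m assume m: "m \<in> {1..k + n}"
      then have "x i \<noteq> dual_params ?N t m"
        using xt[OF i mirror[of m]] by (simp add: dual_params_def add.commute)
      then show "fps_const (x i) \<noteq> d m" using d0[OF m] by (metis fps_nth_fps_const)
    qed
    ultimately show "(\<Prod>i\<in>{1..k}. fps_const (x i)) ^ n * vandermonde k (\<lambda>i. fps_const (x i)) *
        Z_osc n k (\<lambda>i. fps_const (t i)) fps_X (\<lambda>i. fps_const (inverse (x i))) nu (replicate n 0) =
        alternant k (rev_params ?N (\<lambda>i. fps_const (dual_params ?N t i))) (star_part k nu) (\<lambda>i. fps_const (x i))"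
      by (simp only: compl_conj_part[OF nu] add.commute[of k n])
  qed
  then have "poly ?L q = poly ?R q" by (rule poly_identity_from_fps)
  then show ?thesis
    unfolding poly_mult poly_power poly_prod poly_sum vandermonde_hom[OF ph] Z_osc_hom[OF ph]
      alternant_hom[OF ph] S_tilde_hom[OF ph] rev_params_hom[of "\<lambda>p. poly p q"] by simp
qed

section \<open>Generalised factorial skew Schur functions\<close>

lemma fact_schur_alternant:
  "fact_schur m lam x a = alternant m a lam x / vandermonde m x"
proof -
  have "det1 m (\<lambda>i j. fact_power a (x j) (m - i)) = alternant m a (replicate m 0) x"
    unfolding alternant_def by (rule det1_cong) (simp add: expo_replicate)
  then show ?thesis
    by (simp add: fact_schur_def alternant_def[of m a lam] expo_def alternant_empty)
qed

lemma alternant_params_cong: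
  assumes "lam \<in> box n k" and "\<And>i. i \<in> {1..n + k} \<Longrightarrow> a i = b i"
  shows "alternant n a lam x = alternant n b lam x"
  unfolding alternant_def fact_power_def
proof (intro det1_cong prod.cong refl)
  fix i j r assume "i \<in> {1..n}" "r \<in> {1..expo n lam i}"
  then have "r \<in> {1..n + k}" using expo_less[OF assms(1), of i] by auto
  then show "x j - a r = x j - b r" using assms(2) by simp
qed

lemma rev_rev_params: "i \<in> {1..N} \<Longrightarrow> rev_params N (rev_params N a) i = a i"
  by (auto simp: rev_params_def)

lemma rev_dual_params: "i \<in> {1..N} \<Longrightarrow> rev_params N (dual_params N t) i = - t i"
  by (auto simp: rev_params_def dual_params_def)

lemma dual_params_rev: "dual_params N t = rev_params N (\<lambda>i. - t i)"
  by (rule ext) (simp add: dual_params_def rev_params_def)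

lemma Z_vic_tilde_expansion:
  fixes a x :: "nat \<Rightarrow> 'a::field"
  assumes a: "inj_on a {1..n + k}" and n: "0 < n"
    and lam: "lam \<in> box n k" and mu: "mu \<in> box n k"
    and x: "inj_on x {1..n}" and x0: "\<And>i. i \<in> {1..n} \<Longrightarrow> x i \<noteq> 0"
    and xa: "\<And>i m. i \<in> {1..n} \<Longrightarrow> m \<in> {1..n + k} \<Longrightarrow> x i \<noteq> a m"
  shows "Z_vic_tilde n k (rev_params (n + k) a) q x lam mu = (\<Sum>nu\<in>box n k.
    S_tilde n k (rev_params (n + k) a) q mu (basis_vec (positions n nu)) (positions n lam) *
    fact_schur n (compl_part k nu) x a)"
proof -
  let ?t = "rev_params (n + k) a"
  have mirror: "n + k + 1 - m \<in> {1..n + k}" if "m \<in> {1..n + k}" for m using that by auto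
  have t: "inj_on ?t {1..n + k}"
  proof (rule inj_onI)
    fix i j assume i: "i \<in> {1..n + k}" and j: "j \<in> {1..n + k}" and "?t i = ?t j"
    then have "n + k + 1 - i = n + k + 1 - j"
      by (intro inj_onD[OF a _ mirror[OF i] mirror[OF j]]) (simp add: rev_params_def)
    then show "i = j" using i j by auto
  qed
  have V: "vandermonde n x \<noteq> 0" by (rule vandermonde_nonzero[OF x])
  have "vandermonde n x * Z_vic_tilde n k ?t q x lam mu =
      (\<Prod>i\<in>{1..n}. x i) ^ k * vandermonde n x * Z_vic n k ?t q (\<lambda>i. inverse (x i)) lam mu"
    by (simp add: Z_vic_tilde_def mult_ac)
  also have "\<dots> = (\<Sum>nu\<in>box n k. alternant n (rev_params (n + k) ?t) (compl_part k nu) x *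
       S_tilde n k ?t q mu (basis_vec (positions n nu)) (positions n lam))"
    by (rule Z_vic_expansion_field[OF t n lam mu x0]) (use xa mirror in \<open>auto simp: rev_params_def\<close>)
  also have "\<dots> = vandermonde n x * (\<Sum>nu\<in>box n k.
      S_tilde n k ?t q mu (basis_vec (positions n nu)) (positions n lam) * fact_schur n (compl_part k nu) x a)"
    unfolding sum_distrib_left
  proof (rule sum.cong[OF refl])
    fix nu assume "nu \<in> box n k"
    then have "alternant n (rev_params (n + k) ?t) (compl_part k nu) x = alternant n a (compl_part k nu) x"
      by (intro alternant_params_cong[OF compl_part_box(1)]) (auto simp: rev_rev_params)
    then show "alternant n (rev_params (n + k) ?t) (compl_part k nu) x *
       S_tilde n k ?t q mu (basis_vec (positions n nu)) (positions n lam) = vandermonde n x *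
       (S_tilde n k ?t q mu (basis_vec (positions n nu)) (positions n lam) * fact_schur n (compl_part k nu) x a)"
      using V by (simp add: fact_schur_alternant)
  qed
  finally show ?thesis using V by simp
qed

lemma Z_osc_tilde_expansion:
  fixes t x :: "nat \<Rightarrow> 'a::field"
  assumes t: "inj_on t {1..n + k}" and n: "0 < n" and k: "0 < k"
    and lam: "lam \<in> box n k" and mu: "mu \<in> box n k"
    and x: "inj_on x {1..k}" and x0: "\<And>i. i \<in> {1..k} \<Longrightarrow> x i \<noteq> 0"
    and xt: "\<And>i m. i \<in> {1..k} \<Longrightarrow> m \<in> {1..n + k} \<Longrightarrow> x i \<noteq> - t m"
  shows "Z_osc_tilde n k t q x lam mu = (\<Sum>nu\<in>box n k.
    S_tilde n k t q mu (basis_vec (positions n nu)) (positions n lam) *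
    fact_schur k (star_part k nu) x (\<lambda>i. - t i))"
proof -
  let ?a = "rev_params (n + k) (dual_params (n + k) t)"
  have V: "vandermonde k x \<noteq> 0" by (rule vandermonde_nonzero[OF x])
  have "vandermonde k x * Z_osc_tilde n k t q x lam mu =
      (\<Prod>i\<in>{1..k}. x i) ^ n * vandermonde k x * Z_osc n k t q (\<lambda>i. inverse (x i)) lam mu"
    by (simp add: Z_osc_tilde_def mult_ac)
  also have "\<dots> = (\<Sum>nu\<in>box n k. alternant k ?a (star_part k nu) x *
       S_tilde n k t q mu (basis_vec (positions n nu)) (positions n lam))"
    by (rule Z_osc_expansion_field[OF t n k lam mu x0]) (use xt in auto)
  also have "\<dots> = vandermonde k x * (\<Sum>nu\<in>box n k.
      S_tilde n k t q mu (basis_vec (positions n nu)) (positions n lam) * fact_schur k (star_part k nu) x (\<lambda>i. - t i))"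
    unfolding sum_distrib_left
  proof (rule sum.cong[OF refl])
    fix nu assume "nu \<in> box n k"
    then have "alternant k ?a (star_part k nu) x = alternant k (\<lambda>i. - t i) (star_part k nu) x"
      by (intro alternant_params_cong[OF star_part_box]) (auto simp: rev_dual_params)
    then show "alternant k ?a (star_part k nu) x *
       S_tilde n k t q mu (basis_vec (positions n nu)) (positions n lam) = vandermonde k x *
       (S_tilde n k t q mu (basis_vec (positions n nu)) (positions n lam) * fact_schur k (star_part k nu) x (\<lambda>i. - t i))"
      using V by (simp add: fact_schur_alternant)
  qed
  finally show ?thesis using V by simp
qed

lemma Z_osc_tilde_dual:
  fixes t x :: "nat \<Rightarrow> 'a::field"
  assumes lam: "lam \<in> box n k" and mu: "mu \<in> box n k" and x0: "\<And>i. i \<in> {1..k} \<Longrightarrow> x i \<noteq> 0"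
  shows "Z_osc_tilde n k t q x lam mu =
    Z_vic_tilde k n (rev_params (k + n) (\<lambda>i. - t i)) q x (conj_part k lam) (conj_part k mu)"
proof -
  have "Z_osc n k t q (\<lambda>i. inverse (x i)) lam mu =
      Z_vic k n (rev_params (n + k) (\<lambda>i. - t i)) q (\<lambda>i. inverse (x i)) (conj_part k lam) (conj_part k mu)"
    unfolding dual_params_rev[symmetric] by (rule Z_osc_dual[OF lam mu]) (simp add: x0)
  then show ?thesis
    by (simp only: Z_osc_tilde_def Z_vic_tilde_def add.commute[of n k])
qed

lemma Sum_any_gw_mult:
  fixes a :: "nat \<Rightarrow> 'a::comm_ring_1"
  shows "Sum_any (\<lambda>d. q ^ d * subst_T a (gw n k lam mu nu d) * c) =
    S_tilde n k (rev_params (n + k) a) q lam (basis_vec (positions n mu)) (positions n nu) * c"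
proof -
  have fin: "finite {d. q ^ d * subst_T a (gw n k lam mu nu d) \<noteq> 0}"
    by (rule finite_subset[OF _ finite_gw[of n k lam mu nu]]) (auto simp: subst_T_def)
  show ?thesis unfolding sum_gw[symmetric] Sum_any_left_distrib[OF fin] ..
qed

text \<open>Summing over \<open>d\<close> first assembles the structure constants to matrix elements of \<open>S\<close>-tilde.  The
  complements are then absorbed by reindexing, which brings the sum to the form of the expansions above.\<close>

lemma fact_skew_schur_generating:
  fixes a x :: "nat \<Rightarrow> 'a::field"
  shows "Sum_any (\<lambda>d. q ^ d * fact_skew_schur m l lam d mu x a) =
    (\<Sum>nu\<in>box m l. S_tilde m l (rev_params (m + l) a) q (compl_part l mu)
       (basis_vec (positions m nu)) (positions m (compl_part l lam)) * fact_schur m (compl_part l nu) x a)"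
proof -
  let ?D = "\<Union>nu\<in>box m l. {d. gw m l (compl_part l mu) (compl_part l nu) (compl_part l lam) d \<noteq> 0}"
  let ?f = "\<lambda>nu d. q ^ d * subst_T a (gw m l (compl_part l mu) (compl_part l nu) (compl_part l lam) d) * fact_schur m nu x a"
  have D: "finite ?D" by (auto simp: finite_box finite_gw)
  have zero: "?f nu d = 0" if "nu \<in> box m l" "d \<notin> ?D" for nu d
    using that by (auto simp: subst_T_def)
  have f: "q ^ d * fact_skew_schur m l lam d mu x a = (\<Sum>nu\<in>box m l. ?f nu d)" for d
    by (simp add: fact_skew_schur_def sum_distrib_left mult.assoc)
  have "Sum_any (\<lambda>d. q ^ d * fact_skew_schur m l lam d mu x a) = (\<Sum>d\<in>?D. \<Sum>nu\<in>box m l. ?f nu d)"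
    unfolding f
  proof (rule Sum_any.expand_superset[OF D], rule subsetI)
    fix d assume d: "d \<in> {d. (\<Sum>nu\<in>box m l. ?f nu d) \<noteq> 0}"
    show "d \<in> ?D"
    proof (rule ccontr)
      assume "d \<notin> ?D"
      then have "(\<Sum>nu\<in>box m l. ?f nu d) = 0" by (intro sum.neutral ballI zero)
      with d show False by simp
    qed
  qed
  also have "\<dots> = (\<Sum>nu\<in>box m l. \<Sum>d\<in>?D. ?f nu d)" by (rule sum.swap)
  also have "\<dots> = (\<Sum>nu\<in>box m l. Sum_any (?f nu))"
  proof (rule sum.cong[OF refl])
    fix nu assume nu: "nu \<in> box m l"
    show "(\<Sum>d\<in>?D. ?f nu d) = Sum_any (?f nu)"
      by (rule Sum_any.expand_superset[OF D, symmetric]) (use zero[OF nu] in blast)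
  qed
  also have "\<dots> = (\<Sum>nu\<in>box m l. S_tilde m l (rev_params (m + l) a) q (compl_part l mu)
       (basis_vec (positions m (compl_part l nu))) (positions m (compl_part l lam)) * fact_schur m nu x a)"
    by (simp only: Sum_any_gw_mult)
  also have "\<dots> = (\<Sum>nu\<in>box m l. S_tilde m l (rev_params (m + l) a) q (compl_part l mu)
       (basis_vec (positions m (compl_part l (compl_part l nu)))) (positions m (compl_part l lam)) *
       fact_schur m (compl_part l nu) x a)"
    by (rule sum.reindex_bij_betw[OF bij_betw_compl_part, symmetric])
  also have "\<dots> = (\<Sum>nu\<in>box m l. S_tilde m l (rev_params (m + l) a) q (compl_part l mu)
       (basis_vec (positions m nu)) (positions m (compl_part l lam)) * fact_schur m (compl_part l nu) x a)"
    by (rule sum.cong) (simp_all add: compl_part_involution)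
  finally show ?thesis .
qed

text \<open>This and the next lemmas verify the genericity conditions of the expansions for the indeterminates.\<close>

lemma T_ind_eq_iff: "T_ind i = T_ind j \<longleftrightarrow> i = j"
proof
  assume "T_ind i = T_ind j"
  then have "Poly_Mapping.single (0 :: nat \<Rightarrow>\<^sub>0 nat) [:T_var i:] = Poly_Mapping.single 0 [:T_var j:]"
    by (simp add: T_ind_def)
  then have "[:T_var i:] = [:T_var j:]" by (metis lookup_single_eq)
  then have "T_var i = T_var j" by simp
  then have "Poly_Mapping.lookup (T_var i) (Poly_Mapping.single i 1) = Poly_Mapping.lookup (T_var j) (Poly_Mapping.single i 1)"
    by simp
  then have "Poly_Mapping.single j (1 :: nat) = Poly_Mapping.single i 1"
    by (simp add: T_var_def lookup_single when_def split: if_splits)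
  then have "Poly_Mapping.lookup (Poly_Mapping.single j (1 :: nat)) i = 1" by simp
  then show "i = j" by (simp add: lookup_single when_def split: if_splits)
qed simp

lemma x_monomial_nonzero: "Poly_Mapping.single j (1 :: nat) \<noteq> 0"
  by (metis lookup_single_eq lookup_zero zero_neq_one)

lemma x_ind_eq_iff: "x_ind i = x_ind j \<longleftrightarrow> i = j"
proof
  assume "x_ind i = x_ind j"
  then have "Poly_Mapping.single (Poly_Mapping.single i (1 :: nat)) (1 :: Lam poly) =
      Poly_Mapping.single (Poly_Mapping.single j 1) 1"
    by (simp add: x_ind_def)
  then have "Poly_Mapping.lookup (Poly_Mapping.single (Poly_Mapping.single i (1 :: nat)) (1 :: Lam poly)) (Poly_Mapping.single j 1) = 1"
    by simp
  then have "Poly_Mapping.single i (1 :: nat) = Poly_Mapping.single j 1"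
    by (simp add: lookup_single when_def split: if_splits)
  then have "Poly_Mapping.lookup (Poly_Mapping.single i (1 :: nat)) j = 1" by simp
  then show "i = j" by (simp add: lookup_single when_def split: if_splits)
qed simp

lemma x_ind_neq_coefficient: "x_ind j \<noteq> to_fract (Poly_Mapping.single 0 c)"
proof
  assume "x_ind j = to_fract (Poly_Mapping.single 0 c)"
  then have "Poly_Mapping.single (Poly_Mapping.single j (1 :: nat)) (1 :: Lam poly) = Poly_Mapping.single 0 c"
    by (simp add: x_ind_def)
  then have "Poly_Mapping.lookup (Poly_Mapping.single (0 :: nat \<Rightarrow>\<^sub>0 nat) c) (Poly_Mapping.single j 1) = 1"
    by (metis lookup_single_eq)
  then show False using x_monomial_nonzero[of j] by (simp add: lookup_single when_def split: if_splits)
qed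

lemma x_ind_neq:
  "x_ind j \<noteq> 0" "x_ind j \<noteq> T_ind i" "x_ind j \<noteq> - T_ind i"
proof -
  show "x_ind j \<noteq> 0" using x_ind_neq_coefficient[of j 0] by simp
  show "x_ind j \<noteq> T_ind i" unfolding T_ind_def by (rule x_ind_neq_coefficient)
  have "- T_ind i = to_fract (Poly_Mapping.single 0 (- [:T_var i:]))"
    by (simp only: T_ind_def single_uminus to_fract_uminus)
  then show "x_ind j \<noteq> - T_ind i" by (simp only: x_ind_neq_coefficient not_False_eq_True)
qed

theorem proposition6p25:
  fixes n k N :: nat and lam mu :: "nat list" and t :: "nat \<Rightarrow> rat_fun"
  assumes "0 < n" and "n < N" and "k = N - n"
    and "lam \<in> box n k" and "mu \<in> box n k"
    and "t = rev_params N T_ind"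
  shows "(Z_vic_tilde n k t q_ind x_ind lam mu =
      Sum_any (\<lambda>d. q_ind ^ d *
        fact_skew_schur n k (compl_part k lam) d (compl_part k mu) x_ind T_ind))
    \<and> (Z_osc_tilde n k t q_ind x_ind lam mu =
      Sum_any (\<lambda>d. q_ind ^ d *
        fact_skew_schur k n (star_part k lam) d (star_part k mu) x_ind (\<lambda>i. - t i)))
    \<and> (Z_vic_tilde n k t q_ind x_ind lam mu =
      (\<Sum>nu\<in>box n k. Sum_any (\<lambda>d. q_ind ^ d *
        subst_T T_ind (gw n k mu nu lam d) * fact_schur n (compl_part k nu) x_ind T_ind)))
    \<and> (Z_osc_tilde n k t q_ind x_ind lam mu =
      (\<Sum>nu\<in>box n k. Sum_any (\<lambda>d. q_ind ^ d *
        subst_T T_ind (gw n k mu nu lam d) * fact_schur k (star_part k nu) x_ind (\<lambda>i. - t i))))"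
proof -
  note lam = assms(4) and mu = assms(5)
  have N: "N = n + k" and k: "0 < k" using assms(2,3) by auto
  have t: "t = rev_params (n + k) T_ind" using assms(6) N by simp
  have vic: "Z_vic_tilde n k t q_ind x_ind lam mu = (\<Sum>nu\<in>box n k.
      S_tilde n k t q_ind mu (basis_vec (positions n nu)) (positions n lam) * fact_schur n (compl_part k nu) x_ind T_ind)"
    unfolding t by (rule Z_vic_tilde_expansion[OF _ assms(1) lam mu])
      (auto simp: inj_on_def T_ind_eq_iff x_ind_eq_iff x_ind_neq)
  have inj_t: "inj_on t {1..n + k}"
    by (rule inj_onI) (auto simp: t rev_params_def T_ind_eq_iff)
  have osc: "Z_osc_tilde n k t q_ind x_ind lam mu = (\<Sum>nu\<in>box n k.
      S_tilde n k t q_ind mu (basis_vec (positions n nu)) (positions n lam) *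
      fact_schur k (star_part k nu) x_ind (\<lambda>i. - t i))"
    by (rule Z_osc_tilde_expansion[OF inj_t assms(1) k lam mu])
      (auto simp: inj_on_def x_ind_eq_iff x_ind_neq t rev_params_def)
  note conj_lam = conj_part_box(1)[OF lam] and conj_mu = conj_part_box(1)[OF mu]
  \<comment> \<open>the expansion of the vicious walkers with \<open>n\<close> and \<open>k\<close> exchanged and parameters \<open>-t\<close>\<close>
  have "Z_osc_tilde n k t q_ind x_ind lam mu =
      Z_vic_tilde k n (rev_params (k + n) (\<lambda>i. - t i)) q_ind x_ind (conj_part k lam) (conj_part k mu)"
    by (rule Z_osc_tilde_dual[OF lam mu]) (rule x_ind_neq)
  also have "\<dots> = (\<Sum>nu\<in>box k n. S_tilde k n (rev_params (k + n) (\<lambda>i. - t i)) q_ind (conj_part k mu)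
       (basis_vec (positions k nu)) (positions k (conj_part k lam)) * fact_schur k (compl_part n nu) x_ind (\<lambda>i. - t i))"
  proof (rule Z_vic_tilde_expansion[OF _ k conj_lam conj_mu])
    show "inj_on (\<lambda>i. - t i) {1..k + n}"
    proof (rule inj_onI)
      fix i j assume "i \<in> {1..k + n}" "j \<in> {1..k + n}" "- t i = - t j"
      then show "i = j" by (intro inj_onD[OF inj_t]) auto
    qed
    show "inj_on x_ind {1..k}" by (rule inj_onI) (simp only: x_ind_eq_iff)
    show "x_ind i \<noteq> 0" for i by (rule x_ind_neq)
    show "x_ind i \<noteq> - t m" for i m unfolding t rev_params_def by (rule x_ind_neq)
  qed
  finally have dual: "Z_osc_tilde n k t q_ind x_ind lam mu = Sum_any (\<lambda>d. q_ind ^ d *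
        fact_skew_schur k n (star_part k lam) d (star_part k mu) x_ind (\<lambda>i. - t i))"
    unfolding fact_skew_schur_generating compl_star_part[OF lam] compl_star_part[OF mu] .
  show ?thesis
  proof (intro conjI)
    show "Z_vic_tilde n k t q_ind x_ind lam mu = Sum_any (\<lambda>d. q_ind ^ d *
        fact_skew_schur n k (compl_part k lam) d (compl_part k mu) x_ind T_ind)"
      unfolding fact_skew_schur_generating compl_part_involution[OF lam] compl_part_involution[OF mu] t[symmetric]
      by (rule vic)
    show "Z_vic_tilde n k t q_ind x_ind lam mu = (\<Sum>nu\<in>box n k. Sum_any (\<lambda>d. q_ind ^ d *
        subst_T T_ind (gw n k mu nu lam d) * fact_schur n (compl_part k nu) x_ind T_ind))"
      unfolding Sum_any_gw_mult t[symmetric] by (rule vic)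
    show "Z_osc_tilde n k t q_ind x_ind lam mu = (\<Sum>nu\<in>box n k. Sum_any (\<lambda>d. q_ind ^ d *
        subst_T T_ind (gw n k mu nu lam d) * fact_schur k (star_part k nu) x_ind (\<lambda>i. - t i)))"
      unfolding Sum_any_gw_mult t[symmetric] by (rule osc)
  qed (rule dual)
qed

end
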